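(* Let $k\ge 2$ and let $\Gamma$ be the complete bipartite graph with vertex set $\{s_1,\dots,s_{2k}\}$ and parts $\{s_1,s_3,\dots,s_{2k-1}\}$ and $\{s_2,s_4,\dots,s_{2k}\}$. Let $H<W_\Gamma$ be the cyclic subgroup generated by $s_1s_2\cdots s_{2k}$. Let $\Delta$ be a finite $\Gamma$-partite graph with path connectors and with decomposition $A_1,\dots,A_{2k}$ satisfying $|A_i|\ge 2$ for each $i$. Then the generalization $\overline H$ of $H$ with respect to $\Delta$ and $T=\{s_1s_2\cdots s_{2k}\}$ is a finitely generated, non-quasiconvex, non-normal, free subgroup of the group $W_\Delta$, and $W_\Delta$ is one-ended. Moreover, when $k>2$, $\overline H\cap K$ is not normal in $K$ for any finite-index subgroup $K<W_\Delta$.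
   Context: Right-angled Coxeter group (RACG): for a simplicial graph $\Gamma$ with vertex set $V(\Gamma)$ and edge set $E(\Gamma)$, $W_\Gamma=\langle s\in V(\Gamma) \mid s^2=1 \text{ for all } s\in V(\Gamma),\ st=ts \text{ for all } (s,t)\in E(\Gamma)\rangle$; $V(\Gamma)$ is its standard generating set. Quasiconvexity: a subgroup $H$ of a group $G$ with generating set $S$ is quasiconvex (with respect to $S$) if some finite-radius neighborhood of $H$ in the Cayley graph of $(G,S)$ contains every geodesic connecting a pair of vertices in $H$. Quasiconvexity in a RACG is always with respect to the standard generating set. $\Gamma$-partite graphs: let $\Gamma$ have vertex set $\{s_1,\dots,s_n\}$. A simplicial graph $\Delta$ is $\Gamma$-partite if its vertex set can be partitioned into $n$ non-empty disjoint sets $A_1,\dots,A_n$ (the decomposition of $\Delta$) such that (1) no two vertices of $A_i$ are adjacent; (2) for all $1\le i<j\le n$, the subgraph $\Delta_{ij}$ of $\Delta$ induced by $A_i\cup A_j$ is connected if $s_i$ is adjacent to $s_j$ in $\Gamma$, and otherwise has no edges. $\Delta$ has path connectors if each $\Delta_{ij}$ is either edgeless or a simple path. Generalization of a subgroup: let $\Delta$ be a finite $\Gamma$-partite graph with decomposition $A_1,\dots,A_n$ and let $H<W_\Gamma$ be generated by a finite set $T=\{w_1,\dots,w_m\}$ of words in $V(\Gamma)$. The rose graph $R$ associated to $T$ is the graph with edges labeled by vertices of $\Gamma$ consisting of a base vertex $B$ together with, for each $i$, a cycle of length $|w_i|$ attached at $B$ with label $w_i$. Let $\overline R$ be the graph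 with the same vertices as $R$, obtained by replacing each edge of $R$ labeled $s_i$ by $|A_i|$ parallel edges with the same endpoints, whose labels are in bijection with the elements of $A_i$. Choose a finite set of loops in $\overline R$ based at $B$ which generate $\pi_1(\overline R,B)$, and let $\overline T$ be the set of their labels (the label of an edge path is the word of labels of the edges successively traversed, in whichever direction). The generalization $\overline H$ of $H$ with respect to $\Delta$ and $T$ is the subgroup of $W_\Delta$ generated by $\overline T$; it does not depend on the choice of loops. *)

theory Defs
  imports
    "HOL-Algebra.Generated_Groups"
    "Graph_Theory.Graph_Theory"
begin

section \<open>Groups of words: presentations and fundamental groups\<close>

text \<open>
  The quotient of a set \<open>C\<close> of lists, closed under concatenation, by a congruence \<open>r\<close>.
\<close>

definition word_quotient :: "'a list set \<Rightarrow> ('a list \<times> 'a list) set \<Rightarrow> 'a list set monoid" where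
  "word_quotient C r =
     \<lparr>carrier = C // r,
      monoid.mult = (\<lambda>X Y. \<Union>x\<in>X. \<Union>y\<in>Y. r `` {x @ y}),
      one = r `` {[]}\<rparr>"

lemma word_quotient_group:
  assumes eq: "equiv C r" and nil: "[] \<in> C"
    and app: "\<And>x y. x \<in> C \<Longrightarrow> y \<in> C \<Longrightarrow> x @ y \<in> C"
    and cong: "\<And>x x' y y'. (x, x') \<in> r \<Longrightarrow> (y, y') \<in> r \<Longrightarrow> (x @ y, x' @ y') \<in> r"
    and inv: "\<And>x. x \<in> C \<Longrightarrow> \<exists>y\<in>C. (y @ x, []) \<in> r"
  shows "group (word_quotient C r)"
    and "\<And>x y. x \<in> C \<Longrightarrow> y \<in> C \<Longrightarrow>
           r `` {x} \<otimes>\<^bsub>word_quotient C r\<^esub> r `` {y} = r `` {x @ y}"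
proof -
  let ?W = "word_quotient C r"
  show m: "r `` {x} \<otimes>\<^bsub>?W\<^esub> r `` {y} = r `` {x @ y}" if "x \<in> C" "y \<in> C" for x y
  proof -
    have "r `` {x' @ y'} = r `` {x @ y}" if "x' \<in> r `` {x}" "y' \<in> r `` {y}" for x' y'
      using equiv_class_eq[OF eq cong[of x x' y y']] that by simp
    then have "(\<Union>x'\<in>r `` {x}. \<Union>y'\<in>r `` {y}. r `` {x' @ y'}) =
        (\<Union>x'\<in>r `` {x}. \<Union>y'\<in>r `` {y}. r `` {x @ y})"
      by (intro SUP_cong refl)
    moreover have "r `` {x} \<noteq> {}" "r `` {y} \<noteq> {}"
      using equiv_class_self[OF eq] that by blast+
    ultimately have "(\<Union>x'\<in>r `` {x}. \<Union>y'\<in>r `` {y}. r `` {x' @ y'}) = r `` {x @ y}"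
      by (simp only: UN_constant if_False)
    then show ?thesis by (simp add: word_quotient_def)
  qed
  have c: "carrier ?W = C // r" and o: "\<one>\<^bsub>?W\<^esub> = r `` {[]}"
    by (simp_all add: word_quotient_def)
  show "group ?W"
  proof (rule groupI)
    fix X assume "X \<in> carrier ?W"
    then obtain x where x: "X = r `` {x}" "x \<in> C" by (auto simp: c elim: quotientE)
    show "\<one>\<^bsub>?W\<^esub> \<otimes>\<^bsub>?W\<^esub> X = X" using x m[OF nil] o by simp
    obtain y where y: "y \<in> C" "(y @ x, []) \<in> r" using inv x by blast
    have "r `` {y} \<otimes>\<^bsub>?W\<^esub> X = \<one>\<^bsub>?W\<^esub>"
      using x y m o equiv_class_eq[OF eq] by simp
    moreover have "r `` {y} \<in> carrier ?W" using y c by (simp add: quotientI)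
    ultimately show "\<exists>Y\<in>carrier ?W. Y \<otimes>\<^bsub>?W\<^esub> X = \<one>\<^bsub>?W\<^esub>" by blast
  next
    show "\<one>\<^bsub>?W\<^esub> \<in> carrier ?W" by (simp add: c o nil quotientI)
  next
    fix X Y assume "X \<in> carrier ?W" "Y \<in> carrier ?W"
    then show "X \<otimes>\<^bsub>?W\<^esub> Y \<in> carrier ?W"
      by (auto simp: c m app elim!: quotientE intro!: quotientI)
  next
    fix X Y Z assume "X \<in> carrier ?W" "Y \<in> carrier ?W" "Z \<in> carrier ?W"
    then show "(X \<otimes>\<^bsub>?W\<^esub> Y) \<otimes>\<^bsub>?W\<^esub> Z = X \<otimes>\<^bsub>?W\<^esub> (Y \<otimes>\<^bsub>?W\<^esub> Z)"
      by (auto simp: c m app elim!: quotientE)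
  qed
qed

text \<open>
  \<open>flip\<close> reverses an oriented letter or an oriented edge, so that \<open>inv_word\<close> is both the formal
  inverse of a word (\<open>(x, True)\<close> being the generator \<open>x\<close> and \<open>(x, False)\<close> its formal inverse)
  and the reverse of an edge path.
\<close>

definition flip :: "'a \<times> bool \<Rightarrow> 'a \<times> bool" where
  "flip x = (fst x, \<not> snd x)"

definition inv_word :: "('a \<times> bool) list \<Rightarrow> ('a \<times> bool) list" where
  "inv_word w = rev (map flip w)"

abbreviation signed_words :: "'a set \<Rightarrow> ('a \<times> bool) list set" where
  "signed_words S \<equiv> lists (S \<times> UNIV)"

inductive_set presentation_rel ::
    "'a set \<Rightarrow> ('a \<times> bool) list set \<Rightarrow> (('a \<times> bool) list \<times> ('a \<times> bool) list) set"
  for S R where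
  refl: "w \<in> signed_words S \<Longrightarrow> (w, w) \<in> presentation_rel S R"
| sym: "(v, w) \<in> presentation_rel S R \<Longrightarrow> (w, v) \<in> presentation_rel S R"
| trans: "(u, v) \<in> presentation_rel S R \<Longrightarrow> (v, w) \<in> presentation_rel S R \<Longrightarrow>
    (u, w) \<in> presentation_rel S R"
| cancel: "u \<in> signed_words S \<Longrightarrow> v \<in> signed_words S \<Longrightarrow> x \<in> S \<times> UNIV \<Longrightarrow>
    (u @ [x, flip x] @ v, u @ v) \<in> presentation_rel S R"
| relator: "u \<in> signed_words S \<Longrightarrow> v \<in> signed_words S \<Longrightarrow> r \<in> signed_words S \<Longrightarrow> r \<in> R \<Longrightarrow>
    (u @ r @ v, u @ v) \<in> presentation_rel S R"

definition presented_group ::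
    "'a set \<Rightarrow> ('a \<times> bool) list set \<Rightarrow> ('a \<times> bool) list set monoid" where
  "presented_group S R = word_quotient (signed_words S) (presentation_rel S R)"

definition free_group :: "'a set \<Rightarrow> ('a \<times> bool) list set monoid" where
  "free_group X = presented_group X {}"

lemma presentation_rel_words:
  "(v, w) \<in> presentation_rel S R \<Longrightarrow> v \<in> signed_words S \<and> w \<in> signed_words S"
  by (induction rule: presentation_rel.induct) (auto simp: flip_def)

lemma presentation_rel_context:
  "(v, w) \<in> presentation_rel S R \<Longrightarrow> a \<in> signed_words S \<Longrightarrow> b \<in> signed_words S \<Longrightarrow>
    (a @ v @ b, a @ w @ b) \<in> presentation_rel S R"
proof (induction rule: presentation_rel.induct)
  case (cancel u v x)
  then show ?case using presentation_rel.cancel[of "a @ u" S "v @ b" x R] by simp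
next
  case (relator u v r)
  then show ?case using presentation_rel.relator[of "a @ u" S "v @ b" r R] by simp
next
  case (refl w)
  then show ?case by (intro presentation_rel.refl) auto
qed (blast intro: presentation_rel.sym presentation_rel.trans)+

lemma group_presented_group: "group (presented_group S R)"
  unfolding presented_group_def
proof (rule word_quotient_group)
  show "equiv (signed_words S) (presentation_rel S R)"
    by (rule equivI)
      (auto simp: refl_on_def intro!: presentation_rel.refl symI transI
         dest: presentation_rel_words presentation_rel.sym presentation_rel.trans)
next
  fix x x' y y' assume a: "(x, x') \<in> presentation_rel S R" "(y, y') \<in> presentation_rel S R"
  have "(x @ y, x' @ y) \<in> presentation_rel S R" "(x' @ y, x' @ y') \<in> presentation_rel S R"
    using presentation_rel_context[OF a(1), of "[]" y]
      presentation_rel_context[OF a(2), of x' "[]"] presentation_rel_words[OF a(1)]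
      presentation_rel_words[OF a(2)] by simp_all
  then show "(x @ y, x' @ y') \<in> presentation_rel S R" by (rule presentation_rel.trans)
next
  fix x assume "x \<in> signed_words S"
  then have "inv_word x \<in> signed_words S \<and> (inv_word x @ x, []) \<in> presentation_rel S R"
  proof (induction x)
    case Nil
    then show ?case by (simp add: inv_word_def presentation_rel.refl)
  next
    case (Cons a x)
    have f: "flip (flip a) = a" and fa: "flip a \<in> S \<times> UNIV" using Cons.hyps(1)
      by (auto simp: flip_def)
    have "(inv_word x @ [flip a, flip (flip a)] @ x, inv_word x @ x) \<in> presentation_rel S R"
      using Cons fa by (intro presentation_rel.cancel) auto
    then show ?case using Cons fa f
      by (auto simp: inv_word_def intro: presentation_rel.trans)
  qed
  then show "\<exists>y\<in>signed_words S. (y @ x, []) \<in> presentation_rel S R" by blast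
qed auto

section \<open>Group properties\<close>

definition finitely_generated :: "('g, 'm) monoid_scheme \<Rightarrow> bool" where
  "finitely_generated G \<longleftrightarrow> (\<exists>S. finite S \<and> S \<subseteq> carrier G \<and> generate G S = carrier G)"

text \<open>A basis of a free group may be taken inside the group, so the type of \<open>X\<close> is no restriction.\<close>

definition is_free :: "('g, 'm) monoid_scheme \<Rightarrow> bool" where
  "is_free G \<longleftrightarrow> (\<exists>X. X \<subseteq> carrier G \<and> free_group X \<cong> G)"

definition finite_index :: "'g set \<Rightarrow> ('g, 'm) monoid_scheme \<Rightarrow> bool" where
  "finite_index K G \<longleftrightarrow> finite (rcosets\<^bsub>G\<^esub> K)"

text \<open>An edge of the (undirected) Cayley graph is a pair of opposite arcs.\<close>

definition cayley_graph ::
    "('g, 'm) monoid_scheme \<Rightarrow> 'g set \<Rightarrow> 'g pair_pre_digraph" where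
  "cayley_graph G S =
     \<lparr>pverts = carrier G,
      parcs = {(g, h). g \<in> carrier G \<and> h \<in> carrier G \<and>
                 (\<exists>s\<in>S. h = g \<otimes>\<^bsub>G\<^esub> s \<or> g = h \<otimes>\<^bsub>G\<^esub> s)}\<rparr>"

definition geodesic :: "('v, 'e) pre_digraph \<Rightarrow> 'v \<Rightarrow> 'e awalk \<Rightarrow> 'v \<Rightarrow> bool" where
  "geodesic X u p v \<longleftrightarrow>
     pre_digraph.awalk X u p v \<and> (\<forall>q. pre_digraph.awalk X u q v \<longrightarrow> length p \<le> length q)"

definition quasiconvex :: "('g, 'm) monoid_scheme \<Rightarrow> 'g set \<Rightarrow> 'g set \<Rightarrow> bool" where
  "quasiconvex G S H \<longleftrightarrow>
     (let X = with_proj (cayley_graph G S) in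
      \<exists>N. \<forall>g\<in>H. \<forall>h\<in>H. \<forall>p. geodesic X g p h \<longrightarrow>
        (\<forall>x\<in>set (pre_digraph.awalk_verts X g p).
           \<exists>h'\<in>H. \<exists>q. pre_digraph.awalk X h' q x \<and> length q \<le> N))"

text \<open>
  For connected locally finite graphs. As all arcs here have opposites, strongly connected
  components are connected components. The empty set \<open>F\<close> forces the graph to be infinite.
\<close>

definition one_ended_graph :: "('v, 'e) pre_digraph \<Rightarrow> bool" where
  "one_ended_graph X \<longleftrightarrow>
     (\<forall>F. finite F \<and> F \<subseteq> verts X \<longrightarrow>
        (\<exists>!C. C \<in> pre_digraph.sccs_verts (X \<restriction> (verts X - F)) \<and> infinite C))"

text \<open>For Cayley graphs of finite generating sets, one-endedness does not depend on that set.\<close>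

definition one_ended :: "('g, 'm) monoid_scheme \<Rightarrow> bool" where
  "one_ended G \<longleftrightarrow>
     (\<exists>S. finite S \<and> S \<subseteq> carrier G \<and> generate G S = carrier G \<and>
        one_ended_graph (with_proj (cayley_graph G S)))"

section \<open>Right-angled Coxeter groups\<close>

definition racg_relators :: "'a pair_pre_digraph \<Rightarrow> ('a \<times> bool) list set" where
  "racg_relators \<Gamma> =
     {[(s, True), (s, True)] | s. s \<in> pverts \<Gamma>} \<union>
     {[(s, True), (t, True), (s, False), (t, False)] | s t. (s, t) \<in> parcs \<Gamma>}"

definition racg :: "'a pair_pre_digraph \<Rightarrow> ('a \<times> bool) list set monoid" where
  "racg \<Gamma> = presented_group (pverts \<Gamma>) (racg_relators \<Gamma>)"

definition racg_elem :: "'a pair_pre_digraph \<Rightarrow> 'a list \<Rightarrow> ('a \<times> bool) list set" where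
  "racg_elem \<Gamma> w =
     presentation_rel (pverts \<Gamma>) (racg_relators \<Gamma>) `` {map (\<lambda>s. (s, True)) w}"

definition racg_gens :: "'a pair_pre_digraph \<Rightarrow> ('a \<times> bool) list set set" where
  "racg_gens \<Gamma> = (\<lambda>s. racg_elem \<Gamma> [s]) ` pverts \<Gamma>"

lemma group_racg: "group (racg \<Gamma>)"
  by (simp add: racg_def group_presented_group)

section \<open>Partite graphs\<close>

definition complete_bipartite :: "'a set \<Rightarrow> 'a set \<Rightarrow> 'a pair_pre_digraph" where
  "complete_bipartite X Y = \<lparr>pverts = X \<union> Y, parcs = X \<times> Y \<union> Y \<times> X\<rparr>"

text \<open>The decomposition is indexed by the vertices of \<open>\<Gamma>\<close>: \<open>A s\<^sub>i\<close> is the part \<open>A\<^sub>i\<close>.\<close>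

definition partite ::
    "'a pair_pre_digraph \<Rightarrow> 'b pair_pre_digraph \<Rightarrow> ('a \<Rightarrow> 'b set) \<Rightarrow> bool" where
  "partite \<Gamma> \<Delta> A \<longleftrightarrow>
     pverts \<Delta> = (\<Union>s\<in>pverts \<Gamma>. A s) \<and>
     (\<forall>s\<in>pverts \<Gamma>. A s \<noteq> {}) \<and>
     (\<forall>s\<in>pverts \<Gamma>. \<forall>t\<in>pverts \<Gamma>. s \<noteq> t \<longrightarrow> A s \<inter> A t = {}) \<and>
     (\<forall>s\<in>pverts \<Gamma>. \<forall>x\<in>A s. \<forall>y\<in>A s. (x, y) \<notin> parcs \<Delta>) \<and>
     (\<forall>s\<in>pverts \<Gamma>. \<forall>t\<in>pverts \<Gamma>. s \<noteq> t \<longrightarrow>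
        (if (s, t) \<in> parcs \<Gamma> then connected (with_proj \<Delta> \<restriction> (A s \<union> A t))
         else arcs (with_proj \<Delta> \<restriction> (A s \<union> A t)) = {}))"

definition simple_path_graph :: "('v, 'e) pre_digraph \<Rightarrow> bool" where
  "simple_path_graph X \<longleftrightarrow>
     (\<exists>vs. vs \<noteq> [] \<and> distinct vs \<and> verts X = set vs \<and>
        arcs_ends X = (\<Union>i\<in>{i. Suc i < length vs}. {(vs ! i, vs ! Suc i), (vs ! Suc i, vs ! i)}))"

definition path_connectors ::
    "'a pair_pre_digraph \<Rightarrow> 'b pair_pre_digraph \<Rightarrow> ('a \<Rightarrow> 'b set) \<Rightarrow> bool" where
  "path_connectors \<Gamma> \<Delta> A \<longleftrightarrow>
     (\<forall>s\<in>pverts \<Gamma>. \<forall>t\<in>pverts \<Gamma>. s \<noteq> t \<longrightarrow>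
        arcs (with_proj \<Delta> \<restriction> (A s \<union> A t)) = {} \<or>
        simple_path_graph (with_proj \<Delta> \<restriction> (A s \<union> A t)))"

section \<open>Edge-labelled graphs and their fundamental groups\<close>

text \<open>
  Edges are arcs with an arbitrary fixed direction; edge paths may traverse them in either
  direction and are therefore walks in the following graph.
\<close>

definition oriented :: "('v, 'e, 'm) pre_digraph_scheme \<Rightarrow> ('v, 'e \<times> bool) pre_digraph" where
  "oriented X =
     \<lparr>verts = verts X, arcs = arcs X \<times> UNIV,
      tail = (\<lambda>(e, d). if d then tail X e else head X e),
      head = (\<lambda>(e, d). if d then head X e else tail X e)\<rparr>"

abbreviation edge_path ::
    "('v, 'e, 'm) pre_digraph_scheme \<Rightarrow> 'v \<Rightarrow> ('e \<times> bool) list \<Rightarrow> 'v \<Rightarrow> bool" where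
  "edge_path X \<equiv> pre_digraph.awalk (oriented X)"

definition loops_at :: "('v, 'e, 'm) pre_digraph_scheme \<Rightarrow> 'v \<Rightarrow> ('e \<times> bool) list set" where
  "loops_at X b = {p. edge_path X b p b}"

inductive_set loop_homotopy ::
    "('v, 'e, 'm) pre_digraph_scheme \<Rightarrow> 'v \<Rightarrow> (('e \<times> bool) list \<times> ('e \<times> bool) list) set"
  for X b where
  refl: "p \<in> loops_at X b \<Longrightarrow> (p, p) \<in> loop_homotopy X b"
| sym: "(p, q) \<in> loop_homotopy X b \<Longrightarrow> (q, p) \<in> loop_homotopy X b"
| trans: "(p, q) \<in> loop_homotopy X b \<Longrightarrow> (q, r) \<in> loop_homotopy X b \<Longrightarrow>
    (p, r) \<in> loop_homotopy X b"
| backtrack: "p @ [x, flip x] @ q \<in> loops_at X b \<Longrightarrow> p @ q \<in> loops_at X b \<Longrightarrow>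
    (p @ [x, flip x] @ q, p @ q) \<in> loop_homotopy X b"

definition fundamental_group ::
    "('v, 'e, 'm) pre_digraph_scheme \<Rightarrow> 'v \<Rightarrow> ('e \<times> bool) list set monoid" where
  "fundamental_group X b = word_quotient (loops_at X b) (loop_homotopy X b)"

definition generates_fundamental_group ::
    "('v, 'e, 'm) pre_digraph_scheme \<Rightarrow> 'v \<Rightarrow> ('e \<times> bool) list set \<Rightarrow> bool" where
  "generates_fundamental_group X b L \<longleftrightarrow>
     L \<subseteq> loops_at X b \<and>
     generate (fundamental_group X b) ((\<lambda>p. loop_homotopy X b `` {p}) ` L) =
       carrier (fundamental_group X b)"

lemma flip_flip [simp]: "flip (flip x) = x"
  by (simp add: flip_def)

lemma oriented_simps [simp]:
  "verts (oriented X) = verts X"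
  "flip x \<in> arcs (oriented X) \<longleftrightarrow> x \<in> arcs (oriented X)"
  "tail (oriented X) (flip x) = head (oriented X) x"
  "head (oriented X) (flip x) = tail (oriented X) x"
  by (auto simp: oriented_def flip_def mem_Times_iff split: prod.splits)

lemma edge_path_inv_word:
  assumes "wf_digraph (oriented X)" "edge_path X u p v"
  shows "edge_path X v (inv_word p) u"
proof -
  interpret wf_digraph "oriented X" by (rule assms(1))
  show ?thesis using assms(2)
  proof (induction p arbitrary: u)
    case Nil
    then show ?case by (auto simp: inv_word_def awalk_Nil_iff)
  next
    case (Cons x p)
    then have "x \<in> arcs (oriented X)" "u = tail (oriented X) x"
      "awalk v (inv_word p) (head (oriented X) x)"
      by (auto simp: awalk_Cons_iff)
    moreover from this have "awalk (head (oriented X) x) [flip x] u"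
      using wellformed(1)[of x] by (simp add: awalk_Cons_iff awalk_Nil_iff)
    ultimately show ?case by (auto simp: inv_word_def intro: awalk_appendI)
  qed
qed

lemma loop_homotopy_cancel:
  assumes "wf_digraph (oriented X)"
    "edge_path X b p u" "edge_path X v w u" "edge_path X u q b"
  shows "(p @ inv_word w @ w @ q, p @ q) \<in> loop_homotopy X b"
proof -
  interpret wf_digraph "oriented X" by (rule assms(1))
  show ?thesis using assms(3)
  proof (induction w arbitrary: v)
    case Nil
    have "p @ q \<in> loops_at X b" using assms(2,4) by (auto simp: loops_at_def)
    then show ?case by (simp add: inv_word_def loop_homotopy.refl)
  next
    case (Cons x w)
    then have w: "awalk (head (oriented X) x) w u" "awalk (tail (oriented X) x) (x # w) u"
      by (auto simp: awalk_Cons_iff)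
    note i = w[THEN edge_path_inv_word[OF assms(1)]]
    have "p @ inv_word w @ w @ q \<in> loops_at X b"
      "p @ inv_word (x # w) @ (x # w) @ q \<in> loops_at X b"
      using w i assms(2,4) by (auto simp: loops_at_def intro!: awalk_appendI simp del: append_Cons)
    then have "(p @ inv_word (x # w) @ (x # w) @ q, p @ inv_word w @ w @ q) \<in> loop_homotopy X b"
      using loop_homotopy.backtrack[of "p @ inv_word w" "flip x" "w @ q" X b]
      by (simp add: inv_word_def)
    then show ?case using Cons.IH[OF w(1)] by (rule loop_homotopy.trans)
  qed
qed

lemma loop_homotopy_loops:
  "(p, q) \<in> loop_homotopy X b \<Longrightarrow> p \<in> loops_at X b \<and> q \<in> loops_at X b"
  by (induction rule: loop_homotopy.induct) auto

lemma loop_homotopy_context: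
  assumes "wf_digraph (oriented X)" "(p, q) \<in> loop_homotopy X b"
    "r \<in> loops_at X b" "s \<in> loops_at X b"
  shows "(r @ p @ s, r @ q @ s) \<in> loop_homotopy X b"
proof -
  interpret wf_digraph "oriented X" by (rule assms(1))
  have l: "r @ p @ s \<in> loops_at X b" if "p \<in> loops_at X b" for p
    using that assms(3,4) by (auto simp: loops_at_def intro!: awalk_appendI)
  show ?thesis using assms(2)
  proof (induction rule: loop_homotopy.induct)
    case (backtrack p x q)
    then show ?case
      using loop_homotopy.backtrack[of "r @ p" x "q @ s" X b] l[of "p @ [x, flip x] @ q"] l[of "p @ q"]
      by simp
  qed (auto intro: loop_homotopy.refl loop_homotopy.sym loop_homotopy.trans l)
qed

lemma equiv_loop_homotopy: "equiv (loops_at X b) (loop_homotopy X b)"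
  by (rule equivI)
    (auto simp: refl_on_def intro!: loop_homotopy.refl symI transI
       dest: loop_homotopy_loops loop_homotopy.sym loop_homotopy.trans)

lemma
  assumes wf: "wf_digraph (oriented X)" and b: "b \<in> verts X"
  shows group_fundamental_group: "group (fundamental_group X b)"
    and fundamental_group_mult:
      "\<And>p q. p \<in> loops_at X b \<Longrightarrow> q \<in> loops_at X b \<Longrightarrow>
         loop_homotopy X b `` {p} \<otimes>\<^bsub>fundamental_group X b\<^esub> loop_homotopy X b `` {q} =
         loop_homotopy X b `` {p @ q}"
proof -
  interpret wf_digraph "oriented X" by (rule wf)
  have n: "[] \<in> loops_at X b"
    using b by (simp add: loops_at_def awalk_Nil_iff)
  have app: "p @ q \<in> loops_at X b" if "p \<in> loops_at X b" "q \<in> loops_at X b" for p q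
    using that by (auto simp: loops_at_def)
  have cong: "(p @ q, p' @ q') \<in> loop_homotopy X b"
    if h: "(p, p') \<in> loop_homotopy X b" "(q, q') \<in> loop_homotopy X b" for p p' q q'
    using loop_homotopy_context[OF wf h(1) n, of q] loop_homotopy_context[OF wf h(2) _ n, of p']
      loop_homotopy_loops[OF h(1)] loop_homotopy_loops[OF h(2)]
    by (auto intro: loop_homotopy.trans)
  have inv: "\<exists>q\<in>loops_at X b. (q @ p, []) \<in> loop_homotopy X b" if "p \<in> loops_at X b" for p
    using loop_homotopy_cancel[OF wf, of b "[]" b b p "[]"] edge_path_inv_word[OF wf, of b p b] n that
    by (auto simp: loops_at_def)
  show "group (fundamental_group X b)"
    "\<And>p q. p \<in> loops_at X b \<Longrightarrow> q \<in> loops_at X b \<Longrightarrow>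
         loop_homotopy X b `` {p} \<otimes>\<^bsub>fundamental_group X b\<^esub> loop_homotopy X b `` {q} =
         loop_homotopy X b `` {p @ q}"
    unfolding fundamental_group_def
    using word_quotient_group[OF equiv_loop_homotopy n app cong inv] by blast+
qed

text \<open>
  Finitely generated: one loop for each oriented edge \<open>x\<close>, through \<open>x\<close> and returning to \<open>b\<close> along
  chosen paths.
\<close>

lemma finite_generates_fundamental_group:
  assumes wf: "wf_digraph (oriented X)" and b: "b \<in> verts X" and fin: "finite (arcs X)"
    and conn: "\<And>v. v \<in> verts X \<Longrightarrow> \<exists>p. edge_path X b p v"
  shows "\<exists>L. finite L \<and> generates_fundamental_group X b L"
proof -
  interpret wf_digraph "oriented X" by (rule wf)
  interpret F: group "fundamental_group X b" by (rule group_fundamental_group[OF wf b])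
  note m = fundamental_group_mult[OF wf b]
  let ?c = "\<lambda>p. loop_homotopy X b `` {p}"
  have n: "edge_path X b [] b" using b by (simp add: awalk_Nil_iff)
  have "\<forall>v. \<exists>p. v \<in> verts X \<longrightarrow> edge_path X b p v \<and> (v = b \<longrightarrow> p = [])"
    using conn n by metis
  then obtain P where P: "\<And>v. v \<in> verts X \<Longrightarrow> edge_path X b (P v) v" "P b = []"
    using b by metis
  define l where "l x = P (tail (oriented X) x) @ [x] @ inv_word (P (head (oriented X) x))" for x
  define L where "L = l ` arcs (oriented X)"
  have l: "l x \<in> loops_at X b" if "x \<in> arcs (oriented X)" for x
  proof -
    have "tail (oriented X) x \<in> verts X" "head (oriented X) x \<in> verts X"
      using that wellformed[of x] by auto
    then have "edge_path X b (P (tail (oriented X) x)) (tail (oriented X) x)"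
      "edge_path X (tail (oriented X) x) ([x] @ inv_word (P (head (oriented X) x))) b"
      using that P(1) edge_path_inv_word[OF wf P(1)] by (auto simp: awalk_Cons_iff)
    then show ?thesis unfolding l_def loops_at_def by (blast intro: awalk_appendI)
  qed
  have c: "carrier (fundamental_group X b) = ?c ` loops_at X b"
    by (auto simp: fundamental_group_def word_quotient_def quotient_def)
  have gen: "?c (p @ inv_word (P v)) \<in> generate (fundamental_group X b) (?c ` L)"
    if "edge_path X b p v" for p v
    using that
  proof (induction p arbitrary: v rule: rev_induct)
    case Nil
    then have "v = b" by (simp add: awalk_Nil_iff)
    moreover have "?c [] = \<one>\<^bsub>fundamental_group X b\<^esub>"
      by (simp add: fundamental_group_def word_quotient_def)
    ultimately show ?case using P(2) by (simp add: inv_word_def generate.one)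
  next
    case (snoc x p)
    define t where "t = tail (oriented X) x"
    have x: "x \<in> arcs (oriented X)" "v = head (oriented X) x" and p: "edge_path X b p t"
      using snoc.prems by (auto simp: awalk_Cons_iff awalk_Nil_iff t_def)
    have tv: "t \<in> verts X" "v \<in> verts X" using x wellformed[of x] by (auto simp: t_def)
    have 1: "p @ inv_word (P t) \<in> loops_at X b"
      using p edge_path_inv_word[OF wf P(1)[OF tv(1)]] by (auto simp: loops_at_def)
    have 2: "edge_path X t ([x] @ inv_word (P v)) b"
      using x edge_path_inv_word[OF wf P(1)[OF tv(2)]] by (auto simp: awalk_Cons_iff t_def)
    have "?c (p @ inv_word (P t)) \<otimes>\<^bsub>fundamental_group X b\<^esub> ?c (l x) =
      ?c (p @ inv_word (P t) @ P t @ [x] @ inv_word (P v))"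
      using m[OF 1 l[OF x(1)]] by (simp add: l_def t_def x)
    also have "\<dots> = ?c ((p @ [x]) @ inv_word (P v))"
      using equiv_class_eq[OF equiv_loop_homotopy loop_homotopy_cancel[OF wf p P(1)[OF tv(1)] 2]]
      by simp
    finally show ?case
      using generate.eng[OF snoc.IH[OF p], of "?c (l x)"] x(1)
      by (simp add: L_def generate.incl)
  qed
  have L: "L \<subseteq> loops_at X b" using l by (auto simp: L_def)
  have "?c p \<in> generate (fundamental_group X b) (?c ` L)" if "p \<in> loops_at X b" for p
    using gen[of p b] that P(2) by (simp add: loops_at_def inv_word_def)
  moreover have "generate (fundamental_group X b) (?c ` L) \<subseteq> carrier (fundamental_group X b)"
    using L c by (intro F.generate_incl) auto
  ultimately have "generates_fundamental_group X b L"
    using L c by (auto simp: generates_fundamental_group_def)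
  moreover have "finite L" using fin by (simp add: L_def oriented_def)
  ultimately show ?thesis by blast
qed

record ('v, 'e, 'l) labelled_graph = "('v, 'e) pre_digraph" +
  label :: "'e \<Rightarrow> 'l"

definition path_label :: "('v, 'e, 'l) labelled_graph \<Rightarrow> ('e \<times> bool) list \<Rightarrow> 'l list" where
  "path_label X p = map (\<lambda>x. label X (fst x)) p"

section \<open>Generalizations of subgroups\<close>

text \<open>
  The \<open>j\<close>-th edge of the cycle of the word \<open>w\<close> is \<open>(w, j)\<close>; it joins the vertices number \<open>j\<close> and
  \<open>Suc j\<close> of this cycle, of which those numbered \<open>0\<close> and \<open>length w\<close> are the base vertex.
\<close>

datatype 'a rose_vertex = Base | Inner "'a list" nat

definition petal_vertex :: "'a list \<Rightarrow> nat \<Rightarrow> 'a rose_vertex" where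
  "petal_vertex w j = (if j = 0 \<or> j = length w then Base else Inner w j)"

definition rose_graph ::
    "'a list set \<Rightarrow> ('a rose_vertex, 'a list \<times> nat, 'a) labelled_graph" where
  "rose_graph T =
     \<lparr>verts = insert Base {petal_vertex w j | w j. w \<in> T \<and> j \<le> length w},
      arcs = {(w, j). w \<in> T \<and> j < length w},
      tail = (\<lambda>(w, j). petal_vertex w j),
      head = (\<lambda>(w, j). petal_vertex w (Suc j)),
      label = (\<lambda>(w, j). w ! j)\<rparr>"

definition expand_labels ::
    "('a \<Rightarrow> 'b set) \<Rightarrow> ('v, 'e, 'a) labelled_graph \<Rightarrow> ('v, 'e \<times> 'b, 'b) labelled_graph" where
  "expand_labels A R =
     \<lparr>verts = verts R,
      arcs = {(e, a). e \<in> arcs R \<and> a \<in> A (label R e)},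
      tail = (\<lambda>(e, a). tail R e),
      head = (\<lambda>(e, a). head R e),
      label = snd\<rparr>"

text \<open>
  \<open>H'\<close> is the generalization of \<open>H\<close> with respect to \<open>\<Delta>\<close> (with decomposition \<open>A\<close>) and \<open>T\<close>. It is
  a predicate in \<open>H'\<close> because of the choice of the loops \<open>L\<close>; statements about every such \<open>H'\<close> hold
  for every choice. Some choice is possible by \<open>generalization_exists\<close> below.
\<close>

definition is_generalization ::
    "'a pair_pre_digraph \<Rightarrow> ('a \<times> bool) list set set \<Rightarrow> 'a list set \<Rightarrow>
     'b pair_pre_digraph \<Rightarrow> ('a \<Rightarrow> 'b set) \<Rightarrow> ('b \<times> bool) list set set \<Rightarrow> bool" where
  "is_generalization \<Gamma> H T \<Delta> A H' \<longleftrightarrow>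
     partite \<Gamma> \<Delta> A \<and>
     finite T \<and> T \<subseteq> lists (pverts \<Gamma>) \<and> H = generate (racg \<Gamma>) (racg_elem \<Gamma> ` T) \<and>
     (let R' = expand_labels A (rose_graph T) in
      \<exists>L. finite L \<and> generates_fundamental_group R' Base L \<and>
        H' = generate (racg \<Delta>) (racg_elem \<Delta> ` path_label R' ` L))"

lemma generalization_exists:
  assumes "partite \<Gamma> \<Delta> A" "finite T" "T \<subseteq> lists (pverts \<Gamma>)" "finite (pverts \<Delta>)"
  shows "\<exists>H'. is_generalization \<Gamma> (generate (racg \<Gamma>) (racg_elem \<Gamma> ` T)) T \<Delta> A H'"
proof -
  let ?X = "expand_labels A (rose_graph T)"
  note defs = oriented_def expand_labels_def rose_graph_def
  have wf: "wf_digraph (oriented ?X)"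
    by unfold_locales (force simp: defs split: if_splits)+
  then interpret wf_digraph "oriented ?X" .
  have A: "w ! j \<in> pverts \<Gamma>" if "w \<in> T" "j < length w" for w j
    using assms(3) that by auto
  have base: "Base \<in> verts ?X" by (simp add: defs)
  have "arcs ?X \<subseteq> (SIGMA w:T. {..<length w}) \<times> pverts \<Delta>"
    using assms(1) A by (auto simp: defs partite_def)
  moreover have "finite ((SIGMA w:T. {..<length w}) \<times> pverts \<Delta>)"
    using assms(2,4) by (intro finite_SigmaI) auto
  ultimately have fin: "finite (arcs ?X)" by (rule finite_subset)
  have petal: "\<exists>p. edge_path ?X Base p (petal_vertex w j)" if w: "w \<in> T" "j \<le> length w" for w j
    using w(2)
  proof (induction j)
    case 0
    have "edge_path ?X Base [] (petal_vertex w 0)"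
      using base by (simp add: awalk_Nil_iff petal_vertex_def)
    then show ?case by blast
  next
    case (Suc j)
    then obtain p where p: "edge_path ?X Base p (petal_vertex w j)" by auto
    have "A s \<noteq> {}" if "s \<in> pverts \<Gamma>" for s
      using assms(1) that by (simp add: partite_def)
    then obtain a where a: "a \<in> A (w ! j)"
      using A[of w j] w(1) Suc.prems by (metis Suc_le_eq ex_in_conv)
    define x where "x = (((w, j), a), True)"
    have "x \<in> arcs (oriented ?X)" "tail (oriented ?X) x = petal_vertex w j"
      "head (oriented ?X) x = petal_vertex w (Suc j)"
      using a w(1) Suc.prems by (simp_all add: x_def defs)
    then have "edge_path ?X (petal_vertex w j) [x] (petal_vertex w (Suc j))"
      using wellformed(2)[of x] by (simp add: awalk_Cons_iff awalk_Nil_iff)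
    then show ?case using p awalk_appendI by blast
  qed
  have "\<exists>p. edge_path ?X Base p v" if "v \<in> verts ?X" for v
  proof (cases "v = Base")
    case True
    have "edge_path ?X Base [] Base" using base by (simp add: awalk_Nil_iff)
    then show ?thesis using True by blast
  next
    case False
    then show ?thesis using that petal by (auto simp: defs)
  qed
  then obtain L where "finite L" "generates_fundamental_group ?X Base L"
    using finite_generates_fundamental_group[OF wf base fin] by blast
  then show ?thesis
    using assms unfolding is_generalization_def Let_def by blast
qed

end

theory Submission
  imports Defs
begin

text \<open>
  Let \<open>n = 2 k\<close>. The graph whose loops define the generalization is a cycle of length \<open>n\<close> in
  which the edge from one vertex to the next is replaced by parallel edges, labelled by one part of
  the decomposition. In its infinite cyclic cover the vertices are the integers, and the
  generalization consists of the elements represented by labels of walks from \<open>0\<close> to multiples of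
  \<open>n\<close> (\<open>generate_loop_labels\<close>, \<open>rose_loops_walks\<close>).

  Draw this cover as a staircase in the integer grid, even steps being horizontal and odd ones
  vertical, and let all horizontal edges in one column and all vertical edges in one row carry the
  same parallel labels. Parts that meet at a corner of the grid belong to the two sides of the
  bipartite graph, and adjacent labels bound a square. Filling in a square of the grid at two
  consecutive sides that are already present adds the other two sides and a square for each edge of
  a path connector. Since the connector is connected, this creates no new group elements
  (\<open>fill_coset\<close>), and since it has no cycles, it creates no new relations (\<open>fill_square\<close>). So the
  grid is a model of the generalization in which every square is filled, with the fundamental group
  of the original graph.

  The right-angled Coxeter group of \<open>\<Delta>\<close> acts on the grid: a letter moves a point along the edge with
  its label, and it fixes the point if there is no such edge.

  \<^item> Freeness: the action on the grid lifts to the product of the grid with a free group, because a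
    cocycle on the edges of the staircase extends to all squares (\<open>cocycle_exists\<close>). The lift sends
    each free generator of the generalization to a generator of the free group.

  \<^item> No quasiconvexity: the word that goes from \<open>(0, 0)\<close> horizontally to \<open>(m, 0)\<close> and then
    vertically to \<open>(m, m)\<close> represents an element of the generalization if \<open>k\<close> divides \<open>m\<close>. It is
    geodesic, as a letter moves by at most one step of the grid, and its corner has distance at
    least \<open>m\<close> from the diagonal, where the generalization lives.

  \<^item> No normality: if \<open>k > 2\<close>, there are letters that fix the origin and that generate, together
    with two letters of the first part, a free product. Conjugating powers by such letters leads out
    of the generalization, also inside a subgroup of finite index. If \<open>k = 2\<close>, a conjugate of the
    label of the cycle itself ends off the diagonal.

  \<^item> One end: the letters that shorten an element of a right-angled Coxeter group are pairwise
    adjacent (\<open>descents_adjacent\<close>). Hence, if no clique separates the graph, a path can be pushed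
    away from the identity as far as one likes. In the partite graph no clique separates: the
    parts that it does not meet are joined by paths, and each other vertex has neighbours there.
\<close>

section \<open>Right-angled Coxeter groups and actions by involutions\<close>

lemma equiv_presentation_rel: "equiv (signed_words S) (presentation_rel S R)"
  by (rule equivI)
    (auto simp: refl_on_def intro!: presentation_rel.refl symI transI
       dest: presentation_rel_words presentation_rel.sym presentation_rel.trans)

lemma carrier_presented_group:
  "carrier (presented_group S R) = (\<lambda>w. presentation_rel S R `` {w}) ` signed_words S"
  by (auto simp: presented_group_def word_quotient_def quotient_def)

lemma one_presented_group: "\<one>\<^bsub>presented_group S R\<^esub> = presentation_rel S R `` {[]}"
  by (simp add: presented_group_def word_quotient_def)

lemma mult_presented_group:
  assumes "u \<in> signed_words S" "v \<in> signed_words S"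
  shows "presentation_rel S R `` {u} \<otimes>\<^bsub>presented_group S R\<^esub> presentation_rel S R `` {v} =
    presentation_rel S R `` {u @ v}"
proof -
  let ?r = "presentation_rel S R"
  have "?r `` {u' @ v'} = ?r `` {u @ v}" if "(u, u') \<in> ?r" "(v, v') \<in> ?r" for u' v'
  proof -
    have "(u @ v, u' @ v) \<in> ?r" "(u' @ v, u' @ v') \<in> ?r"
      using presentation_rel_context[OF that(1), of "[]" v]
        presentation_rel_context[OF that(2), of u' "[]"] presentation_rel_words[OF that(1)] assms
      by simp_all
    then show ?thesis
      using equiv_class_eq[OF equiv_presentation_rel] presentation_rel.trans by metis
  qed
  then have "(\<Union>u'\<in>?r `` {u}. \<Union>v'\<in>?r `` {v}. ?r `` {u' @ v'}) =
      (\<Union>u'\<in>?r `` {u}. \<Union>v'\<in>?r `` {v}. ?r `` {u @ v})"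
    by (intro SUP_cong refl) auto
  moreover have "?r `` {u} \<noteq> {}" "?r `` {v} \<noteq> {}"
    using equiv_class_self[OF equiv_presentation_rel] assms by blast+
  ultimately have "(\<Union>u'\<in>?r `` {u}. \<Union>v'\<in>?r `` {v}. ?r `` {u' @ v'}) = ?r `` {u @ v}"
    by (simp only: UN_constant if_False)
  then show ?thesis by (simp add: presented_group_def word_quotient_def)
qed

lemma presented_group_eqI:
  "(u, v) \<in> presentation_rel S R \<Longrightarrow> presentation_rel S R `` {u} = presentation_rel S R `` {v}"
  by (rule equiv_class_eq[OF equiv_presentation_rel])

lemma racg_elem_append:
  assumes "u \<in> lists (pverts \<Delta>)" "v \<in> lists (pverts \<Delta>)"
  shows "racg_elem \<Delta> (u @ v) = racg_elem \<Delta> u \<otimes>\<^bsub>racg \<Delta>\<^esub> racg_elem \<Delta> v"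
proof -
  have "map (\<lambda>s. (s, True)) u \<in> signed_words (pverts \<Delta>)" "map (\<lambda>s. (s, True)) v \<in> signed_words (pverts \<Delta>)"
    using assms by auto
  from mult_presented_group[OF this, of "racg_relators \<Delta>"] show ?thesis
    by (simp add: racg_elem_def racg_def)
qed

lemma racg_elem_Nil: "racg_elem \<Delta> [] = \<one>\<^bsub>racg \<Delta>\<^esub>"
  by (simp add: racg_elem_def racg_def one_presented_group)

lemma racg_elem_square:
  assumes "a \<in> pverts \<Delta>"
  shows "racg_elem \<Delta> [a, a] = \<one>\<^bsub>racg \<Delta>\<^esub>"
proof -
  have "([] @ [(a, True), (a, True)] @ [], [] @ []) \<in>
      presentation_rel (pverts \<Delta>) (racg_relators \<Delta>)"
    using assms by (intro presentation_rel.relator) (auto simp: racg_relators_def)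
  then show ?thesis
    by (simp add: racg_elem_def racg_elem_Nil[symmetric] presented_group_eqI)
qed

lemma map_fst_signed_words: "w \<in> signed_words S \<Longrightarrow> map fst w \<in> lists S"
  by (induction w) auto

text \<open>Every generator being an involution, the formal inverses can be replaced by generators.\<close>

lemma signed_word_eq_racg_elem:
  assumes "w \<in> signed_words (pverts \<Delta>)"
  shows "presentation_rel (pverts \<Delta>) (racg_relators \<Delta>) `` {w} = racg_elem \<Delta> (map fst w)"
  using assms
proof (induction w)
  case Nil
  then show ?case by (simp add: racg_elem_def)
next
  case (Cons x w)
  let ?r = "presentation_rel (pverts \<Delta>) (racg_relators \<Delta>)"
  obtain a d where x: "x = (a, d)" "a \<in> pverts \<Delta>" using Cons.hyps by auto
  have w: "w \<in> signed_words (pverts \<Delta>)" "map fst w \<in> lists (pverts \<Delta>)"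
    using Cons.hyps map_fst_signed_words[of w] by auto
  have "?r `` {[x]} = racg_elem \<Delta> [a]"
  proof (cases d)
    case True
    then show ?thesis by (simp add: x racg_elem_def)
  next
    case False
    have "([(a, False)] @ [(a, True), (a, True)] @ [], [(a, False)] @ []) \<in> ?r"
      using x by (intro presentation_rel.relator) (auto simp: racg_relators_def)
    moreover have "([] @ [(a, False), flip (a, False)] @ [(a, True)], [] @ [(a, True)]) \<in> ?r"
      using x by (intro presentation_rel.cancel) auto
    ultimately have "([(a, False)], [(a, True)]) \<in> ?r"
      by (auto simp: flip_def dest: presentation_rel.sym intro: presentation_rel.trans)
    then show ?thesis using False by (simp add: x racg_elem_def presented_group_eqI)
  qed
  then have "?r `` {[x] @ w} = racg_elem \<Delta> ([a] @ map fst w)"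
    using mult_presented_group[of "[x]" "pverts \<Delta>" w "racg_relators \<Delta>"]
      racg_elem_append[of "[a]" \<Delta> "map fst w"] w x Cons.IH
    by (simp add: racg_def)
  then show ?case by (simp add: x)
qed

lemma carrier_racg: "carrier (racg \<Delta>) = racg_elem \<Delta> ` lists (pverts \<Delta>)"
proof
  show "carrier (racg \<Delta>) \<subseteq> racg_elem \<Delta> ` lists (pverts \<Delta>)"
  proof
    fix g assume "g \<in> carrier (racg \<Delta>)"
    then obtain w where w: "w \<in> signed_words (pverts \<Delta>)"
        "g = presentation_rel (pverts \<Delta>) (racg_relators \<Delta>) `` {w}"
      by (auto simp: racg_def carrier_presented_group)
    moreover have "map fst w \<in> lists (pverts \<Delta>)" using w(1) by (rule map_fst_signed_words)
    ultimately show "g \<in> racg_elem \<Delta> ` lists (pverts \<Delta>)"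
      using signed_word_eq_racg_elem by blast
  qed
  show "racg_elem \<Delta> ` lists (pverts \<Delta>) \<subseteq> carrier (racg \<Delta>)"
    unfolding racg_def carrier_presented_group racg_elem_def by (auto intro!: imageI)
qed

lemma racg_elem_carrier: "w \<in> lists (pverts \<Delta>) \<Longrightarrow> racg_elem \<Delta> w \<in> carrier (racg \<Delta>)"
  by (simp add: carrier_racg)

lemma racg_elem_commute:
  assumes "(a, b) \<in> parcs \<Delta>" "a \<in> pverts \<Delta>" "b \<in> pverts \<Delta>"
  shows "racg_elem \<Delta> [a, b] = racg_elem \<Delta> [b, a]"
proof -
  interpret group "racg \<Delta>" by (rule group_racg)
  have "([] @ [(a, True), (b, True), (a, False), (b, False)] @ [], [] @ []) \<in>
      presentation_rel (pverts \<Delta>) (racg_relators \<Delta>)"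
    using assms by (intro presentation_rel.relator) (auto simp: racg_relators_def)
  then have "racg_elem \<Delta> ([a, b] @ [a, b]) = \<one>\<^bsub>racg \<Delta>\<^esub>"
    using signed_word_eq_racg_elem[of "[(a, True), (b, True), (a, False), (b, False)]" \<Delta>] assms
      presented_group_eqI[of "[(a, True), (b, True), (a, False), (b, False)]" "[]"]
    by (simp add: racg_def one_presented_group)
  then have 1: "racg_elem \<Delta> [a, b] \<otimes>\<^bsub>racg \<Delta>\<^esub> racg_elem \<Delta> [a, b] = \<one>\<^bsub>racg \<Delta>\<^esub>"
    using assms by (simp only: racg_elem_append lists.intros)
  have "racg_elem \<Delta> [a, b] \<otimes>\<^bsub>racg \<Delta>\<^esub> racg_elem \<Delta> [b, a] =
    racg_elem \<Delta> [a] \<otimes>\<^bsub>racg \<Delta>\<^esub> (racg_elem \<Delta> [b, b] \<otimes>\<^bsub>racg \<Delta>\<^esub> racg_elem \<Delta> [a])"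
    using assms by (simp add: racg_elem_append[symmetric])
  also have "\<dots> = \<one>\<^bsub>racg \<Delta>\<^esub>"
    using assms racg_elem_append[of "[a]" \<Delta> "[a]"]
    by (simp add: racg_elem_square racg_elem_carrier)
  finally have 2: "racg_elem \<Delta> [a, b] \<otimes>\<^bsub>racg \<Delta>\<^esub> racg_elem \<Delta> [b, a] = \<one>\<^bsub>racg \<Delta>\<^esub>" .
  show ?thesis
    using 1 2 assms by (metis inv_equality inv_inv lists.intros racg_elem_carrier)
qed

lemma racg_elem_rev:
  assumes "w \<in> lists (pverts \<Delta>)"
  shows "racg_elem \<Delta> (rev w) = inv\<^bsub>racg \<Delta>\<^esub> racg_elem \<Delta> w"
proof -
  interpret group "racg \<Delta>" by (rule group_racg)
  have "racg_elem \<Delta> (w @ rev w) = \<one>\<^bsub>racg \<Delta>\<^esub>"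
    using assms
  proof (induction w rule: rev_induct)
    case Nil
    then show ?case by (simp add: racg_elem_Nil)
  next
    case (snoc a w)
    then have l: "w \<in> lists (pverts \<Delta>)" "rev w \<in> lists (pverts \<Delta>)" "a \<in> pverts \<Delta>" by auto
    have "racg_elem \<Delta> (w @ [a, a] @ rev w) = racg_elem \<Delta> w \<otimes>\<^bsub>racg \<Delta>\<^esub> (racg_elem \<Delta> [a, a] \<otimes>\<^bsub>racg \<Delta>\<^esub> racg_elem \<Delta> (rev w))"
      using l by (simp only: racg_elem_append lists.intros append_in_lists_conv)
    then show ?case using snoc l
      by (simp add: racg_elem_square racg_elem_carrier racg_elem_append[symmetric])
  qed
  moreover have "rev w \<in> lists (pverts \<Delta>)" using assms by auto
  ultimately show ?thesis
    using assms by (metis inv_equality inv_inv inv_closed racg_elem_append racg_elem_carrier)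
qed

text \<open>
  The group acts from the right through every family of involutions that is indexed by the vertices
  of the graph and commutes along its edges. Words are shown to represent different elements by
  acting differently.
\<close>

definition racg_action :: "'b pair_pre_digraph \<Rightarrow> 'x set \<Rightarrow> ('b \<Rightarrow> 'x \<Rightarrow> 'x) \<Rightarrow> bool" where
  "racg_action \<Delta> X \<tau> \<longleftrightarrow>
     (\<forall>a\<in>pverts \<Delta>. \<forall>x\<in>X. \<tau> a x \<in> X \<and> \<tau> a (\<tau> a x) = x) \<and>
     (\<forall>a b. (a, b) \<in> parcs \<Delta> \<longrightarrow> (\<forall>x\<in>X. \<tau> a (\<tau> b x) = \<tau> b (\<tau> a x)))"

lemma fold_action_closed:
  "racg_action \<Delta> X \<tau> \<Longrightarrow> w \<in> lists (pverts \<Delta>) \<Longrightarrow> x \<in> X \<Longrightarrow> fold \<tau> w x \<in> X"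
  by (induction w arbitrary: x) (auto simp: racg_action_def)

lemma racg_action_fold_eq:
  assumes "racg_action \<Delta> X \<tau>" "u \<in> lists (pverts \<Delta>)" "v \<in> lists (pverts \<Delta>)"
    "racg_elem \<Delta> u = racg_elem \<Delta> v" "x \<in> X"
  shows "fold \<tau> u x = fold \<tau> v x"
proof -
  let ?r = "presentation_rel (pverts \<Delta>) (racg_relators \<Delta>)"
  have "fold \<tau> (map fst p) x = fold \<tau> (map fst q) x" if "(p, q) \<in> ?r" "x \<in> X" for p q x
    using that
  proof (induction arbitrary: x rule: presentation_rel.induct)
    case (cancel u v y)
    have "map fst u \<in> lists (pverts \<Delta>)" using cancel.hyps(1) by (rule map_fst_signed_words)
    then have "fold \<tau> (map fst u) x \<in> X" using assms(1) cancel.prems fold_action_closed by metis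
    then show ?case using assms(1) cancel.hyps by (auto simp: racg_action_def flip_def)
  next
    case (relator u v r)
    have "map fst u \<in> lists (pverts \<Delta>)" using relator.hyps(1) by (rule map_fst_signed_words)
    then have x: "fold \<tau> (map fst u) x \<in> X" using assms(1) relator.prems fold_action_closed by metis
    have "fold \<tau> (map fst r) y = y" if "y \<in> X" for y
      using relator.hyps(3,4) that assms(1) unfolding racg_action_def racg_relators_def
      by auto metis
    then show ?case using x by simp
  qed auto
  moreover have "map (\<lambda>s. (s, True)) v \<in> signed_words (pverts \<Delta>)" using assms by auto
  then have "(map (\<lambda>s. (s, True)) u, map (\<lambda>s. (s, True)) v) \<in> ?r"
    using assms(4) eq_equiv_class[OF _ equiv_presentation_rel] by (metis racg_elem_def)
  ultimately show ?thesis using assms(5) by (metis (no_types, lifting) comp_def fst_conv map_idI map_map)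
qed

section \<open>Walls, word length and descents\<close>

locale finite_racg = pair_graph \<Delta> for \<Delta> :: "'b pair_pre_digraph"
begin

sublocale W: group "racg \<Delta>"
  by (rule group_racg)

abbreviation vertices ("V") where "V \<equiv> pverts \<Delta>"
abbreviation element ("E") where "E \<equiv> racg_elem \<Delta>"
abbreviation product (infixl "\<cdot>" 70) where "g \<cdot> h \<equiv> g \<otimes>\<^bsub>racg \<Delta>\<^esub> h"
abbreviation elements ("C") where "C \<equiv> carrier (racg \<Delta>)"
abbreviation unit ("\<bbbone>") where "\<bbbone> \<equiv> \<one>\<^bsub>racg \<Delta>\<^esub>"
abbreviation inverse ("_\<^sup>-" [1000] 999) where "g\<^sup>- \<equiv> inv\<^bsub>racg \<Delta>\<^esub> g"

lemmas E_append = racg_elem_append[of _ \<Delta>]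
lemmas E_Nil = racg_elem_Nil[of \<Delta>]
lemmas E_carrier [simp] = racg_elem_carrier[of _ \<Delta>]

lemma edge_vertices: "(a, b) \<in> parcs \<Delta> \<Longrightarrow> a \<in> V \<and> b \<in> V"
  using wellformed[of "(a, b)"] by auto

lemma edge_sym: "(a, b) \<in> parcs \<Delta> \<Longrightarrow> (b, a) \<in> parcs \<Delta>"
  using graph_symmetric by simp

lemma E_snoc: "w \<in> lists V \<Longrightarrow> a \<in> V \<Longrightarrow> E (w @ [a]) = E w \<cdot> E [a]"
  by (simp add: E_append)

lemma E_Cons: "w \<in> lists V \<Longrightarrow> a \<in> V \<Longrightarrow> E (a # w) = E [a] \<cdot> E w"
  using E_append[of "[a]" w] by simp

lemma gen_carrier [simp]: "a \<in> V \<Longrightarrow> E [a] \<in> C"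
  by simp

lemma gen_square [simp]: "a \<in> V \<Longrightarrow> E [a] \<cdot> E [a] = \<bbbone>"
  using E_append[of "[a]" "[a]"] by (simp add: racg_elem_square)

lemma gen_inv [simp]: "a \<in> V \<Longrightarrow> (E [a])\<^sup>- = E [a]"
  using gen_square W.inv_equality gen_carrier by metis

lemma mult_gen_gen [simp]: "a \<in> V \<Longrightarrow> g \<in> C \<Longrightarrow> g \<cdot> E [a] \<cdot> E [a] = g"
  by (simp add: W.m_assoc)

lemma gen_commute: "(a, b) \<in> parcs \<Delta> \<Longrightarrow> E [a] \<cdot> E [b] = E [b] \<cdot> E [a]"
  using racg_elem_commute[of a b \<Delta>] edge_vertices[of a b] E_append[of "[a]" "[b]"]
    E_append[of "[b]" "[a]"] by simp

lemma elementE: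
  assumes "g \<in> C"
  obtains w where "w \<in> lists V" "g = E w"
  using assms by (auto simp: carrier_racg)

lemma element_induct [consumes 1, case_names one mult]:
  assumes "g \<in> C" "P \<bbbone>" "\<And>g a. g \<in> C \<Longrightarrow> a \<in> V \<Longrightarrow> P g \<Longrightarrow> P (g \<cdot> E [a])"
  shows "P g"
proof -
  obtain w where w: "w \<in> lists V" "g = E w" using assms(1) by (rule elementE)
  have "P (E w)" using w(1)
  proof (induction w rule: rev_induct)
    case Nil
    then show ?case using assms(2) by (simp add: E_Nil)
  next
    case (snoc a w)
    then show ?case using assms(3)[of "E w" a] by (simp add: E_snoc)
  qed
  then show ?thesis using w(2) by simp
qed

lemma rev_in_lists: "rev w \<in> lists A \<longleftrightarrow> w \<in> lists A"
  by (simp add: in_lists_conv_set)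

definition act :: "('b \<Rightarrow> 'x \<Rightarrow> 'x) \<Rightarrow> ('b \<times> bool) list set \<Rightarrow> 'x \<Rightarrow> 'x" where
  "act \<tau> g = fold \<tau> (SOME w. w \<in> lists V \<and> E w = g)"

lemma act_E:
  assumes "racg_action \<Delta> X \<tau>" "w \<in> lists V" "x \<in> X"
  shows "act \<tau> (E w) x = fold \<tau> w x"
proof -
  have "\<exists>w'. w' \<in> lists V \<and> E w' = E w" using assms(2) by blast
  then have "(SOME w'. w' \<in> lists V \<and> E w' = E w) \<in> lists V \<and>
      E (SOME w'. w' \<in> lists V \<and> E w' = E w) = E w"
    by (rule someI_ex)
  then show ?thesis unfolding act_def
    using racg_action_fold_eq[OF assms(1) _ assms(2) _ assms(3)] by blast
qed

lemma act_mult: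
  assumes "racg_action \<Delta> X \<tau>" "g \<in> C" "h \<in> C" "x \<in> X"
  shows "act \<tau> (g \<cdot> h) x = act \<tau> h (act \<tau> g x)"
proof -
  obtain u v where u: "u \<in> lists V" "g = E u" and v: "v \<in> lists V" "h = E v"
    using assms(2,3) by (metis elementE)
  have "act \<tau> (E (u @ v)) x = fold \<tau> (u @ v) x" using u v assms(1,4) by (intro act_E) auto
  then show ?thesis using u v assms(1,4) fold_action_closed[OF assms(1) u(1) assms(4)]
    by (simp add: E_append act_E)
qed

lemma act_one: "racg_action \<Delta> X \<tau> \<Longrightarrow> x \<in> X \<Longrightarrow> act \<tau> \<bbbone> x = x"
  using act_E[of X \<tau> "[]" x] by (simp add: E_Nil)

lemma act_gen: "racg_action \<Delta> X \<tau> \<Longrightarrow> a \<in> V \<Longrightarrow> x \<in> X \<Longrightarrow> act \<tau> (E [a]) x = \<tau> a x"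
  using act_E[of X \<tau> "[a]" x] by simp

lemma gen_inj:
  assumes "a \<in> V" "b \<in> V" "E [a] = E [b]"
  shows "a = b"
proof -
  have "racg_action \<Delta> UNIV (\<lambda>x y. if x = a then \<not> y else y)"
    by (auto simp: racg_action_def)
  from racg_action_fold_eq[OF this, of "[a]" "[b]" False] show ?thesis
    using assms by (auto split: if_splits)
qed

text \<open>
  The edge of the Cayley graph from \<open>g\<close> to \<open>g \<cdot> E [a]\<close> crosses the wall of the conjugate
  \<open>reflection g a\<close> of a generator. Toggling one wall per edge defines an action, so the set of
  walls crossed an odd number of times on the way from \<open>\<bbbone>\<close> to \<open>g\<close> depends on \<open>g\<close> only.
\<close>

definition reflection where "reflection g a = g \<cdot> E [a] \<cdot> g\<^sup>-"

definition toggle :: "'x \<Rightarrow> 'x set \<Rightarrow> 'x set" where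
  "toggle r N = (if r \<in> N then N - {r} else insert r N)"

definition cross where
  "cross a = (\<lambda>(g, N). (g \<cdot> E [a], toggle (reflection g a) N))"

definition walls where "walls g = snd (act cross g (\<bbbone>, {}))"

definition len where "len g = card (walls g)"

lemma mem_toggle: "x \<in> toggle r N \<longleftrightarrow> (x \<in> N) \<noteq> (x = r)"
  by (auto simp: toggle_def)

lemma reflection_carrier [simp]: "g \<in> C \<Longrightarrow> a \<in> V \<Longrightarrow> reflection g a \<in> C"
  by (simp add: reflection_def)

lemma reflection_mult:
  assumes "g \<in> C" "a \<in> V"
  shows "reflection g a \<cdot> g = g \<cdot> E [a]"
  using assms by (simp add: reflection_def W.m_assoc)

lemma reflection_step:
  assumes "g \<in> C" "a \<in> V" "b \<in> V" "a = b \<or> (a, b) \<in> parcs \<Delta>"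
  shows "reflection (g \<cdot> E [a]) b = reflection g b"
proof -
  have "E [a] \<cdot> E [b] \<cdot> E [a] = E [b]"
    using assms(4) gen_commute[of a b] mult_gen_gen[of a "E [b]"] mult_gen_gen[of a "E [a]"] assms(2,3)
    by auto
  moreover have "reflection (g \<cdot> E [a]) b = g \<cdot> (E [a] \<cdot> E [b] \<cdot> E [a]) \<cdot> g\<^sup>-"
    using assms by (simp add: reflection_def W.m_assoc W.inv_mult_group)
  ultimately show ?thesis by (simp add: reflection_def)
qed

lemma cross_action: "racg_action \<Delta> (C \<times> UNIV) cross"
  unfolding racg_action_def
proof (intro conjI ballI allI impI)
  fix a x assume "a \<in> V" "x \<in> C \<times> (UNIV :: ('b \<times> bool) list set set set)"
  then show "cross a x \<in> C \<times> UNIV" "cross a (cross a x) = x"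
    by (auto simp: cross_def reflection_step mem_toggle)
next
  fix a b x assume e: "(a, b) \<in> parcs \<Delta>" and "x \<in> C \<times> (UNIV :: ('b \<times> bool) list set set set)"
  then obtain g N where x: "x = (g, N)" "g \<in> C" by auto
  have "reflection (g \<cdot> E [a]) b = reflection g b" "reflection (g \<cdot> E [b]) a = reflection g a"
    using x e edge_sym[OF e] edge_vertices[OF e] by (simp_all add: reflection_step)
  moreover have "g \<cdot> E [a] \<cdot> E [b] = g \<cdot> E [b] \<cdot> E [a]"
    using x gen_commute[OF e] edge_vertices[OF e] by (simp add: W.m_assoc)
  ultimately show "cross a (cross b x) = cross b (cross a x)"
    by (auto simp: cross_def x mem_toggle)
qed

lemma fst_fold_cross:
  "g \<in> C \<Longrightarrow> w \<in> lists V \<Longrightarrow> fst (fold cross w (g, N)) = g \<cdot> E w"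
proof (induction w arbitrary: g N)
  case Nil
  then show ?case by (simp add: E_Nil)
next
  case (Cons a w)
  then show ?case by (auto simp: cross_def E_Cons[of w a] W.m_assoc)
qed

lemma act_cross_fst:
  assumes "g \<in> C"
  shows "fst (act cross g (\<bbbone>, {})) = g"
proof -
  obtain w where w: "w \<in> lists V" "g = E w" using assms by (rule elementE)
  then show ?thesis
    using act_E[OF cross_action w(1), of "(\<bbbone>, {})"] fst_fold_cross[OF _ w(1), of \<bbbone> "{}"] by simp
qed

lemma walls_one [simp]: "walls \<bbbone> = {}"
  unfolding walls_def by (subst act_one[OF cross_action]) auto

lemma walls_mult_gen:
  assumes "g \<in> C" "a \<in> V"
  shows "walls (g \<cdot> E [a]) = toggle (reflection g a) (walls g)"
proof -
  have "act cross g (\<bbbone>, {}) \<in> C \<times> UNIV" using act_cross_fst[OF assms(1)] assms(1)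
    by (simp add: mem_Times_iff)
  then have "act cross (g \<cdot> E [a]) (\<bbbone>, {}) = cross a (act cross g (\<bbbone>, {}))"
    using assms act_mult[OF cross_action, of g "E [a]" "(\<bbbone>, {})"] act_gen[OF cross_action]
    by simp
  then show ?thesis using act_cross_fst[OF assms(1)]
    by (simp add: walls_def cross_def case_prod_beta)
qed

lemma finite_walls [simp]: "g \<in> C \<Longrightarrow> finite (walls g)"
  by (induction rule: element_induct) (auto simp: walls_mult_gen toggle_def)

lemma walls_carrier: "g \<in> C \<Longrightarrow> walls g \<subseteq> C"
  by (induction rule: element_induct) (auto simp: walls_mult_gen toggle_def)

lemma len_mult_gen:
  assumes "g \<in> C" "a \<in> V"
  shows "reflection g a \<in> walls g \<Longrightarrow> Suc (len (g \<cdot> E [a])) = len g"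
    and "reflection g a \<notin> walls g \<Longrightarrow> len (g \<cdot> E [a]) = Suc (len g)"
  using assms card_Suc_Diff1[OF finite_walls[OF assms(1)]]
  by (auto simp: len_def walls_mult_gen toggle_def simp del: card_Diff_singleton_if)

lemma len_le_length: "w \<in> lists V \<Longrightarrow> len (E w) \<le> length w"
proof (induction w rule: rev_induct)
  case Nil
  then show ?case by (simp add: len_def E_Nil)
next
  case (snoc a w)
  then show ?case
    using len_mult_gen[of "E w" a] by (cases "reflection (E w) a \<in> walls (E w)") (auto simp: E_snoc)
qed

text \<open>The deletion condition: a wall crossed by a word can be avoided by omitting a letter.\<close>

lemma deletion:
  assumes "w \<in> lists V" "r \<in> walls (E w)"
  shows "\<exists>w'\<in>lists V. length w' < length w \<and> E w' = r \<cdot> E w"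
  using assms
proof (induction w rule: rev_induct)
  case Nil
  then show ?case by (simp add: E_Nil)
next
  case (snoc a w)
  then have w: "w \<in> lists V" "a \<in> V" by auto
  show ?case
  proof (cases "r = reflection (E w) a")
    case True
    then have "E w = r \<cdot> E (w @ [a])"
      using w reflection_mult[of "E w" a] by (simp add: E_snoc W.m_assoc[symmetric])
    then show ?thesis using w by (intro bexI[of _ w]) auto
  next
    case False
    then have r: "r \<in> walls (E w)" using snoc.prems w by (simp add: E_snoc walls_mult_gen mem_toggle)
    then obtain w' where w': "w' \<in> lists V" "length w' < length w" "E w' = r \<cdot> E w"
      using snoc.IH w by blast
    moreover have "r \<in> C" using r walls_carrier[of "E w"] w(1) by auto
    ultimately show ?thesis using w
      by (intro bexI[of _ "w' @ [a]"]) (auto simp: E_snoc W.m_assoc)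
  qed
qed


text \<open>
  A shortest word crosses no wall twice: otherwise the deletion condition would shorten the prefix
  ending with the second crossing. So \<open>len\<close> is the word length.
\<close>

lemma len_word:
  assumes "g \<in> C"
  shows "\<exists>w\<in>lists V. E w = g \<and> length w = len g"
proof -
  obtain w0 where w0: "w0 \<in> lists V" "g = E w0" using assms by (rule elementE)
  then obtain w where w: "w \<in> lists V" "E w = g"
      and min: "\<And>v. v \<in> lists V \<Longrightarrow> E v = g \<Longrightarrow> length w \<le> length v"
    using ex_has_least_nat[of "\<lambda>w. w \<in> lists V \<and> E w = g" w0 length] by blast
  have "len (E u) = length u" if "w = u @ v" for u v
    using that
  proof (induction u arbitrary: v rule: rev_induct)
    case Nil
    then show ?case by (simp add: len_def E_Nil)
  next
    case (snoc a u)
    have u: "u \<in> lists V" "a \<in> V" "v \<in> lists V" using snoc.prems w by auto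
    have "reflection (E u) a \<notin> walls (E u)"
    proof
      assume "reflection (E u) a \<in> walls (E u)"
      then obtain u' where u': "u' \<in> lists V" "length u' < length u" "E u' = reflection (E u) a \<cdot> E u"
        using deletion u by blast
      have "E (u' @ v) = E (u @ [a]) \<cdot> E v"
        using u u' by (simp add: E_append reflection_mult)
      also have "\<dots> = g"
        using u w snoc.prems E_append[of "u @ [a]" v] by simp
      finally have "E (u' @ v) = g" .
      then show False using min[of "u' @ v"] u' u snoc.prems by simp
    qed
    moreover have "len (E u) = length u" using snoc.IH[of "a # v"] snoc.prems by simp
    ultimately show ?case using u by (simp add: E_snoc len_mult_gen)
  qed
  from this[of w "[]"] show ?thesis using w by auto
qed

lemma len_reflected:
  assumes "g \<in> C" "r \<in> walls g"
  shows "len (r \<cdot> g) < len g"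
proof -
  obtain w where w: "w \<in> lists V" "E w = g" "length w = len g" using len_word assms(1) by blast
  then obtain w' where "w' \<in> lists V" "length w' < length w" "E w' = r \<cdot> g"
    using deletion assms(2) by blast
  then show ?thesis using len_le_length[of w'] w(3) by simp
qed

lemma conj_eq_iff:
  assumes "g \<in> C" "r \<in> C" "x \<in> C"
  shows "r = g \<cdot> x \<cdot> g\<^sup>- \<longleftrightarrow> g\<^sup>- \<cdot> r \<cdot> g = x"
proof -
  have "r = g \<cdot> x \<cdot> g\<^sup>- \<longleftrightarrow> r \<cdot> g = g \<cdot> x"
    using assms W.inv_solve_right[of r "g \<cdot> x" g] by auto
  also have "\<dots> \<longleftrightarrow> x = g\<^sup>- \<cdot> (r \<cdot> g)"
    using assms W.inv_solve_left[of x g "r \<cdot> g"] by auto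
  finally show ?thesis using assms by (auto simp: W.m_assoc)
qed

text \<open>
  The walls between \<open>\<bbbone>\<close> and \<open>g \<cdot> h\<close> are those between \<open>\<bbbone>\<close> and \<open>g\<close> and the translates by \<open>g\<close>
  of those between \<open>\<bbbone>\<close> and \<open>h\<close>, except for the walls crossed twice.
\<close>

lemma mem_walls_mult:
  assumes "g \<in> C" "h \<in> C" "r \<in> C"
  shows "r \<in> walls (g \<cdot> h) \<longleftrightarrow> (r \<in> walls g) \<noteq> (g\<^sup>- \<cdot> r \<cdot> g \<in> walls h)"
  using assms(2)
proof (induction rule: element_induct)
  case one
  then show ?case using assms by simp
next
  case (mult h a)
  have "reflection (g \<cdot> h) a = g \<cdot> reflection h a \<cdot> g\<^sup>-"
    using mult.hyps assms(1) by (simp add: reflection_def W.inv_mult_group W.m_assoc)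
  then have "r = reflection (g \<cdot> h) a \<longleftrightarrow> g\<^sup>- \<cdot> r \<cdot> g = reflection h a"
    using conj_eq_iff[of g r "reflection h a"] assms mult.hyps by simp
  moreover have "walls (g \<cdot> (h \<cdot> E [a])) = toggle (reflection (g \<cdot> h) a) (walls (g \<cdot> h))"
    using mult assms(1) walls_mult_gen[of "g \<cdot> h" a] by (simp add: W.m_assoc)
  ultimately show ?case
    using mult.IH mult.hyps by (auto simp: walls_mult_gen mem_toggle)
qed

text \<open>
  The infinite dihedral group generated by two vertices that are not adjacent acts on the
  integers, its chambers, with every other vertex acting trivially.
\<close>

definition chamber :: "'b \<Rightarrow> 'b \<Rightarrow> 'b \<Rightarrow> int \<Rightarrow> int" where
  "chamber s t a n = (if a = s then if even n then n + 1 else n - 1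
     else if a = t then if even n then n - 1 else n + 1 else n)"

lemma chamber_action:
  assumes "s \<noteq> t" "(s, t) \<notin> parcs \<Delta>"
  shows "racg_action \<Delta> UNIV (chamber s t)"
proof -
  have "(t, s) \<notin> parcs \<Delta>" using edge_sym assms by blast
  moreover have "(a, a) \<notin> parcs \<Delta>" for a using no_loops[of "(a, a)"] by auto
  ultimately show ?thesis using assms by (auto simp: racg_action_def chamber_def)
qed

text \<open>
  Each letter of an alternating word leads farther away from \<open>0\<close>, because the letter that leads
  back is the one just used.
\<close>

lemma chamber_alternating:
  assumes "s \<noteq> t" "w \<in> lists {s, t}" "distinct_adj w"
  shows "\<bar>fold (chamber s t) w 0\<bar> = int (length w) \<and>
    (w \<noteq> [] \<longrightarrow> \<bar>chamber s t (last w) (fold (chamber s t) w 0)\<bar> = int (length w) - 1)"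
  using assms(2,3)
proof (induction w rule: rev_induct)
  case Nil
  then show ?case by simp
next
  case (snoc x w)
  let ?c = "chamber s t" let ?n = "fold ?c w 0"
  have IH: "\<bar>?n\<bar> = int (length w)"
    "w \<noteq> [] \<longrightarrow> \<bar>?c (last w) ?n\<bar> = int (length w) - 1"
    using snoc by (auto simp: distinct_adj_append_iff)
  have x: "x = s \<or> x = t" using snoc.prems by auto
  have "?c x (?c x ?n) = ?n" by (auto simp: chamber_def)
  moreover have "\<bar>?c x ?n\<bar> = int (length w) + 1"
  proof (cases "w = []")
    case True
    then show ?thesis using x by (auto simp: chamber_def)
  next
    case False
    then have "last w = s \<or> last w = t" "last w \<noteq> x"
      using snoc.prems last_in_set[OF False] by (auto simp: distinct_adj_append_iff)
    then show ?thesis using IH False x assms(1) by (auto simp: chamber_def split: if_splits)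
  qed
  ultimately show ?case using IH by simp
qed

lemma chamber_bound: "\<bar>fold (chamber s t) w n\<bar> \<le> \<bar>n\<bar> + int (length w)"
proof (induction w arbitrary: n)
  case (Cons a w)
  have "\<bar>chamber s t a n\<bar> \<le> \<bar>n\<bar> + 1" by (auto simp: chamber_def)
  then show ?case using Cons[of "chamber s t a n"] by simp
qed simp

lemma chamber_outwards:
  assumes "s \<noteq> t"
  shows "\<exists>x\<in>{s, t}. \<bar>chamber s t x n\<bar> = \<bar>n\<bar> + 1"
  using assms by (cases "even n"; cases "n \<ge> 0") (auto simp: chamber_def)

text \<open>
  A shortest word in \<open>s\<close> and \<open>t\<close> is alternating. Of the two neighbours of its chamber one is
  farther away from \<open>0\<close>, and the distance from \<open>0\<close> bounds the length from below.
\<close>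

lemma dihedral_descents:
  assumes st: "s \<noteq> t" "(s, t) \<notin> parcs \<Delta>" "s \<in> V" "t \<in> V" and w: "w \<in> lists {s, t}"
  shows "\<not> (len (E w \<cdot> E [s]) < len (E w) \<and> len (E w \<cdot> E [t]) < len (E w))"
proof
  assume less: "len (E w \<cdot> E [s]) < len (E w) \<and> len (E w \<cdot> E [t]) < len (E w)"
  note act = chamber_action[OF st(1,2)]
  have sub: "v \<in> lists V" if "v \<in> lists {s, t}" for v using that st by auto
  define P where "P v \<longleftrightarrow> v \<in> lists {s, t} \<and> E v = E w" for v
  have "P w" using w by (simp add: P_def)
  then obtain v where v: "P v" and min: "\<And>v'. P v' \<Longrightarrow> length v \<le> length v'"
    using ex_has_least_nat[of P w length] by blast
  note v = v[unfolded P_def, THEN conjunct1] v[unfolded P_def, THEN conjunct2]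
  have "distinct_adj v"
  proof (rule ccontr)
    assume "\<not> distinct_adj v"
    then obtain i where i: "Suc i < length v" "v ! i = v ! Suc i"
      by (auto simp: distinct_adj_conv_nth)
    define p x q where "p = take i v" and "x = v ! i" and "q = drop (Suc (Suc i)) v"
    then have p: "v = p @ [x, x] @ q"
      using i by (simp add: Cons_nth_drop_Suc Suc_lessD id_take_nth_drop)
        (metis Cons_nth_drop_Suc Suc_lessD append_take_drop_id)
    then have l: "p \<in> lists {s, t}" "q \<in> lists {s, t}" "x \<in> {s, t}" using v by auto
    then have l': "p \<in> lists V" "q \<in> lists V" "x \<in> V" using sub st by auto
    then have "E v = E (p @ q)"
      unfolding p by (simp add: E_append racg_elem_square E_append[of "[x, x]", simplified])
    then show False using min[of "p @ q"] l v p by (simp add: P_def)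
  qed
  then have abs: "\<bar>fold (chamber s t) v 0\<bar> = int (length v)"
    using chamber_alternating[OF st(1) v(1)] by simp
  have "len (E v) \<le> length v" using len_le_length[OF sub[OF v(1)]] .
  \<comment> \<open>the generator that leads outwards cannot shorten the element\<close>
  obtain x where x: "x \<in> {s, t}" "\<bar>chamber s t x (fold (chamber s t) v 0)\<bar> = int (length v) + 1"
    using abs chamber_outwards[OF st(1)] by metis
  have "E v \<in> C" "E [x] \<in> C" using sub[OF v(1)] x(1) st by (auto simp del: in_lists_conv_set)
  then have "E v \<cdot> E [x] \<in> C" by simp
  then obtain u where u: "u \<in> lists V" "E u = E v \<cdot> E [x]" "length u = len (E v \<cdot> E [x])"
    using len_word by metis
  have "fold (chamber s t) u 0 = fold (chamber s t) (v @ [x]) 0"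
    using racg_action_fold_eq[OF act u(1), of "v @ [x]" 0] u(2) E_snoc[of v x] sub[OF v(1)] x(1) st
    by auto
  then have "int (length v) + 1 \<le> int (length u)" using x(2) chamber_bound[of s t u 0] by simp
  moreover have "length u < length v" using less u(3) x(1) v(2) \<open>len (E v) \<le> length v\<close> by auto
  ultimately show False by simp
qed

text \<open>
  A coset of the subgroup generated by \<open>s\<close> and \<open>t\<close> has an element \<open>h\<close> of least length. By
  the deletion condition no wall of \<open>h\<close> is crossed inside the coset, so lengths in the coset are
  those in the dihedral group, in which no element can be shortened by both generators.
\<close>

lemma descents_adjacent:
  assumes g: "g \<in> C" and st: "s \<in> V" "t \<in> V" "s \<noteq> t"
    and desc: "reflection g s \<in> walls g" "reflection g t \<in> walls g"
  shows "(s, t) \<in> parcs \<Delta>"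
proof (rule ccontr)
  assume nonadj: "(s, t) \<notin> parcs \<Delta>"
  have sub: "v \<in> lists V" if "v \<in> lists {s, t}" for v using that st by auto
  define P where "P v \<longleftrightarrow> v \<in> lists {s, t}" for v
  have "P []" by (simp add: P_def)
  then obtain v where v: "P v" and min: "\<And>v'. P v' \<Longrightarrow> len (g \<cdot> E v) \<le> len (g \<cdot> E v')"
    using ex_has_least_nat[of P "[]" "\<lambda>v. len (g \<cdot> E v)"] by blast
  note v = v[unfolded P_def]
  define h where "h = g \<cdot> E v"
  define u where "u = E (rev v)"
  have v': "v \<in> lists V" "rev v \<in> lists V" "rev v \<in> lists {s, t}"
    using sub[OF v] v by (simp_all only: rev_in_lists)
  have hC: "h \<in> C" and uC: "u \<in> C" using g v' by (simp_all add: h_def u_def)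
  have ghu: "g = h \<cdot> u"
    using g v' racg_elem_rev[of v \<Delta>] by (simp add: h_def u_def W.m_assoc)
  have coset: "h \<cdot> E x \<cdot> h\<^sup>- \<notin> walls h" if x: "x \<in> lists {s, t}" for x
  proof
    assume "h \<cdot> E x \<cdot> h\<^sup>- \<in> walls h"
    then have "len (h \<cdot> E x \<cdot> h\<^sup>- \<cdot> h) < len h" using len_reflected hC by blast
    moreover have "h \<cdot> E x \<cdot> h\<^sup>- \<cdot> h = g \<cdot> E (v @ x)"
      using hC sub[OF x] v' g by (simp add: W.m_assoc h_def E_append)
    ultimately show False using min[of "v @ x"] v x by (simp add: h_def P_def)
  qed
  have "len (u \<cdot> E [x]) < len u" if x: "x \<in> {s, t}" for x
  proof -
    have xV: "x \<in> V" using x st by auto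
    have r: "reflection g x \<in> walls (h \<cdot> u)" using desc x ghu by auto
    have "reflection g x = h \<cdot> (u \<cdot> E [x] \<cdot> u\<^sup>-) \<cdot> h\<^sup>-"
      unfolding ghu using hC uC xV by (simp add: reflection_def W.m_assoc W.inv_mult_group)
    moreover have "u \<cdot> E [x] \<cdot> u\<^sup>- = E (rev v @ [x] @ v)"
      using v' xV racg_elem_rev[of "rev v" \<Delta>] E_append[of "rev v" "[x] @ v"] E_append[of "[x]" v]
      by (simp add: u_def W.m_assoc)
    moreover have "rev v @ [x] @ v \<in> lists {s, t}" using v x by auto
    ultimately have "reflection g x \<notin> walls h" using coset by metis
    then have "h\<^sup>- \<cdot> reflection g x \<cdot> h \<in> walls u"
      using r mem_walls_mult[of h u "reflection g x"] hC uC g xV by simp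
    moreover have "h\<^sup>- \<cdot> reflection g x \<cdot> h = reflection u x"
      using conj_eq_iff[of h "reflection g x" "reflection u x"] hC uC xV g
        \<open>reflection g x = h \<cdot> (u \<cdot> E [x] \<cdot> u\<^sup>-) \<cdot> h\<^sup>-\<close>
      by (simp add: reflection_def)
    ultimately show ?thesis using len_mult_gen(1)[OF uC xV] by simp
  qed
  then show False
    using dihedral_descents[OF st(3) nonadj st(1,2) v'(3)] by (simp add: u_def)
qed

end

section \<open>One-endedness\<close>

context finite_racg
begin

definition outer_steps where
  "outer_steps n = {(g, g \<cdot> E [a]) | g a. g \<in> C \<and> a \<in> V \<and> n \<le> len g \<and> n \<le> len (g \<cdot> E [a])}"

lemma outer_stepI:
  "g \<in> C \<Longrightarrow> a \<in> V \<Longrightarrow> n \<le> len g \<Longrightarrow> n \<le> len (g \<cdot> E [a]) \<Longrightarrow>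
    (g, g \<cdot> E [a]) \<in> outer_steps n"
  by (auto simp: outer_steps_def)

lemma outer_steps_sym: "sym (outer_steps n)"
proof (rule symI)
  fix g h assume "(g, h) \<in> outer_steps n"
  then obtain a where "g \<in> C" "a \<in> V" "h = g \<cdot> E [a]" "n \<le> len g" "n \<le> len h"
    by (auto simp: outer_steps_def)
  then show "(h, g) \<in> outer_steps n" using outer_stepI[of h a n] by simp
qed

text \<open>
  The next hypothesis says that no clique, the empty one included, separates the graph. The
  neighbours of \<open>g\<close> farther from \<open>\<bbbone>\<close> than \<open>g\<close> correspond to the vertices outside the clique of
  descents of \<open>g\<close>; along an edge \<open>(a, b)\<close> between such vertices there is a detour from
  \<open>g \<cdot> E [a]\<close> to \<open>g \<cdot> E [b]\<close> through \<open>g \<cdot> E [a] \<cdot> E [b]\<close>.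
\<close>

context
  assumes no_separating_clique: "\<And>D a b. D \<subseteq> V \<Longrightarrow>
    (\<And>s t. s \<in> D \<Longrightarrow> t \<in> D \<Longrightarrow> s \<noteq> t \<Longrightarrow> (s, t) \<in> parcs \<Delta>) \<Longrightarrow>
    a \<in> V - D \<Longrightarrow> b \<in> V - D \<Longrightarrow> (a, b) \<in> (parcs \<Delta> \<inter> (V - D) \<times> (V - D))\<^sup>*"
begin

lemma ascents_connected:
  assumes g: "g \<in> C" and a: "a \<in> V" "reflection g a \<notin> walls g"
    and b: "b \<in> V" "reflection g b \<notin> walls g"
  shows "(g \<cdot> E [a], g \<cdot> E [b]) \<in> (outer_steps (Suc (len g)))\<^sup>*"
proof -
  define D where "D = {s \<in> V. reflection g s \<in> walls g}"
  have "(a, b) \<in> (parcs \<Delta> \<inter> (V - D) \<times> (V - D))\<^sup>*"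
  proof (rule no_separating_clique)
    show "(s, t) \<in> parcs \<Delta>" if "s \<in> D" "t \<in> D" "s \<noteq> t" for s t
      using that descents_adjacent[OF g] by (auto simp: D_def)
  qed (use a b in \<open>auto simp: D_def\<close>)
  then show ?thesis
  proof (induction rule: rtrancl_induct)
    case base
    then show ?case by simp
  next
    case (step c d)
    then have e: "(c, d) \<in> parcs \<Delta>" "c \<in> V" "d \<in> V" "c \<noteq> d"
      and r: "reflection g c \<notin> walls g" "reflection g d \<notin> walls g"
      using no_loops[of "(c, d)"] by (auto simp: D_def)
    have lens: "len (g \<cdot> E [c]) = Suc (len g)" "len (g \<cdot> E [d]) = Suc (len g)"
      using g e r len_mult_gen(2) by auto
    have eq: "g \<cdot> E [c] \<cdot> E [d] = g \<cdot> E [d] \<cdot> E [c]"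
      using g e gen_commute[OF e(1)] by (simp add: W.m_assoc)
    have "n \<le> len (g \<cdot> E [c] \<cdot> E [d])" if "n = Suc (len g)" for n
    proof -
      have "reflection (g \<cdot> E [c]) d = reflection g d" using g e by (simp add: reflection_step)
      moreover have "reflection g d \<noteq> reflection g c"
      proof
        assume "reflection g d = reflection g c"
        then have "g \<cdot> E [d] = g \<cdot> E [c]" using g e reflection_mult by metis
        then have "E [c] = E [d]" using g e by (metis W.Units_l_cancel W.Units_eq gen_carrier)
        then show False using e gen_inj by metis
      qed
      ultimately have "reflection (g \<cdot> E [c]) d \<notin> walls (g \<cdot> E [c])"
        using g e r by (simp add: walls_mult_gen mem_toggle)
      then show ?thesis using g e that lens len_mult_gen(2)[of "g \<cdot> E [c]" d] by simp
    qed
    then have far: "Suc (len g) \<le> len (g \<cdot> E [c] \<cdot> E [d])" by simp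
    have "(g \<cdot> E [c], g \<cdot> E [c] \<cdot> E [d]) \<in> outer_steps (Suc (len g))"
      using g e lens far by (intro outer_stepI) simp_all
    moreover have "(g \<cdot> E [d], g \<cdot> E [d] \<cdot> E [c]) \<in> outer_steps (Suc (len g))"
      using g e lens far[unfolded eq] by (intro outer_stepI) simp_all
    ultimately have "(g \<cdot> E [c], g \<cdot> E [d]) \<in> (outer_steps (Suc (len g)))\<^sup>*"
      using eq symD[OF outer_steps_sym] by (metis converse_rtrancl_into_rtrancl r_into_rtrancl)
    then show ?case using step.IH by (rule rtrancl_trans[rotated])
  qed
qed

text \<open>
  Induction on the radius. A path outside the open ball of radius \<open>n\<close> has no two consecutive points
  at distance \<open>n\<close> from \<open>\<bbbone>\<close>, since neighbours differ in length by one. Each visit of the sphere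
  of radius \<open>n\<close> therefore goes from one farther neighbour of a point to another one, and these are
  joined outside the sphere.
\<close>

lemma outer_connected:
  "g \<in> C \<Longrightarrow> h \<in> C \<Longrightarrow> n \<le> len g \<Longrightarrow> n \<le> len h \<Longrightarrow> (g, h) \<in> (outer_steps n)\<^sup>*"
proof (induction n arbitrary: g h)
  case 0
  have one: "(\<bbbone>, x) \<in> (outer_steps 0)\<^sup>*" if "x \<in> C" for x
    using that
  proof (induction rule: element_induct)
    case (mult x a)
    then show ?case using outer_stepI[of x a 0] by (meson le0 rtrancl.rtrancl_into_rtrancl)
  qed simp
  then have "(g, \<bbbone>) \<in> (outer_steps 0)\<^sup>*"
    using 0 symD[OF sym_rtrancl[OF outer_steps_sym]] by blast
  then show ?case using one 0 by (meson rtrancl_trans)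
next
  case (Suc n)
  let ?R = "(outer_steps (Suc n))\<^sup>*"
  have "(g, h) \<in> (outer_steps n)\<^sup>*" using Suc by simp
  then have "h \<in> C \<and> (Suc n \<le> len h \<longrightarrow> (g, h) \<in> ?R) \<and>
      (len h = n \<longrightarrow> (\<forall>a\<in>V. reflection h a \<notin> walls h \<longrightarrow> (g, h \<cdot> E [a]) \<in> ?R))"
  proof (induction rule: rtrancl_induct)
    case base
    then show ?case using Suc.prems by simp
  next
    case (step x y)
    then obtain c where c: "x \<in> C" "c \<in> V" "y = x \<cdot> E [c]" "n \<le> len x" "n \<le> len y"
      by (auto simp: outer_steps_def)
    then have y: "y \<in> C" "x = y \<cdot> E [c]" by simp_all
    show ?case
    proof (cases "len x = n")
      case True
      then have "reflection x c \<notin> walls x" using c len_mult_gen(1)[of x c] by auto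
      then show ?thesis using True step.IH c len_mult_gen(2)[of x c] by simp
    next
      case False
      then have gx: "(g, x) \<in> ?R" using step.IH c by simp
      show ?thesis
      proof (cases "len y = n")
        case True
        then have "reflection y c \<notin> walls y"
          using False c(4) len_mult_gen(1)[OF y(1) c(2), folded y(2)] by auto
        then have "(x, y \<cdot> E [a]) \<in> ?R" if "a \<in> V" "reflection y a \<notin> walls y" for a
          using ascents_connected[OF y(1) c(2) _ that, folded y(2)] True by simp
        then show ?thesis using True gx y(1) by (auto intro: rtrancl_trans)
      next
        case False': False
        then have "(x, y) \<in> outer_steps (Suc n)" using False c outer_stepI[of x c "Suc n"] by simp
        then show ?thesis using gx y(1) False' by (auto intro: rtrancl_into_rtrancl)
      qed
    qed
  qed
  then show ?case using Suc.prems by simp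
qed

lemma finite_ball: "finite {g \<in> C. len g < n}"
proof -
  have "{g \<in> C. len g < n} \<subseteq> E ` {w. set w \<subseteq> V \<and> length w \<le> n}"
  proof
    fix g assume "g \<in> {g \<in> C. len g < n}"
    moreover then obtain w where "w \<in> lists V" "E w = g" "length w = len g" using len_word by blast
    ultimately show "g \<in> E ` {w. set w \<subseteq> V \<and> length w \<le> n}" by (auto intro!: image_eqI[of _ _ w])
  qed
  moreover have "finite {w. set w \<subseteq> V \<and> length w \<le> n}"
    by (intro finite_lists_length_le) simp
  ultimately show ?thesis by (meson finite_imageI finite_subset)
qed

lemma generate_gens: "generate (racg \<Delta>) (racg_gens \<Delta>) = C"
proof
  show "generate (racg \<Delta>) (racg_gens \<Delta>) \<subseteq> C"
    by (intro W.generate_incl) (auto simp: racg_gens_def)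
  show "C \<subseteq> generate (racg \<Delta>) (racg_gens \<Delta>)"
  proof
    fix g assume "g \<in> C"
    then show "g \<in> generate (racg \<Delta>) (racg_gens \<Delta>)"
      by (induction rule: element_induct)
        (auto simp: racg_gens_def intro: generate.one generate.eng generate.incl)
  qed
qed

text \<open>
  Balls are finite, so a finite set lies in a ball, and an infinite component of its complement meets
  the connected complement of this ball.
\<close>

lemma one_endedI:
  assumes inf: "infinite C"
  shows "one_ended (racg \<Delta>)"
  unfolding one_ended_def
proof (intro exI conjI)
  show "finite (racg_gens \<Delta>)" "racg_gens \<Delta> \<subseteq> C" by (auto simp: racg_gens_def)
  show "generate (racg \<Delta>) (racg_gens \<Delta>) = C" by (rule generate_gens)
  show "one_ended_graph (with_proj (cayley_graph (racg \<Delta>) (racg_gens \<Delta>)))"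
    unfolding one_ended_graph_def
  proof (intro allI impI, elim conjE)
    let ?X = "with_proj (cayley_graph (racg \<Delta>) (racg_gens \<Delta>))"
    fix F assume F: "finite F" "F \<subseteq> verts ?X"
    let ?Y = "?X \<restriction> (verts ?X - F)"
    have X: "verts ?X = C" by (simp add: cayley_graph_def)
    define n where "n = Suc (Max (insert 0 (len ` F)))"
    have nF: "g \<notin> F" if "n \<le> len g" for g
    proof
      assume "g \<in> F"
      then have "len g \<le> Max (insert 0 (len ` F))" using F(1) by (intro Max_ge) auto
      then show False using that by (simp add: n_def)
    qed
    have arc: "(g, h) \<in> arcs_ends ?Y" if "(g, h) \<in> outer_steps n" for g h
    proof -
      from that obtain a where "g \<in> C" "a \<in> V" "h = g \<cdot> E [a]" "n \<le> len g" "n \<le> len h"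
        by (auto simp: outer_steps_def)
      then show ?thesis using nF
        by (auto simp: arcs_ends_def arc_to_ends_def induce_subgraph_def cayley_graph_def racg_gens_def
            intro!: image_eqI[of _ _ "(g, h)"])
    qed
    have far: "g \<rightarrow>\<^sup>*\<^bsub>?Y\<^esub> h" if "g \<in> C" "n \<le> len g" "h \<in> C" "n \<le> len h" for g h
    proof -
      have "(g, h) \<in> (outer_steps n)\<^sup>*" using that outer_connected by blast
      then show ?thesis
      proof (induction rule: rtrancl_induct)
        case base
        then show ?case using that nF X by (simp add: reachable_def rtrancl_on.intros)
      next
        case (step y z)
        then have "z \<in> verts ?Y" using nF X by (auto simp: outer_steps_def)
        then show ?case using step.IH arc[OF step.hyps(2)]
          unfolding reachable_def by (rule rtrancl_on_into_rtrancl_on[rotated -1])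
      qed
    qed
    have meets: "\<exists>g\<in>S. g \<in> C \<and> n \<le> len g" if "infinite S" "S \<in> pre_digraph.sccs_verts ?Y" for S
    proof -
      have "S \<subseteq> C"
      proof
        fix g assume "g \<in> S"
        then have "g \<rightarrow>\<^sup>*\<^bsub>?Y\<^esub> g" using that(2) unfolding pre_digraph.sccs_verts_def by blast
        then have "g \<in> verts ?Y" unfolding reachable_def by (rule in_rtrancl_on_in_F)
        then show "g \<in> C" using X by simp
      qed
      moreover have "\<not> S \<subseteq> {g \<in> C. len g < n}"
        using finite_subset[OF _ finite_ball] that(1) by blast
      ultimately show ?thesis by (auto simp: not_less)
    qed
    have scc: "S = {v. g \<rightarrow>\<^sup>*\<^bsub>?Y\<^esub> v \<and> v \<rightarrow>\<^sup>*\<^bsub>?Y\<^esub> g}"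
      if "S \<in> pre_digraph.sccs_verts ?Y" "g \<in> S" for S g
      using that unfolding pre_digraph.sccs_verts_def by blast
    have "\<not> C \<subseteq> {g \<in> C. len g < n}" using finite_ball inf finite_subset by blast
    then obtain z where "z \<in> C" "\<not> len z < n" by blast
    then have z: "z \<in> C" "n \<le> len z" by simp_all
    define S where "S = {v. z \<rightarrow>\<^sup>*\<^bsub>?Y\<^esub> v \<and> v \<rightarrow>\<^sup>*\<^bsub>?Y\<^esub> z}"
    have tr: "x \<rightarrow>\<^sup>*\<^bsub>?Y\<^esub> y \<Longrightarrow> y \<rightarrow>\<^sup>*\<^bsub>?Y\<^esub> v \<Longrightarrow> x \<rightarrow>\<^sup>*\<^bsub>?Y\<^esub> v" for x y v
      unfolding reachable_def by (rule rtrancl_on_trans)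
    have S: "S \<in> pre_digraph.sccs_verts ?Y"
      unfolding pre_digraph.sccs_verts_def mem_Collect_eq
    proof (intro conjI ballI allI impI)
      show "S \<noteq> {}" using far[OF z z] by (auto simp: S_def)
      show "u \<rightarrow>\<^sup>*\<^bsub>?Y\<^esub> v" if "u \<in> S" "v \<in> S" for u v
        using that tr[of u z v] by (simp add: S_def)
      show "\<not> u \<rightarrow>\<^sup>*\<^bsub>?Y\<^esub> v \<or> \<not> v \<rightarrow>\<^sup>*\<^bsub>?Y\<^esub> u" if "u \<in> S" "v \<notin> S" for u v
        using that tr[of z u v] tr[of v u z] by (auto simp: S_def)
    qed
    have farS: "g \<in> S" if "g \<in> C" "n \<le> len g" for g
      using far[OF z that] far[OF that z] by (simp add: S_def)
    have inf_S: "infinite S"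
    proof
      assume "finite S"
      then have "finite (S \<union> {g \<in> C. len g < n})" using finite_ball by simp
      moreover have "C \<subseteq> S \<union> {g \<in> C. len g < n}" using farS not_less by blast
      ultimately show False using inf finite_subset by blast
    qed
    have uniq: "T = S" if T: "T \<in> pre_digraph.sccs_verts ?Y" "infinite T" for T
    proof -
      obtain g where g: "g \<in> T" "g \<in> C" "n \<le> len g" using meets T by blast
      show ?thesis using scc[OF T(1) g(1)] scc[OF S farS[OF g(2,3)]] by simp
    qed
    show "\<exists>!S. S \<in> pre_digraph.sccs_verts ?Y \<and> infinite S"
    proof (rule ex1I[of _ S])
      show "S \<in> pre_digraph.sccs_verts ?Y \<and> infinite S" using S inf_S by (rule conjI)
      show "T = S" if "T \<in> pre_digraph.sccs_verts ?Y \<and> infinite T" for T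
        using that by (elim conjE) (rule uniq)
    qed
  qed
qed

end

end

section \<open>The generalization as a group of closed staircase walks\<close>

text \<open>
  \<open>B j\<close> is the part of the decomposition whose letters label the edges from the \<open>j\<close>-th vertex
  of the cycle of length \<open>2 * k\<close> to the next one.
\<close>

locale cycle_partite = finite_racg \<Delta> for \<Delta> :: "'b pair_pre_digraph" +
  fixes k :: nat and B :: "nat \<Rightarrow> 'b set"
  assumes k2: "2 \<le> k"
    and verts_parts: "pverts \<Delta> = (\<Union>j<2 * k. B j)"
    and parts_disjoint: "i < 2 * k \<Longrightarrow> j < 2 * k \<Longrightarrow> i \<noteq> j \<Longrightarrow> B i \<inter> B j = {}"
    and edge_parity: "(a, b) \<in> parcs \<Delta> \<Longrightarrow> i < 2 * k \<Longrightarrow> j < 2 * k \<Longrightarrow> a \<in> B i \<Longrightarrow> b \<in> B j \<Longrightarrow>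
      even i \<noteq> even j"
    and parts_path: "i < 2 * k \<Longrightarrow> j < 2 * k \<Longrightarrow> even i \<Longrightarrow> odd j \<Longrightarrow>
      \<exists>vs. distinct vs \<and> set vs = B i \<union> B j \<and>
        (\<forall>x\<in>B i \<union> B j. \<forall>y\<in>B i \<union> B j. (x, y) \<in> parcs \<Delta> \<longleftrightarrow>
          (\<exists>m. Suc m < length vs \<and> (x = vs ! m \<and> y = vs ! Suc m \<or> y = vs ! m \<and> x = vs ! Suc m)))"
    and parts_card: "j < 2 * k \<Longrightarrow> 2 \<le> card (B j)"
begin

abbreviation N where "N \<equiv> 2 * int k"

text \<open>
  The labels of the edges from \<open>t\<close> to \<open>t + 1\<close> in the infinite cyclic cover of the cycle.
\<close>

definition part :: "int \<Rightarrow> 'b set" where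
  "part t = B (nat (t mod N))"

definition index :: "'b \<Rightarrow> nat" where
  "index a = (THE j. j < 2 * k \<and> a \<in> B j)"

lemma index_eq: "j < 2 * k \<Longrightarrow> a \<in> B j \<Longrightarrow> index a = j"
  unfolding index_def using parts_disjoint by (intro the_equality) blast+

lemma N_pos: "0 < N"
  using k2 by simp

lemma nat_mod_N: "nat (t mod N) < 2 * k"
  using N_pos pos_mod_bound[of N t] by (simp add: nat_less_iff)

lemma index_part: "a \<in> part t \<Longrightarrow> int (index a) = t mod N"
  using index_eq[of "nat (t mod N)" a] nat_mod_N N_pos by (simp add: part_def)

lemma part_vertex: "a \<in> part t \<Longrightarrow> a \<in> V"
  using nat_mod_N by (auto simp: part_def verts_parts)

lemma vertex_part: "a \<in> V \<Longrightarrow> a \<in> part (int (index a)) \<and> index a < 2 * k"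
proof -
  assume "a \<in> V"
  then obtain j where "j < 2 * k" "a \<in> B j" by (auto simp: verts_parts)
  moreover then have "int j mod N = int j" by (intro mod_pos_pos_trivial) auto
  ultimately show ?thesis by (simp add: index_eq part_def)
qed

lemma part_ne: "\<exists>a. a \<in> part t"
proof -
  have "part t \<noteq> {}"
    using parts_card[OF nat_mod_N[of t]] unfolding part_def by (metis card.empty not_numeral_le_zero)
  then show ?thesis by blast
qed

text \<open>
  Labels of edge paths in the infinite cyclic cover.
\<close>

fun walk :: "int \<Rightarrow> 'b list \<Rightarrow> int \<Rightarrow> bool" where
  "walk t [] t' \<longleftrightarrow> t = t'"
| "walk t (a # w) t' \<longleftrightarrow>
     a \<in> part t \<and> walk (t + 1) w t' \<or> a \<in> part (t - 1) \<and> walk (t - 1) w t'"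

lemma walk_append: "walk t (u @ v) t' \<longleftrightarrow> (\<exists>m. walk t u m \<and> walk m v t')"
  by (induction u arbitrary: t) auto

lemma walk_rev: "walk t w t' \<Longrightarrow> walk t' (rev w) t"
proof (induction w arbitrary: t)
  case (Cons a w)
  then have "a \<in> part t \<and> walk t' (rev w) (t + 1) \<or> a \<in> part (t - 1) \<and> walk t' (rev w) (t - 1)"
    by auto
  then show ?case by (auto simp: walk_append)
qed simp

lemma part_shift: "part (t + N * m) = part t"
  by (simp add: part_def)

lemma walk_shift: "walk t w t' \<Longrightarrow> walk (t + N * m) w (t' + N * m)"
proof (induction w arbitrary: t)
  case (Cons a w)
  have "part (t + N * m) = part t" "part (t + N * m - 1) = part (t - 1)"
    using part_shift[of t m] part_shift[of "t - 1" m] by (simp_all add: algebra_simps)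
  then show ?case using Cons.prems Cons.IH[of "t + 1"] Cons.IH[of "t - 1"]
    by (auto simp: algebra_simps)
qed simp

lemma walk_lists: "walk t w t' \<Longrightarrow> w \<in> lists V"
  by (induction w arbitrary: t) (auto simp: part_vertex)

text \<open>
  This is the generalization, as \<open>rose_loops_walks\<close> will show.
\<close>

definition H where "H = E ` {w. \<exists>m. walk 0 w (N * m)}"

lemma H_I: "walk 0 w (N * m) \<Longrightarrow> E w \<in> H"
  by (auto simp: H_def)

lemma subgroup_H: "subgroup H (racg \<Delta>)"
proof (rule W.subgroupI)
  show "H \<subseteq> C" using walk_lists by (auto simp: H_def)
  show "H \<noteq> {}" using H_I[of "[]" 0] by auto
  fix g assume "g \<in> H"
  then obtain w m where w: "walk 0 w (N * m)" "g = E w" by (auto simp: H_def)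
  have "walk 0 (rev w) (N * (- m))"
    using walk_shift[OF walk_rev[OF w(1)], of "- m"] by (simp add: algebra_simps)
  from H_I[OF this] show "g\<^sup>- \<in> H" using racg_elem_rev[OF walk_lists[OF w(1)]] w(2) by simp
  fix h assume "h \<in> H"
  then obtain v l where v: "walk 0 v (N * l)" "h = E v" by (auto simp: H_def)
  have "walk 0 (w @ v) (N * (l + m))"
    using w walk_shift[OF v(1), of m] by (auto simp: walk_append algebra_simps)
  from H_I[OF this] show "g \<cdot> h \<in> H"
    using w(2) v(2) E_append[OF walk_lists[OF w(1)] walk_lists[OF v(1)]] by simp
qed

section \<open>Positions in the grid\<close>

text \<open>
  The staircase of \<open>s\<^sub>1 s\<^sub>2 \<dots>\<close> in the integer grid: even steps are horizontal, odd ones vertical.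
\<close>

definition grid :: "int \<Rightarrow> int \<times> int" where
  "grid t = ((t + 1) div 2, t div 2)"

definition shift :: "int \<Rightarrow> int \<Rightarrow> int" where
  "shift d p = (if p mod int k = d then p + 1 else if (p - 1) mod int k = d then p - 1 else p)"

text \<open>
  A letter of even index labels horizontal edges, in the columns congruent to \<open>index a div 2\<close> modulo
  \<open>k\<close>, and a letter of odd index vertical edges, in the rows congruent to it. A point without such an
  edge is fixed. Adjacent letters have indices of different parity, so they change different
  coordinates.
\<close>

definition move :: "'b \<Rightarrow> int \<times> int \<Rightarrow> int \<times> int" where
  "move a = (\<lambda>(p, q). if even (index a) then (shift (int (index a) div 2) p, q)
     else (p, shift (int (index a) div 2) q))"

lemma mod_pred_ne: "(p - 1) mod int k \<noteq> p mod int k"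
proof
  assume "(p - 1) mod int k = p mod int k"
  then have "int k dvd p - 1 - p" by (metis mod_eq_dvd_iff)
  then show False using k2 by simp
qed

lemma shift_shift: "shift d (shift d p) = p"
  using mod_pred_ne[of p] mod_pred_ne[of "p + 1"] mod_pred_ne[of "p - 1"]
  by (auto simp: shift_def)

lemma shift_bound: "\<bar>shift d p - p\<bar> \<le> 1"
  by (simp add: shift_def)

lemma move_move: "move a (move a x) = x"
  by (cases x) (simp add: move_def shift_shift)

lemma edge_index: "(a, b) \<in> parcs \<Delta> \<Longrightarrow> even (index a) \<noteq> even (index b)"
  using edge_vertices[of a b] edge_parity index_eq by (fastforce simp: verts_parts)

lemma move_action: "racg_action \<Delta> UNIV move"
  unfolding racg_action_def
proof (intro conjI ballI allI impI)
  fix a b x assume "(a, b) \<in> parcs \<Delta>"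
  then show "move a (move b x) = move b (move a x)"
    using edge_index[of a b] by (cases x) (auto simp: move_def)
qed (simp_all add: move_move)

lemma move_part:
  assumes "a \<in> part t"
  shows "move a (grid t) = grid (t + 1)"
proof -
  have k: "0 < int k" using k2 by simp
  have 1: "int (index a) = t mod N" using index_part assms by blast
  then have "even (int (index a)) \<longleftrightarrow> even t"
    by (simp add: dvd_mod_iff)
  then have 2: "even (index a) \<longleftrightarrow> even t" by simp
  have "t mod N div 2 = (t div 2) mod int k"
    using k by (simp add: mod_mult2_eq zmod_zmult2_eq)
  then have "int (index a) div 2 = (t div 2) mod int k" using 1 by simp
  then show ?thesis using 2
    by (cases "even t") (auto simp: move_def grid_def shift_def elim!: evenE oddE)
qed

lemma move_walk: "walk t w t' \<Longrightarrow> fold move w (grid t) = grid t'"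
proof (induction w arbitrary: t)
  case (Cons a w)
  then consider "a \<in> part t" "walk (t + 1) w t'" | "a \<in> part (t - 1)" "walk (t - 1) w t'" by auto
  then show ?case
  proof cases
    case 1
    then show ?thesis using Cons.IH move_part by simp
  next
    case 2
    then have "move a (grid t) = grid (t - 1)" using move_part[of a "t - 1"] move_move by (metis diff_add_cancel)
    then show ?thesis using Cons.IH 2 by simp
  qed
qed simp

definition position where "position g = act move g (0, 0)"

lemma position_E: "w \<in> lists V \<Longrightarrow> position (E w) = fold move w (0, 0)"
  unfolding position_def by (rule act_E[OF move_action]) auto

lemma position_mult: "g \<in> C \<Longrightarrow> a \<in> V \<Longrightarrow> position (g \<cdot> E [a]) = move a (position g)"
  unfolding position_def using act_mult[OF move_action] act_gen[OF move_action] by simp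

lemma position_H: "h \<in> H \<Longrightarrow> \<exists>m. position h = (int k * m, int k * m)"
proof -
  assume "h \<in> H"
  then obtain w m where w: "walk 0 w (N * m)" "h = E w" by (auto simp: H_def)
  have "grid 0 = (0, 0)" "grid (N * m) = (int k * m, int k * m)" by (simp_all add: grid_def)
  then show ?thesis using move_walk[OF w(1)] position_E walk_lists[OF w(1)] w(2) by auto
qed


section \<open>Connectivity of the partite graph\<close>

lemma parts_list:
  assumes "i < 2 * k" "j < 2 * k" "even i \<noteq> even j"
  shows "\<exists>vs. distinct vs \<and> set vs = B i \<union> B j \<and>
    (\<forall>x\<in>B i \<union> B j. \<forall>y\<in>B i \<union> B j. (x, y) \<in> parcs \<Delta> \<longleftrightarrow>
      (\<exists>m. Suc m < length vs \<and> (x = vs ! m \<and> y = vs ! Suc m \<or> y = vs ! m \<and> x = vs ! Suc m)))"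
proof (cases "even i")
  case True
  then show ?thesis using parts_path[of i j] assms by simp
next
  case False
  then show ?thesis using parts_path[of j i] assms by (simp add: Un_commute)
qed

lemma parts_constant:
  assumes ij: "i < 2 * k" "j < 2 * k" "even i \<noteq> even j"
    and f: "\<And>a b. a \<in> B i \<Longrightarrow> b \<in> B j \<Longrightarrow> (a, b) \<in> parcs \<Delta> \<Longrightarrow> f a = f b"
    and xy: "x \<in> B i \<union> B j" "y \<in> B i \<union> B j"
  shows "f x = f y"
proof -
  from parts_list[OF ij] obtain vs where vs: "set vs = B i \<union> B j"
    and e: "\<And>x y. x \<in> B i \<union> B j \<Longrightarrow> y \<in> B i \<union> B j \<Longrightarrow> (x, y) \<in> parcs \<Delta> \<longleftrightarrow>
      (\<exists>m. Suc m < length vs \<and> (x = vs ! m \<and> y = vs ! Suc m \<or> y = vs ! m \<and> x = vs ! Suc m))"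
    by blast
  have step: "f (vs ! m) = f (vs ! Suc m)" if m: "Suc m < length vs" for m
  proof -
    have mem: "vs ! m \<in> B i \<union> B j" "vs ! Suc m \<in> B i \<union> B j"
      using m vs nth_mem[of m vs] nth_mem[of "Suc m" vs] by auto
    then have edge: "(vs ! m, vs ! Suc m) \<in> parcs \<Delta>" using e[OF mem] m by blast
    then have "vs ! m \<in> B i \<and> vs ! Suc m \<in> B j \<or> vs ! m \<in> B j \<and> vs ! Suc m \<in> B i"
      using mem edge_parity ij by blast
    then show ?thesis using f edge edge_sym[OF edge] by metis
  qed
  have "f (vs ! m) = f (vs ! 0)" if "m < length vs" for m
    using that by (induction m) (auto simp: step[symmetric])
  then show ?thesis using xy vs by (metis in_set_conv_nth)
qed

text \<open>
  Without a neighbour, \<open>x\<close> would be distinguished from all other vertices by a function that is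
  constant along the edges.
\<close>

lemma part_neighbour:
  assumes ij: "i < 2 * k" "j < 2 * k" "even i \<noteq> even j" and x: "x \<in> B i"
  shows "\<exists>y\<in>B j. (x, y) \<in> parcs \<Delta>"
proof (rule ccontr)
  assume no: "\<not> (\<exists>y\<in>B j. (x, y) \<in> parcs \<Delta>)"
  have disj: "B i \<inter> B j = {}" using parts_disjoint ij by blast
  have "B j \<noteq> {}" using parts_card[OF ij(2)] by (metis card.empty not_numeral_le_zero)
  then obtain y where y: "y \<in> B j" by blast
  have "(x = x) = (y = x)"
    by (rule parts_constant[OF ij, where f = "\<lambda>z. z = x"]) (use no disj x y in blast)+
  then show False using x y disj by auto
qed

lemma index_part_mem: "a \<in> V \<Longrightarrow> a \<in> B (index a)" "a \<in> V \<Longrightarrow> index a < 2 * k"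
  using index_eq by (auto simp: verts_parts)

text \<open>
  A clique meets at most one of the parts of either parity. Two parts of different parity that it
  does not meet are joined by a path, and every other vertex has neighbours in one of them. Such
  parts exist, as there are at least two parts of each parity.
\<close>

lemma no_separating_clique:
  assumes DV: "D \<subseteq> V" and clique: "\<And>s t. s \<in> D \<Longrightarrow> t \<in> D \<Longrightarrow> s \<noteq> t \<Longrightarrow> (s, t) \<in> parcs \<Delta>"
    and ab: "a \<in> V - D" "b \<in> V - D"
  shows "(a, b) \<in> (parcs \<Delta> \<inter> (V - D) \<times> (V - D))\<^sup>*"
proof -
  define R where "R = parcs \<Delta> \<inter> (V - D) \<times> (V - D)"
  have symR: "sym (R\<^sup>*)"
    by (intro sym_rtrancl symI) (auto simp: R_def dest: edge_sym)
  have clear: "\<exists>i<4. even i = e \<and> B i \<inter> D = {}" for e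
  proof (cases "\<exists>x\<in>D. even (index x) = e")
    case True
    then obtain x where x: "x \<in> D" "even (index x) = e" by blast
    \<comment> \<open>a part of parity \<open>e\<close> other than that of \<open>x\<close>; there are two of them as \<open>2 \<le> k\<close>\<close>
    define i where "i = (if e then if index x = 0 then 2 else 0 else if index x = 1 then 3 else (1::nat))"
    have i: "i < 4" "even i = e" "i \<noteq> index x" using x(2) by (auto simp: i_def)
    have "y \<notin> D" if "y \<in> B i" for y
    proof
      assume "y \<in> D"
      have "index y = i" using that i(1) k2 by (intro index_eq) auto
      then have "y \<noteq> x" using i by auto
      then show False using clique[OF \<open>y \<in> D\<close> x(1)] edge_index[of y x] \<open>index y = i\<close> i x(2) by auto
    qed
    then show ?thesis using i by blast
  next
    case False
    then have "y \<notin> D" if "y \<in> B (if e then 0 else 1)" for y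
      using index_eq[OF _ that] k2 by auto
    then show ?thesis by (intro exI[of _ "if e then 0 else 1"]) auto
  qed
  from clear[of True] obtain i where i: "i < 4" "even i" "B i \<inter> D = {}" by auto
  from clear[of False] obtain j where j: "j < 4" "odd j" "B j \<inter> D = {}" by auto
  have ij: "i < 2 * k" "j < 2 * k" "even i \<noteq> even j" using i j k2 by auto
  have sub: "B l \<subseteq> V" if "l < 2 * k" for l using that by (auto simp: verts_parts)
  have link: "(x, y) \<in> R\<^sup>*" if "x \<in> B i \<union> B j" "y \<in> B i \<union> B j" for x y
  proof -
    have "{z. (x, z) \<in> R\<^sup>*} = {z. (y, z) \<in> R\<^sup>*}"
    proof (rule parts_constant[OF ij _ that, where f = "\<lambda>x. {z. (x, z) \<in> R\<^sup>*}"])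
      fix a b assume "a \<in> B i" "b \<in> B j" "(a, b) \<in> parcs \<Delta>"
      then have "(a, b) \<in> R" using i j sub[OF ij(1)] sub[OF ij(2)] by (auto simp: R_def)
      then have "(a, b) \<in> R\<^sup>*" "(b, a) \<in> R\<^sup>*"
        using symD[OF symR, of a b] by auto
      then show "{z. (a, z) \<in> R\<^sup>*} = {z. (b, z) \<in> R\<^sup>*}" by (auto intro: rtrancl_trans)
    qed
    then show ?thesis by auto
  qed
  have reach: "\<exists>y\<in>B i \<union> B j. (x, y) \<in> R\<^sup>*" if x: "x \<in> V - D" for x
  proof -
    have "\<exists>l\<in>{i, j}. even (index x) \<noteq> even l" using i j by auto
    then obtain l where l: "l \<in> {i, j}" "even (index x) \<noteq> even l" by blast
    then obtain y where y: "y \<in> B l" "(x, y) \<in> parcs \<Delta>"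
      using part_neighbour[of "index x" l x] index_part_mem[of x] x ij by auto
    then have "(x, y) \<in> R" using x l i j sub ij by (auto simp: R_def)
    then show ?thesis using y l by blast
  qed
  obtain x y where "x \<in> B i \<union> B j" "(a, x) \<in> R\<^sup>*" "y \<in> B i \<union> B j" "(b, y) \<in> R\<^sup>*"
    using reach ab by metis
  then have "(a, b) \<in> R\<^sup>*" using link[of x y] symD[OF symR] by (meson rtrancl_trans)
  then show ?thesis by (simp add: R_def)
qed

section \<open>Cosets along the grid and failure of quasiconvexity\<close>

lemma move_hor: "a \<in> part (2 * p) \<Longrightarrow> move a (p, q) = (p + 1, q)"
  using move_part[of a "2 * p"] by (auto simp: grid_def move_def split: if_splits)
    
lemma move_ver: "b \<in> part (2 * q + 1) \<Longrightarrow> move b (p, q) = (p, q + 1)"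
  using move_part[of b "2 * q + 1"] by (auto simp: grid_def move_def split: if_splits)

definition letter :: "int \<Rightarrow> 'b" where
  "letter t = (SOME a. a \<in> part t)"

lemma letter_part: "letter t \<in> part t"
  unfolding letter_def using part_ne by (rule someI_ex)

definition hor_word :: "nat \<Rightarrow> 'b list" where
  "hor_word m = map (\<lambda>p. letter (2 * int p)) [0..<m]"

definition ver_word :: "nat \<Rightarrow> 'b list" where
  "ver_word m = map (\<lambda>q. letter (2 * int q + 1)) [0..<m]"

lemma hor_word_Suc: "hor_word (Suc m) = hor_word m @ [letter (2 * int m)]"
  by (simp add: hor_word_def)

lemma ver_word_Suc: "ver_word (Suc m) = ver_word m @ [letter (2 * int m + 1)]"
  by (simp add: ver_word_def)

lemma hor_ver_lists [simp]: "hor_word m \<in> lists V" "ver_word m \<in> lists V"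
  using part_vertex[OF letter_part] by (auto simp: hor_word_def ver_word_def)

lemma move_hor_word: "fold move (hor_word m) (0, 0) = (int m, 0)"
proof (induction m)
  case 0
  then show ?case by (simp add: hor_word_def)
next
  case (Suc m)
  then show ?case using move_hor[OF letter_part, of "int m" 0] by (simp add: hor_word_Suc)
qed

lemma move_ver_word: "fold move (ver_word m) (p, 0) = (p, int m)"
proof (induction m)
  case 0
  then show ?case by (simp add: ver_word_def)
next
  case (Suc m)
  then show ?case using move_ver[OF letter_part, of "int m" p] by (simp add: ver_word_Suc add.commute)
qed

lemma infinite_elements: "infinite C"
proof
  assume "finite C"
  then have "finite (position ` C)" by simp
  moreover have "range (\<lambda>m. (int m, 0)) \<subseteq> position ` C"
  proof
    fix x assume "x \<in> range (\<lambda>m. (int m, 0 :: int))"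
    then obtain m where "x = (int m, 0)" by auto
    then have "x = position (E (hor_word m))" by (simp add: position_E move_hor_word)
    then show "x \<in> position ` C" by simp
  qed
  ultimately have "finite (range (\<lambda>m. (int m, 0 :: int)))" by (rule finite_subset[rotated])
  then show False by (subst (asm) finite_image_iff) (auto simp: inj_on_def)
qed

definition translate :: "'b \<Rightarrow> ('b \<times> bool) list set set \<Rightarrow> ('b \<times> bool) list set set" where
  "translate a X = (\<lambda>g. g \<cdot> E [a]) ` X"

lemma translate_action: "racg_action \<Delta> (Pow C) translate"
  unfolding racg_action_def
proof (intro conjI ballI allI impI)
  fix a X assume "a \<in> V" "X \<in> Pow C"
  then show "translate a X \<in> Pow C" "translate a (translate a X) = X"
    by (auto simp: translate_def image_image image_iff subset_iff)
next
  fix a b X assume e: "(a, b) \<in> parcs \<Delta>" and X: "X \<in> Pow C"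
  have "g \<cdot> E [b] \<cdot> E [a] = g \<cdot> E [a] \<cdot> E [b]" if "g \<in> X" for g
    using that X gen_commute[OF e] edge_vertices[OF e] by (auto simp: W.m_assoc)
  then show "translate a (translate b X) = translate b (translate a X)"
    by (auto simp: translate_def image_image intro!: image_cong)
qed

text \<open>
  The coset of \<open>H\<close> at the point \<open>t\<close> of the staircase; a letter labelling an edge there translates
  it to the coset at the other end.
\<close>

definition stair_coset :: "int \<Rightarrow> ('b \<times> bool) list set set" where
  "stair_coset t = E ` {w. \<exists>m. walk (N * m) w t}"

lemma stair_coset_C: "stair_coset t \<subseteq> C"
  using walk_lists by (auto simp: stair_coset_def)

lemma translate_stair:
  assumes a: "a \<in> part t"
  shows "translate a (stair_coset t) = stair_coset (t + 1)"
proof -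
  have aV: "a \<in> V" using a by (rule part_vertex)
  have ext: "translate a (stair_coset t) \<subseteq> stair_coset t'"
    if "\<And>m w. walk m w t \<Longrightarrow> walk m (w @ [a]) t'" for t t'
  proof
    fix g assume "g \<in> translate a (stair_coset t)"
    then obtain w m where w: "walk (N * m) w t" "g = E w \<cdot> E [a]"
      by (auto simp: translate_def stair_coset_def)
    then have "g = E (w @ [a])" using E_snoc[OF walk_lists[OF w(1)] aV] by simp
    then show "g \<in> stair_coset t'" using that[OF w(1)] by (auto simp: stair_coset_def)
  qed
  have 1: "translate a (stair_coset t) \<subseteq> stair_coset (t + 1)"
    by (rule ext) (use a in \<open>auto simp: walk_append\<close>)
  have 2: "translate a (stair_coset (t + 1)) \<subseteq> stair_coset t"
    by (rule ext) (use a in \<open>auto simp: walk_append\<close>)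
  have "stair_coset (t + 1) = translate a (translate a (stair_coset (t + 1)))"
    using translate_action aV stair_coset_C unfolding racg_action_def by auto
  also have "\<dots> \<subseteq> translate a (stair_coset t)"
    using 2 by (auto simp: translate_def)
  finally show ?thesis using 1 by blast
qed

lemma stair_coset_H: "stair_coset (N * m) \<subseteq> H"
proof
  fix g assume "g \<in> stair_coset (N * m)"
  then obtain w l where w: "walk (N * l) w (N * m)" "g = E w" by (auto simp: stair_coset_def)
  then have "walk 0 w (N * (m - l))" using walk_shift[of "N * l" w "N * m" "- l"]
    by (simp add: algebra_simps)
  then show "g \<in> H" using w(2) H_I by blast
qed

text \<open>
  If two sides of a square of the grid join cosets, so do the two other sides: adjacent letters
  commute, so they lead to the same new coset, and the graph on the two parts is connected.
\<close>

lemma fill_coset: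
  assumes ij: "i < 2 * k" "j < 2 * k" "even i \<noteq> even j" and X: "X \<subseteq> C" "Z \<subseteq> C"
    and XZ: "\<And>a b. a \<in> B i \<Longrightarrow> b \<in> B j \<Longrightarrow> translate a (translate b X) = Z"
  shows "\<exists>M. M \<subseteq> C \<and> (\<forall>a\<in>B i. translate a X = M) \<and> (\<forall>b\<in>B j. translate b M = Z)"
proof -
  define f where "f z = (if z \<in> B i then translate z X else translate z Z)" for z
  have disj: "B i \<inter> B j = {}" using parts_disjoint ij by blast
  have sub: "B i \<subseteq> V" "B j \<subseteq> V" using ij by (auto simp: verts_parts)
  have cl: "translate z Y \<subseteq> C" "translate z (translate z Y) = Y" if "z \<in> V" "Y \<subseteq> C" for z Y
    using translate_action that unfolding racg_action_def by auto
  have const: "f x = f y" if "x \<in> B i \<union> B j" "y \<in> B i \<union> B j" for x y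
  proof (rule parts_constant[OF ij _ that])
    fix a b assume ab: "a \<in> B i" "b \<in> B j" "(a, b) \<in> parcs \<Delta>"
    have "translate a (translate b X) = translate b (translate a X)"
      using translate_action ab(3) X(1) unfolding racg_action_def by blast
    then have "translate b (translate a X) = Z" using XZ[OF ab(1,2)] by simp
    then have "translate a X = translate b Z"
      using cl(2)[OF _ cl(1)[OF _ X(1)], of b a] ab sub by auto
    then show "f a = f b" using ab disj by (auto simp: f_def)
  qed
  have "B i \<noteq> {}" using parts_card[OF ij(1)] by (metis card.empty not_numeral_le_zero)
  then obtain a0 where a0: "a0 \<in> B i" by blast
  show ?thesis
  proof (intro exI[of _ "f a0"] conjI ballI)
    show "f a0 \<subseteq> C" using a0 cl(1)[of a0 X] sub X by (auto simp: f_def)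
    show "translate a X = f a0" if "a \<in> B i" for a
      using const[of a a0] that a0 by (auto simp: f_def)
    show "translate b (f a0) = Z" if b: "b \<in> B j" for b
    proof -
      have "f a0 = translate b Z" using const[of a0 b] a0 b disj by (auto simp: f_def)
      then show ?thesis using cl(2)[of b Z] b sub X by auto
    qed
  qed
qed

text \<open>
  Cosets at the vertices \<open>(q + d, q)\<close> and \<open>(q + d + 1, q)\<close> of the grid, for all \<open>q\<close>.
\<close>

definition coset_level where
  "coset_level d c0 c1 \<longleftrightarrow> (\<forall>q. c0 q \<subseteq> C \<and> c1 q \<subseteq> C \<and>
     (\<forall>a\<in>part (2 * (q + int d)). translate a (c0 q) = c1 q) \<and>
     (\<forall>b\<in>part (2 * q + 1). translate b (c1 q) = c0 (q + 1)))"

lemma coset_level_0: "coset_level 0 (\<lambda>q. stair_coset (2 * q)) (\<lambda>q. stair_coset (2 * q + 1))"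
  using translate_stair stair_coset_C by (auto simp: coset_level_def add.assoc dest: translate_stair)

lemma part_parity: "even (nat (t mod N)) \<longleftrightarrow> even t"
proof -
  have "even (t mod N) \<longleftrightarrow> even t" by (simp add: dvd_mod_iff)
  then show ?thesis using N_pos by (simp add: even_nat_iff)
qed

lemma coset_level_Suc:
  assumes "coset_level d c0 c1"
  shows "\<exists>c2. coset_level (Suc d) c1 c2"
proof -
  have "\<exists>M. M \<subseteq> C \<and> (\<forall>a\<in>part (2 * (q + int (Suc d))). translate a (c1 q) = M) \<and>
      (\<forall>b\<in>part (2 * q + 1). translate b M = c1 (q + 1))" for q
    unfolding part_def
  proof (rule fill_coset)
    fix a b assume ab: "a \<in> B (nat ((2 * (q + int (Suc d))) mod N))" "b \<in> B (nat ((2 * q + 1) mod N))"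
    have "2 * (q + int (Suc d)) = 2 * ((q + 1) + int d)" by simp
    then have "a \<in> part (2 * ((q + 1) + int d))" "b \<in> part (2 * q + 1)"
      using ab by (simp_all only: part_def)
    then show "translate a (translate b (c1 q)) = c1 (q + 1)"
      using assms unfolding coset_level_def by metis
  qed (use assms in \<open>simp_all only: part_parity nat_mod_N coset_level_def\<close>, simp_all)
  then obtain c2 where "\<And>q. c2 q \<subseteq> C \<and> (\<forall>a\<in>part (2 * (q + int (Suc d))). translate a (c1 q) = c2 q) \<and>
      (\<forall>b\<in>part (2 * q + 1). translate b (c2 q) = c1 (q + 1))" by metis
  then have "coset_level (Suc d) c1 c2" using assms unfolding coset_level_def by blast
  then show ?thesis by blast
qed

text \<open>
  Levels of cosets exist on all diagonals below the staircase. The word follows them from the coset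
  of \<open>\<bbbone>\<close> on the diagonal to the level \<open>k * m\<close> and back to the diagonal.
\<close>

lemma hor_ver_word_H: "E (hor_word (k * m) @ ver_word (k * m)) \<in> H"
proof -
  have "\<exists>f. \<forall>d. (coset_level d (fst (f d)) (snd (f d)) \<and>
      (d = 0 \<longrightarrow> fst (f d) = (\<lambda>q. stair_coset (2 * q)))) \<and> fst (f (Suc d)) = snd (f d)"
  proof (rule dependent_nat_choice)
    show "\<exists>x. coset_level 0 (fst x) (snd x) \<and> (0 = (0::nat) \<longrightarrow> fst x = (\<lambda>q. stair_coset (2 * q)))"
      using coset_level_0 by (metis fst_conv snd_conv)
    show "\<exists>y. (coset_level (Suc n) (fst y) (snd y) \<and>
        (Suc n = 0 \<longrightarrow> fst y = (\<lambda>q. stair_coset (2 * q)))) \<and> fst y = snd x"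
      if "coset_level n (fst x) (snd x) \<and> (n = 0 \<longrightarrow> fst x = (\<lambda>q. stair_coset (2 * q)))" for x n
      using coset_level_Suc that by (metis fst_conv snd_conv nat.distinct(1))
  qed
  then obtain f where f: "\<And>d. coset_level d (fst (f d)) (snd (f d))"
      "fst (f 0) = (\<lambda>q. stair_coset (2 * q))" "\<And>d. fst (f (Suc d)) = snd (f d)"
    by blast
  define c where "c d = fst (f d)" for d
  have lev: "coset_level d (c d) (c (Suc d))" for d using f by (simp add: c_def)
  have tr: "g \<in> X \<Longrightarrow> translate a X = Y \<Longrightarrow> g \<cdot> E [a] \<in> Y" for g a X Y
    by (auto simp: translate_def)
  have hor: "E (hor_word d) \<in> c d 0" for d
  proof (induction d)
    case 0
    have "E [] \<in> stair_coset 0" unfolding stair_coset_def by (intro imageI) (auto intro: exI[of _ 0])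
    then show ?case by (simp add: hor_word_def c_def f)
  next
    case (Suc d)
    have "translate (letter (2 * int d)) (c d 0) = c (Suc d) 0"
      using lev[of d] letter_part[of "2 * int d"] unfolding coset_level_def by force
    from tr[OF Suc this] show ?case
      using part_vertex[OF letter_part] by (simp add: hor_word_Suc E_snoc)
  qed
  have ver: "E (hor_word M @ ver_word q) \<in> c (M - q) (int q)" if "q \<le> M" for q M
    using that
  proof (induction q)
    case 0
    then show ?case using hor by (simp add: ver_word_def)
  next
    case (Suc q)
    have "translate (letter (2 * int q + 1)) (c (Suc (M - Suc q)) (int q)) = c (M - Suc q) (int q + 1)"
      using lev[of "M - Suc q"] letter_part[of "2 * int q + 1"] unfolding coset_level_def by blast
    moreover have "Suc (M - Suc q) = M - q" using Suc.prems by simp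
    ultimately have "E (hor_word M @ ver_word q) \<cdot> E [letter (2 * int q + 1)] \<in> c (M - Suc q) (int (Suc q))"
      using tr Suc by (simp add: add.commute)
    then show ?case
      using part_vertex[OF letter_part] E_snoc[of "hor_word M @ ver_word q"] by (simp add: ver_word_Suc)
  qed
  have "E (hor_word (k * m) @ ver_word (k * m)) \<in> stair_coset (2 * int (k * m))"
    using ver[of "k * m" "k * m"] by (simp add: c_def f)
  moreover have "2 * int (k * m) = N * int m" by simp
  ultimately show ?thesis using stair_coset_H by (metis subsetD)
qed

abbreviation cayley where "cayley \<equiv> with_proj (cayley_graph (racg \<Delta>) (racg_gens \<Delta>))"

definition grid_dist :: "int \<times> int \<Rightarrow> int \<times> int \<Rightarrow> int" where
  "grid_dist x y = \<bar>fst x - fst y\<bar> + \<bar>snd x - snd y\<bar>"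

lemma grid_dist_move: "grid_dist x (move a x) \<le> 1" "grid_dist (move a x) x \<le> 1"
  using shift_bound by (cases x; auto simp: grid_dist_def move_def abs_minus_commute)+

lemma grid_dist_awalk:
  "pre_digraph.awalk cayley g p h \<Longrightarrow> grid_dist (position g) (position h) \<le> int (length p)"
proof (induction p arbitrary: g)
  case Nil
  then show ?case by (simp add: pre_digraph.awalk_def pre_digraph.cas.simps grid_dist_def)
next
  case (Cons e p)
  then have e: "e \<in> arcs cayley" "fst e = g" and p: "pre_digraph.awalk cayley (snd e) p h"
    by (auto simp: pre_digraph.awalk_def pre_digraph.cas.simps cayley_graph_def)
  then obtain a where "a \<in> V" "g \<in> C" "snd e \<in> C" "snd e = g \<cdot> E [a] \<or> g = snd e \<cdot> E [a]"
    by (auto simp: cayley_graph_def racg_gens_def)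
  then have "grid_dist (position g) (position (snd e)) \<le> 1"
    by (metis grid_dist_move position_mult)
  then show ?case using Cons.IH[OF p] by (auto simp: grid_dist_def)
qed

fun word_path where
  "word_path g [] = []"
| "word_path g (a # w) = (g, g \<cdot> E [a]) # word_path (g \<cdot> E [a]) w"

lemma length_word_path [simp]: "length (word_path g w) = length w"
  by (induction w arbitrary: g) auto

lemma awalk_word_path:
  "g \<in> C \<Longrightarrow> w \<in> lists V \<Longrightarrow> pre_digraph.awalk cayley g (word_path g w) (g \<cdot> E w)"
proof (induction w arbitrary: g)
  case Nil
  then show ?case
    by (simp add: pre_digraph.awalk_def pre_digraph.cas.simps cayley_graph_def E_Nil)
next
  case (Cons a w)
  then have "pre_digraph.awalk cayley (g \<cdot> E [a]) (word_path (g \<cdot> E [a]) w) (g \<cdot> E [a] \<cdot> E w)" by simp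
  moreover have "g \<cdot> E [a] \<cdot> E w = g \<cdot> E (a # w)" using Cons by (simp add: E_Cons[of w a] W.m_assoc)
  moreover have "(g, g \<cdot> E [a]) \<in> arcs cayley" using Cons
    by (auto simp: cayley_graph_def racg_gens_def)
  ultimately show ?case using Cons
    by (auto simp: pre_digraph.awalk_def pre_digraph.cas.simps cayley_graph_def)
qed

lemma prefix_word_path:
  "g \<in> C \<Longrightarrow> u \<in> lists V \<Longrightarrow> g \<cdot> E u \<in> set (pre_digraph.awalk_verts cayley g (word_path g (u @ v)))"
proof (induction u arbitrary: g)
  case Nil
  then show ?case by (cases v) (simp_all add: pre_digraph.awalk_verts.simps E_Nil)
next
  case (Cons a u)
  then have "g \<cdot> E [a] \<cdot> E u \<in> set (pre_digraph.awalk_verts cayley (g \<cdot> E [a]) (word_path (g \<cdot> E [a]) (u @ v)))"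
    by simp
  moreover have "g \<cdot> E [a] \<cdot> E u = g \<cdot> E (a # u)" using Cons by (simp add: E_Cons[of u a] W.m_assoc)
  ultimately show ?case by (simp add: pre_digraph.awalk_verts.simps)
qed

text \<open>
  The horizontal and vertical word to \<open>(m, m)\<close> is geodesic by the distance in the grid, and the
  same distance keeps its corner \<open>(m, 0)\<close> away from all points of the diagonal.
\<close>

lemma not_quasiconvex_H: "\<not> quasiconvex (racg \<Delta>) (racg_gens \<Delta>) H"
proof
  assume "quasiconvex (racg \<Delta>) (racg_gens \<Delta>) H"
  then obtain n where n: "\<And>g h p x. g \<in> H \<Longrightarrow> h \<in> H \<Longrightarrow> geodesic cayley g p h \<Longrightarrow>
      x \<in> set (pre_digraph.awalk_verts cayley g p) \<Longrightarrow>
      \<exists>h'\<in>H. \<exists>q. pre_digraph.awalk cayley h' q x \<and> length q \<le> n"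
    unfolding quasiconvex_def Let_def by metis
  define m where "m = k * Suc n"
  let ?w = "hor_word m @ ver_word m"
  have m: "int n < int m" 
  proof -
    have "1 * Suc n \<le> k * Suc n" using k2 by (intro mult_le_mono1) simp
    then have "n < m" by (simp only: m_def nat_mult_1 less_eq_Suc_le)
    then show ?thesis by simp
  qed
  have one: "\<bbbone> \<in> H" using subgroup_H by (rule subgroup.one_closed)
  have end_H: "E ?w \<in> H" using hor_ver_word_H[of "Suc n"] by (simp add: m_def)
  have w: "?w \<in> lists V" by simp
  have pos: "position \<bbbone> = (0, 0)" "position (E ?w) = (int m, int m)"
      "position (E (hor_word m)) = (int m, 0)"
    using position_E[of "[]"] by (simp_all add: position_E E_Nil move_hor_word move_ver_word)
  have "geodesic cayley \<bbbone> (word_path \<bbbone> ?w) (E ?w)"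
    unfolding geodesic_def
  proof (intro conjI allI impI)
    show "pre_digraph.awalk cayley \<bbbone> (word_path \<bbbone> ?w) (E ?w)"
      using awalk_word_path[of "\<bbbone>" ?w] w by simp
    fix q assume "pre_digraph.awalk cayley \<bbbone> q (E ?w)"
    then have "2 * int m \<le> int (length q)" using grid_dist_awalk pos by (fastforce simp: grid_dist_def)
    then show "length (word_path \<bbbone> ?w) \<le> length q" by (simp add: hor_word_def ver_word_def)
  qed
  moreover have "E (hor_word m) \<in> set (pre_digraph.awalk_verts cayley \<bbbone> (word_path \<bbbone> ?w))"
    using prefix_word_path[of "\<bbbone>" "hor_word m" "ver_word m"] by simp
  ultimately obtain h q where hq: "h \<in> H" "pre_digraph.awalk cayley h q (E (hor_word m))" "length q \<le> n"
    using n[OF one end_H] by metis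
  obtain l where "position h = (int k * l, int k * l)" using position_H hq(1) by blast
  then have "int m \<le> int (length q)"
    using grid_dist_awalk[OF hq(2)] pos(3) by (simp add: grid_dist_def)
  then show False using hq(3) m by simp
qed

end

section \<open>Failure of normality\<close>

text \<open>
  Two powers of \<open>g\<close> lie in the same coset.
\<close>

lemma (in group) finite_index_power:
  assumes K: "subgroup K G" and fin: "finite (rcosets K)" and g: "g \<in> carrier G"
  shows "\<exists>n>0. g [^] (n::nat) \<in> K"
proof -
  define f where "f i = K #> (g [^] (i::nat))" for i
  have "range f \<subseteq> rcosets K" using g by (auto simp: f_def RCOSETS_def)
  then have "finite (range f)" using fin by (rule finite_subset)
  then have "\<not> inj f" using finite_imageD infinite_UNIV_nat by blast
  then obtain i j where "f i = f j" "i \<noteq> j" by (auto simp: inj_def)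
  then obtain i j where ij: "f i = f j" "i < j" by (metis nat_neq_iff)
  have "g [^] j \<in> K #> (g [^] i)"
    using rcos_self[OF _ K, of "g [^] j"] g ij(1) by (simp add: f_def)
  then obtain x where x: "x \<in> K" "g [^] j = x \<otimes> g [^] i" by (auto simp: r_coset_def)
  have "g [^] j = g [^] (j - i) \<otimes> g [^] i" using g ij(2) by (simp add: nat_pow_mult)
  then have "x = g [^] (j - i)"
    using x g subgroup.mem_carrier[OF K] by (metis nat_pow_closed right_cancel)
  then show ?thesis using x(1) ij(2) by (intro exI[of _ "j - i"]) auto
qed

context cycle_partite
begin

text \<open>
  Conjugates are recognized by an action on triples of a point of the grid and two vectors.
  Every letter acts on the second vector, but on the first vector only if it moves the point. Walks
  on the staircase move the point in each step, so elements of \<open>H\<close> keep the vectors equal.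
\<close>

definition shadow :: "('b \<Rightarrow> 'm \<Rightarrow> 'm) \<Rightarrow> 'b \<Rightarrow> (int \<times> int) \<times> 'm \<times> 'm \<Rightarrow> (int \<times> int) \<times> 'm \<times> 'm" where
  "shadow \<rho> a = (\<lambda>(v, x, y). (move a v, if move a v = v then x else \<rho> a x, \<rho> a y))"

lemma move_independent:
  assumes "(a, b) \<in> parcs \<Delta>"
  shows "move a (move b v) = move b v \<longleftrightarrow> move a v = v"
  using edge_index[OF assms] by (cases v) (auto simp: move_def)

lemma shadow_action:
  fixes \<rho> :: "'b \<Rightarrow> 'm \<Rightarrow> 'm"
  assumes "racg_action \<Delta> UNIV \<rho>"
  shows "racg_action \<Delta> UNIV (shadow \<rho>)"
  unfolding racg_action_def
proof (intro conjI ballI allI impI)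
  fix a and s :: "(int \<times> int) \<times> 'm \<times> 'm" assume a: "a \<in> V"
  obtain v x y where s: "s = (v, x, y)" by (cases s)
  have "\<rho> a (\<rho> a z) = z" for z using assms a by (simp add: racg_action_def)
  moreover have "v = move a v \<longleftrightarrow> move a v = v" by auto
  ultimately show "shadow \<rho> a (shadow \<rho> a s) = s" by (simp add: shadow_def s move_move)
next
  fix a b and s :: "(int \<times> int) \<times> 'm \<times> 'm" assume e: "(a, b) \<in> parcs \<Delta>"
  obtain v x y where s: "s = (v, x, y)" by (cases s)
  have "\<rho> a (\<rho> b z) = \<rho> b (\<rho> a z)" for z using assms e unfolding racg_action_def by blast
  moreover have "move a (move b v) = move b (move a v)"
    using move_action e unfolding racg_action_def by blast
  moreover have "move a (move b v) = move b v \<longleftrightarrow> move a v = v"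
      "move b (move a v) = move a v \<longleftrightarrow> move b v = v"
    using move_independent[OF e] move_independent[OF edge_sym[OF e]] by auto
  ultimately show "shadow \<rho> a (shadow \<rho> b s) = shadow \<rho> b (shadow \<rho> a s)"
    by (auto simp: shadow_def s)
qed simp

lemma grid_inj: "grid t = grid t' \<Longrightarrow> t = t'"
proof -
  have "fst (grid t) + snd (grid t) = t" for t unfolding grid_def fst_conv snd_conv by linarith
  then show "grid t = grid t' \<Longrightarrow> t = t'" by metis
qed

lemma shadow_walk:
  "walk t w t' \<Longrightarrow> \<exists>y. fold (shadow \<rho>) w (grid t, x, x) = (grid t', y, y)"
proof (induction w arbitrary: t x)
  case (Cons a w)
  then consider "a \<in> part t" "walk (t + 1) w t'" | "a \<in> part (t - 1)" "walk (t - 1) w t'" by auto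
  then show ?case
  proof cases
    case 1
    then show ?thesis using Cons.IH[of "t + 1" "\<rho> a x"] grid_inj[of "t + 1" t]
      by (auto simp: shadow_def move_part)
  next
    case 2
    then have "move a (grid t) = grid (t - 1)" using move_walk[of t "[a]" "t - 1"] by simp
    then show ?thesis using Cons.IH[of "t - 1" "\<rho> a x"] 2 grid_inj[of "t - 1" t]
      by (auto simp: shadow_def)
  qed
qed simp

lemma shadow_H:
  assumes "racg_action \<Delta> UNIV \<rho>" "w \<in> lists V" "E w \<in> H"
    "fold (shadow \<rho>) w ((0, 0), x, x) = (v, y, z)"
  shows "y = z"
proof -
  obtain u m where u: "walk 0 u (N * m)" "E w = E u" using assms(3) by (auto simp: H_def)
  have "fold (shadow \<rho>) w ((0, 0), x, x) = fold (shadow \<rho>) u ((0, 0), x, x)"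
    using racg_action_fold_eq[OF shadow_action[OF assms(1)] assms(2) walk_lists[OF u(1)] u(2)] by simp
  moreover have "grid 0 = (0, 0)" by (simp add: grid_def)
  ultimately show ?thesis using shadow_walk[OF u(1), of \<rho> x] assms(4) by auto
qed

lemma E_power: "w \<in> lists V \<Longrightarrow> E w [^]\<^bsub>racg \<Delta>\<^esub> (n::nat) = E (concat (replicate n w))"
proof (induction n)
  case 0
  then show ?case by (simp add: E_Nil)
next
  case (Suc n)
  then have "concat (replicate n w) \<in> lists V" by auto
  moreover have "concat (replicate (Suc n) w) = concat (replicate n w) @ w"
    by (induction n) auto
  ultimately show ?case using Suc by (simp add: E_append del: replicate.simps)
qed

text \<open>
  Two pairs of involutions of the integer lattice, with products unipotent matrices of which no
  positive powers commute. All the other letters act trivially.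
\<close>

definition shear where
  "shear a1 a2 c1 c2 x = (\<lambda>(u, v :: int). if x = a1 then (u, - v) else if x = a2 then (u + v, - v)
     else if x = c1 then (- u, v) else if x = c2 then (- u, v + u) else (u, v))"

lemma shear_action:
  assumes "even (index a1)" "even (index a2)" "even (index c1)" "even (index c2)"
  shows "racg_action \<Delta> UNIV (shear a1 a2 c1 c2)"
  unfolding racg_action_def
proof (intro conjI ballI allI impI)
  fix a b and x :: "int \<times> int" assume "(a, b) \<in> parcs \<Delta>"
  then have "even (index a) \<noteq> even (index b)" by (rule edge_index)
  then have "shear a1 a2 c1 c2 a = (\<lambda>x. x) \<or> shear a1 a2 c1 c2 b = (\<lambda>x. x)"
    using assms by (auto simp: shear_def fun_eq_iff)
  then show "shear a1 a2 c1 c2 a (shear a1 a2 c1 c2 b x) = shear a1 a2 c1 c2 b (shear a1 a2 c1 c2 a x)"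
    by auto
qed (auto simp: shear_def split: prod.splits)

lemma two_letters: "j < 2 * k \<Longrightarrow> \<exists>a\<in>B j. \<exists>b\<in>B j. a \<noteq> b"
proof -
  assume "j < 2 * k"
  then have "\<not> card (B j) \<le> Suc 0" using parts_card[of j] by simp
  moreover then have "finite (B j)" using card.infinite by fastforce
  ultimately show ?thesis using card_le_Suc0_iff_eq by blast
qed

text \<open>
  For \<open>k > 2\<close> the letters of \<open>B 2\<close> fix the origin, and so do products of two letters of \<open>B 0\<close>. Some
  powers \<open>x\<close> of \<open>E [a1, a2]\<close> and \<open>y\<close> of \<open>E [c1, c2]\<close> lie in \<open>K\<close>, and \<open>x\<close> is in \<open>H\<close>. On the first
  vector the conjugate of \<open>x\<close> by \<open>y\<close> acts like \<open>x\<close>, on the second one it acts as the conjugate.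
\<close>

lemma not_normal_in_finite_index:
  assumes k: "2 < k" and K: "subgroup K (racg \<Delta>)" "finite_index K (racg \<Delta>)"
  shows "\<not> (H \<inter> K) \<lhd> (racg \<Delta>\<lparr>carrier := K\<rparr>)"
proof
  assume normal: "(H \<inter> K) \<lhd> (racg \<Delta>\<lparr>carrier := K\<rparr>)"
  obtain a1 a2 where a: "a1 \<in> B 0" "a2 \<in> B 0" "a1 \<noteq> a2" using two_letters[of 0] k by auto
  obtain c1 c2 where c: "c1 \<in> B 2" "c2 \<in> B 2" "c1 \<noteq> c2" using two_letters[of 2] k by auto
  have idx: "index a1 = 0" "index a2 = 0" "index c1 = 2" "index c2 = 2"
    using a c k index_eq[of 0] index_eq[of 2] by auto
  have vert: "a1 \<in> V" "a2 \<in> V" "c1 \<in> V" "c2 \<in> V" using a c k by (auto simp: verts_parts)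
  have diff: "a1 \<noteq> c1" "a1 \<noteq> c2" "a2 \<noteq> c1" "a2 \<noteq> c2" using idx by auto
  let ?l = "shear a1 a2 c1 c2" let ?s = "shadow ?l"
  have act: "racg_action \<Delta> UNIV ?l" using idx by (intro shear_action) auto
  have fin: "finite (rcosets\<^bsub>racg \<Delta>\<^esub> K)" using K(2) by (simp add: finite_index_def)
  have pairs: "[a1, a2] \<in> lists V" "[c1, c2] \<in> lists V" using vert by simp_all
  obtain n :: nat where n: "0 < n" "E [a1, a2] [^]\<^bsub>racg \<Delta>\<^esub> n \<in> K"
    using W.finite_index_power[OF K(1) fin E_carrier[OF pairs(1)]] by blast
  obtain m :: nat where m: "0 < m" "E [c1, c2] [^]\<^bsub>racg \<Delta>\<^esub> m \<in> K"
    using W.finite_index_power[OF K(1) fin E_carrier[OF pairs(2)]] by blast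
  define x where "x = concat (replicate n [a1, a2])"
  define y where "y = concat (replicate m [c1, c2])"
  have lists: "x \<in> lists V" "y \<in> lists V" "rev y \<in> lists V"
    using vert by (auto simp: x_def y_def split: if_splits)
  have rev_y: "rev y = concat (replicate m [c2, c1])"
    by (simp add: y_def rev_concat rev_map)
  have "0 mod int k = 0" "(- 1) mod int k = int k - 1" "1 mod int k = 1"
    using k by (auto simp: zmod_minus1)
  then have sh: "shift 0 0 = 1" "shift 0 1 = 0" "shift 1 0 = 0"
    using k by (auto simp: shift_def)
  have fx: "fold ?s (concat (replicate n [a1, a2])) ((0, 0), (u, v), (u', v')) =
      ((0, 0), (u - int n * v, v), (u' - int n * v', v'))" for n u v u' v'
    by (induction n arbitrary: u u')
      (use a diff sh idx in \<open>simp_all add: shadow_def shear_def move_def algebra_simps\<close>)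
  have fy: "fold ?s (concat (replicate m [c1, c2])) ((0, 0), z, (u, v)) =
      ((0, 0), z, (u, v - int m * u))" for m u v z
    by (induction m arbitrary: v)
      (use c diff sh idx in \<open>simp_all add: shadow_def shear_def move_def algebra_simps\<close>)
  have fy': "fold ?s (concat (replicate m [c2, c1])) ((0, 0), z, (u, v)) =
      ((0, 0), z, (u, v + int m * u))" for m u v z
    by (induction m arbitrary: v)
      (use c diff sh idx in \<open>simp_all add: shadow_def shear_def move_def algebra_simps\<close>)
  have "walk 0 (concat (replicate n [a1, a2])) (N * 0)" for n
    by (induction n) (use a in \<open>auto simp: part_def\<close>)
  then have "E x \<in> H" unfolding x_def by (rule H_I)
  moreover have Ex: "E x = E [a1, a2] [^]\<^bsub>racg \<Delta>\<^esub> n" "E y = E [c1, c2] [^]\<^bsub>racg \<Delta>\<^esub> m"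
    using vert by (simp_all add: E_power x_def y_def)
  ultimately have "E x \<in> H \<inter> K" "E y \<in> K" using n m by auto
  then have "E y \<otimes>\<^bsub>racg \<Delta>\<lparr>carrier := K\<rparr>\<^esub> E x \<otimes>\<^bsub>racg \<Delta>\<lparr>carrier := K\<rparr>\<^esub>
      inv\<^bsub>racg \<Delta>\<lparr>carrier := K\<rparr>\<^esub> E y \<in> H \<inter> K"
    using normal.inv_op_closed2[OF normal] by simp
  then have "E y \<cdot> E x \<cdot> (E y)\<^sup>- \<in> H" using \<open>E y \<in> K\<close> W.m_inv_consistent[OF K(1)] by simp
  then have "E (y @ x @ rev y) \<in> H"
    using lists racg_elem_rev[OF lists(2)] by (simp add: E_append W.m_assoc)
  moreover have "fold ?s (y @ x @ rev y) ((0, 0), (1, 0), (1, 0)) =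
      ((0, 0), (1, 0), (1 + int n * int m, int m * (int n * int m)))"
    unfolding rev_y unfolding x_def y_def by (simp add: fx fy fy' algebra_simps)
  ultimately have "(1, 0) = (1 + int n * int m, int m * (int n * int m))"
    using lists by (intro shadow_H[OF act]) auto
  then show False using n(1) m(1) by simp
qed

text \<open>
  For \<open>k > 2\<close> the whole group is a subgroup of finite index. For \<open>k = 2\<close> no letter fixes a point of
  the grid, but the conjugate of the label of the cycle by its first letter leads to \<open>(-2, 2)\<close>.
\<close>

lemma not_normal_H: "\<not> H \<lhd> racg \<Delta>"
proof
  assume normal: "H \<lhd> racg \<Delta>"
  show False
  proof (cases "2 < k")
    case True
    have "rcosets\<^bsub>racg \<Delta>\<^esub> C = {C}"
      using W.coset_join2[OF _ W.subgroup_self] W.one_closed by (auto simp: RCOSETS_def)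
    then have "finite_index C (racg \<Delta>)" by (simp add: finite_index_def)
    moreover have "H \<inter> C = H" using subgroup.subset[OF subgroup_H] by blast
    ultimately show False
      using not_normal_in_finite_index[OF True W.subgroup_self] normal by simp
  next
    case False
    then have k: "k = 2" using k2 by simp
    obtain b0 b1 b2 b3 where b: "b0 \<in> B 0" "b1 \<in> B 1" "b2 \<in> B 2" "b3 \<in> B 3"
      using two_letters[of 0] two_letters[of 1] two_letters[of 2] two_letters[of 3] k by auto
    have less: "0 < 2 * k" "1 < 2 * k" "2 < 2 * k" "3 < 2 * k" using k by auto
    have idx: "index b0 = 0" "index b1 = 1" "index b2 = 2" "index b3 = 3"
      using b less index_eq by blast+
    have vert: "b0 \<in> V" "b1 \<in> V" "b2 \<in> V" "b3 \<in> V"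
      using b less unfolding verts_parts by blast+
    have "part 0 = B 0" "part 1 = B 1" "part 2 = B 2" "part 3 = B 3"
      unfolding part_def using k by auto
    then have "walk 0 [b0, b1, b2, b3] 4" using b by simp
    moreover have "4 = N * 1" using k by simp
    ultimately have "walk 0 [b0, b1, b2, b3] (N * 1)" by (simp only:)
    then have "E [b0, b1, b2, b3] \<in> H" by (rule H_I)
    then have "E [b0] \<cdot> E [b0, b1, b2, b3] \<cdot> (E [b0])\<^sup>- \<in> H"
      using normal.inv_op_closed2[OF normal, of "E [b0]"] vert by simp
    moreover have "E [b0] \<cdot> E [b0, b1, b2, b3] \<cdot> (E [b0])\<^sup>- = E [b0, b0, b1, b2, b3, b0]"
      using vert E_append[of "[b0]" "[b0, b1, b2, b3]"] E_append[of "[b0, b0, b1, b2, b3]" "[b0]"]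
      by simp
    ultimately obtain m where "position (E [b0, b0, b1, b2, b3, b0]) = (int k * m, int k * m)"
      using position_H by metis
    moreover have "shift 0 0 = 1" "shift 0 1 = 0" "shift 1 0 = -1" "shift 1 1 = 2" "shift 0 (-1) = -2"
      unfolding shift_def using k by simp_all
    then have "position (E [b0, b0, b1, b2, b3, b0]) = (-2, 2)"
      using vert idx by (simp add: position_E move_def)
    ultimately have "(int k * m, int k * m) = (-2, 2)" by metis
    then show False by (elim Pair_inject) linarith
  qed
qed

end

section \<open>A criterion for freeness\<close>

text \<open>
  The equations for \<open>f\<close> say that \<open>f\<close> maps the value of a word in \<open>X\<close> to the class of this word. So
  words with the same value are equal in the free group, and \<open>f\<close> is the inverse of the evaluation.
\<close>

lemma is_freeI:
  fixes G (structure)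
  assumes "group G" and X: "X \<subseteq> carrier G" and gen: "generate G X = carrier G"
    and fC: "\<And>g. g \<in> carrier G \<Longrightarrow> f g \<in> carrier (free_group X)"
    and f1: "f \<one> = \<one>\<^bsub>free_group X\<^esub>"
    and fx: "\<And>g x. g \<in> carrier G \<Longrightarrow> x \<in> X \<Longrightarrow>
      f (g \<otimes> x) = f g \<otimes>\<^bsub>free_group X\<^esub> presentation_rel X {} `` {[(x, True)]}"
  shows "is_free G"
proof -
  interpret group G by fact
  interpret F: group "free_group X" by (simp add: free_group_def group_presented_group)
  let ?c = "\<lambda>w. presentation_rel X {} `` {w}"
  note mult = mult_presented_group[of _ X _ "{}", folded free_group_def]
  have cC: "?c w \<in> carrier (free_group X)" if "w \<in> signed_words X" for w
    using that by (auto simp: free_group_def carrier_presented_group)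
  have c1: "?c [] = \<one>\<^bsub>free_group X\<^esub>" by (simp add: free_group_def one_presented_group)
  define l where "l z = (if snd z then fst z else inv (fst z))" for z
  define ev where "ev w = foldr (\<lambda>z g. l z \<otimes> g) w \<one>" for w
  have lC: "l z \<in> carrier G" if "z \<in> X \<times> UNIV" for z using that X by (auto simp: l_def)
  have evC: "ev w \<in> carrier G" if "w \<in> signed_words X" for w
    using that by (induction w) (auto simp: ev_def lC)
  have ev_Cons: "ev (z # w) = l z \<otimes> ev w" for z w by (simp add: ev_def)
  have ev_append: "ev (u @ v) = ev u \<otimes> ev v" if "u \<in> signed_words X" "v \<in> signed_words X" for u v
    using that
  proof (induction u)
    case Nil
    then show ?case using evC by (simp add: ev_def)
  next
    case (Cons z u)
    then have "l z \<in> carrier G" "ev u \<in> carrier G" "ev v \<in> carrier G" using lC evC by auto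
    then show ?case using Cons by (simp add: ev_Cons m_assoc)
  qed
  have fl: "f (g \<otimes> l z) = f g \<otimes>\<^bsub>free_group X\<^esub> ?c [z]" if g: "g \<in> carrier G" and z: "z \<in> X \<times> UNIV" for g z
  proof (cases "snd z")
    case True
    then have "z = (fst z, True)" by (cases z) simp
    then show ?thesis using fx[OF g, of "fst z"] z True by (auto simp: l_def)
  next
    case False
    then obtain x where x: "z = (x, False)" "x \<in> X" "x \<in> carrier G" using z X by (cases z) auto
    have "f g = f (g \<otimes> inv x \<otimes> x)" using g x by (simp add: m_assoc)
    also have "\<dots> = f (g \<otimes> inv x) \<otimes>\<^bsub>free_group X\<^esub> ?c [(x, True)]" using g x by (intro fx) auto
    finally have "f g \<otimes>\<^bsub>free_group X\<^esub> ?c [(x, False)] =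
        f (g \<otimes> inv x) \<otimes>\<^bsub>free_group X\<^esub> (?c [(x, True)] \<otimes>\<^bsub>free_group X\<^esub> ?c [(x, False)])"
      using g x fC cC by (simp add: F.m_assoc)
    also have "?c [(x, True)] \<otimes>\<^bsub>free_group X\<^esub> ?c [(x, False)] = \<one>\<^bsub>free_group X\<^esub>"
    proof -
      have "([] @ [(x, True), flip (x, True)] @ [], [] @ []) \<in> presentation_rel X {}"
        using x by (intro presentation_rel.cancel) auto
      then have "?c [(x, True), (x, False)] = ?c []"
        by (intro presented_group_eqI) (simp add: flip_def)
      then show ?thesis using mult[of "[(x, True)]" "[(x, False)]"] x c1 by simp
    qed
    finally show ?thesis using g x fC by (simp add: l_def)
  qed
  have f_ev: "f (g \<otimes> ev w) = f g \<otimes>\<^bsub>free_group X\<^esub> ?c w"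
    if "g \<in> carrier G" "w \<in> signed_words X" for g w
    using that
  proof (induction w arbitrary: g)
    case Nil
    then show ?case using fC c1 by (simp add: ev_def)
  next
    case (Cons z w)
    then have z: "z \<in> X \<times> UNIV" "w \<in> signed_words X" by auto
    have "f (g \<otimes> ev (z # w)) = f (g \<otimes> l z \<otimes> ev w)"
      using Cons.prems z lC evC by (simp add: ev_Cons m_assoc)
    also have "\<dots> = f g \<otimes>\<^bsub>free_group X\<^esub> ?c [z] \<otimes>\<^bsub>free_group X\<^esub> ?c w"
      using Cons.IH[of "g \<otimes> l z"] Cons.prems z lC fl by simp
    also have "\<dots> = f g \<otimes>\<^bsub>free_group X\<^esub> ?c (z # w)"
      using Cons.prems z cC[of "[z]"] cC[of w] fC mult[of "[z]" w] by (simp add: F.m_assoc)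
    finally show ?case .
  qed
  have f_ev1: "f (ev w) = ?c w" if "w \<in> signed_words X" for w
    using f_ev[of \<one> w] that evC cC f1 by simp
  have word: "\<exists>w\<in>signed_words X. g = ev w" if "g \<in> carrier G" for g
  proof -
    have "g \<in> generate G X" using that gen by simp
    then show ?thesis
    proof (induction rule: generate.induct)
      case one
      then show ?case by (intro bexI[of _ "[]"]) (auto simp: ev_def)
    next
      case (incl h)
      then show ?case using X by (intro bexI[of _ "[(h, True)]"]) (auto simp: ev_def l_def)
    next
      case (inv h)
      then show ?case using X by (intro bexI[of _ "[(h, False)]"]) (auto simp: ev_def l_def)
    next
      case (eng h1 h2)
      then obtain u v where "u \<in> signed_words X" "h1 = ev u" "v \<in> signed_words X" "h2 = ev v" by blast
      then show ?case using ev_append by (intro bexI[of _ "u @ v"]) auto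
    qed
  qed
  have ev_rel: "ev u = ev v" if "(u, v) \<in> presentation_rel X {}" for u v
    using that
  proof (induction rule: presentation_rel.induct)
    case (cancel u v x)
    have fx: "flip x \<in> X \<times> UNIV" using cancel.hyps by (auto simp: flip_def)
    then have w: "[x, flip x] \<in> signed_words X" using cancel.hyps by simp
    have "fst x \<in> carrier G" using cancel.hyps X by auto
    then have "ev [x, flip x] = \<one>" by (simp add: ev_def l_def flip_def)
    moreover have "ev (u @ [x, flip x] @ v) = ev u \<otimes> (ev [x, flip x] \<otimes> ev v)"
      using cancel.hyps w ev_append[of u "[x, flip x] @ v"] ev_append[OF w, of v] by simp
    ultimately show ?case using ev_append[of u v] cancel.hyps evC by simp
  qed simp_all
  have "f \<in> iso G (free_group X)"
    unfolding iso_def bij_betw_def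
  proof (intro CollectI conjI homI)
    fix g h assume g: "g \<in> carrier G" and h: "h \<in> carrier G"
    obtain w where "w \<in> signed_words X" "h = ev w" using word[OF h] by (elim bexE)
    then show "f (g \<otimes> h) = f g \<otimes>\<^bsub>free_group X\<^esub> f h" using f_ev g f_ev1 by simp
  next
    show "inj_on f (carrier G)"
    proof (rule inj_onI)
      fix g h assume "g \<in> carrier G" "h \<in> carrier G" and eq: "f g = f h"
      obtain u where u: "u \<in> signed_words X" "g = ev u" using word[OF \<open>g \<in> carrier G\<close>] by (elim bexE)
      obtain v where v: "v \<in> signed_words X" "h = ev v" using word[OF \<open>h \<in> carrier G\<close>] by (elim bexE)
      note uv = u v
      have "?c u = ?c v" using eq f_ev1 uv by simp
      then have "(u, v) \<in> presentation_rel X {}"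
        using eq_equiv_class[OF _ equiv_presentation_rel] uv(3) by metis
      then show "g = h" using ev_rel uv by simp
    qed
  next
    show "f ` carrier G = carrier (free_group X)"
    proof
      show "carrier (free_group X) \<subseteq> f ` carrier G"
      proof
        fix z assume "z \<in> carrier (free_group X)"
        then obtain w where w: "w \<in> signed_words X" "z = ?c w"
          by (auto simp: free_group_def carrier_presented_group)
        then have "z = f (ev w)" using f_ev1 by simp
        then show "z \<in> f ` carrier G" using evC w by blast
      qed
    qed (use fC in auto)
  qed (use fC in auto)
  then have "G \<cong> free_group X" by (rule is_isoI)
  then show ?thesis using X iso_sym by (auto simp: is_free_def)
qed

context cycle_partite
begin

section \<open>A cocycle on the grid\<close>

text \<open>
  Around a square of the grid, values in a group on two consecutive sides extend to the other two:
  along a path, which has no cycles, the equations for the edges are solved one after the other.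
\<close>

lemma fill_square:
  fixes F (structure) and x y :: "'b \<Rightarrow> 'f"
  assumes "group F" and ij: "i < 2 * k" "j < 2 * k" "even i \<noteq> even j"
    and x: "\<And>b. x b \<in> carrier F" and y: "\<And>a. y a \<in> carrier F"
  shows "\<exists>u v. (\<forall>a. u a \<in> carrier F) \<and> (\<forall>b. v b \<in> carrier F) \<and>
    (\<forall>a\<in>B i. \<forall>b\<in>B j. (a, b) \<in> parcs \<Delta> \<longrightarrow> u a \<otimes> v b = x b \<otimes> y a)"
proof -
  interpret F: group F by fact
  from parts_list[OF ij] obtain vs where dist: "distinct vs" and vs: "set vs = B i \<union> B j"
    and e: "\<And>x y. x \<in> B i \<union> B j \<Longrightarrow> y \<in> B i \<union> B j \<Longrightarrow> (x, y) \<in> parcs \<Delta> \<longleftrightarrow>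
      (\<exists>m. Suc m < length vs \<and> (x = vs ! m \<and> y = vs ! Suc m \<or> y = vs ! m \<and> x = vs ! Suc m))"
    by blast
  have disj: "B i \<inter> B j = {}" using parts_disjoint ij by blast
  \<comment> \<open>solves the equations along the path, starting from the arbitrary value \<open>\<one>\<close> at its first vertex\<close>
  define h where "h = rec_nat \<one> (\<lambda>m r. if vs ! m \<in> B i
    then inv r \<otimes> (x (vs ! Suc m) \<otimes> y (vs ! m)) else x (vs ! m) \<otimes> y (vs ! Suc m) \<otimes> inv r)"
  have hC: "h m \<in> carrier F" for m by (induction m) (auto simp: h_def x y)
  define z where "z c = h (the_inv_into {..<length vs} ((!) vs) c)" for c
  have z: "z (vs ! m) = h m" if "m < length vs" for m
    using that dist by (simp add: z_def the_inv_into_f_f inj_on_nth)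
  have "z a \<otimes> z b = x b \<otimes> y a" if ab: "a \<in> B i" "b \<in> B j" "(a, b) \<in> parcs \<Delta>" for a b
  proof -
    from e[of a b] ab obtain m where m: "Suc m < length vs"
      "a = vs ! m \<and> b = vs ! Suc m \<or> b = vs ! m \<and> a = vs ! Suc m" by auto
    have h: "h (Suc m) = (if vs ! m \<in> B i
      then inv (h m) \<otimes> (x (vs ! Suc m) \<otimes> y (vs ! m)) else x (vs ! m) \<otimes> y (vs ! Suc m) \<otimes> inv (h m))"
      by (simp add: h_def)
    have hm: "z (vs ! m) = h m" "z (vs ! Suc m) = h (Suc m)" using z m by simp_all
    from m(2) show ?thesis
    proof (elim disjE conjE)
      assume "a = vs ! m" "b = vs ! Suc m"
      then show ?thesis using hm h ab hC[of m] x y by (simp add: F.m_assoc[symmetric])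
    next
      assume "b = vs ! m" "a = vs ! Suc m"
      moreover then have "vs ! m \<notin> B i" using disj ab by auto
      ultimately show ?thesis using hm h hC[of m] x y by (simp add: F.m_assoc)
    qed
  qed
  moreover have "z c \<in> carrier F" for c using hC by (simp add: z_def)
  ultimately show ?thesis by blast
qed

lemma fill_square_part:
  fixes F (structure) and x y :: "'b \<Rightarrow> 'f"
  assumes "group F" "even t \<noteq> even t'" "\<And>b. x b \<in> carrier F" "\<And>a. y a \<in> carrier F"
  shows "\<exists>uv. (\<forall>a. fst uv a \<in> carrier F) \<and> (\<forall>b. snd uv b \<in> carrier F) \<and>
    (\<forall>a\<in>part t. \<forall>b\<in>part t'. (a, b) \<in> parcs \<Delta> \<longrightarrow> fst uv a \<otimes> snd uv b = x b \<otimes> y a)"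
proof -
  have "even (nat (t mod N)) \<noteq> even (nat (t' mod N))" using assms(2) part_parity by simp
  from fill_square[OF assms(1) nat_mod_N nat_mod_N this assms(3,4)] show ?thesis
    unfolding part_def by auto
qed

text \<open>
  Starting from arbitrary values on the staircase, the squares below it and those above it can be
  filled in, diagonal by diagonal.
\<close>

lemma cocycle_exists:
  fixes F (structure) and \<xi> :: "'b \<Rightarrow> 'f"
  assumes F: "group F" and \<xi>: "\<And>a. \<xi> a \<in> carrier F"
  shows "\<exists>hor ver. (\<forall>p q a. hor p q a \<in> carrier F \<and> ver p q a \<in> carrier F) \<and>
    (\<forall>p a. hor p p a = \<xi> a \<and> ver (p + 1) p a = \<xi> a) \<and>
    (\<forall>p q. \<forall>a\<in>part (2 * p). \<forall>b\<in>part (2 * q + 1). (a, b) \<in> parcs \<Delta> \<longrightarrow>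
      hor p q a \<otimes> ver (p + 1) q b = ver p q b \<otimes> hor p (q + 1) a)"
proof -
  define closed :: "(int \<Rightarrow> 'b \<Rightarrow> 'f) \<times> (int \<Rightarrow> 'b \<Rightarrow> 'f) \<Rightarrow> bool" where
    "closed z \<longleftrightarrow> (\<forall>p a. fst z p a \<in> carrier F \<and> snd z p a \<in> carrier F)" for z
  define z0 :: "(int \<Rightarrow> 'b \<Rightarrow> 'f) \<times> (int \<Rightarrow> 'b \<Rightarrow> 'f)" where "z0 = (\<lambda>p. \<xi>, \<lambda>p. \<xi>)"
  have z0: "closed z0" by (simp add: closed_def z0_def \<xi>)
  \<comment> \<open>on level \<open>d\<close> below the staircase: \<open>fst z q\<close> on \<open>(q + d, q)\<close> to \<open>(q + d + 1, q)\<close> and \<open>snd z q\<close>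
    on \<open>(q + d + 1, q)\<close> to \<open>(q + d + 1, q + 1)\<close>; level \<open>0\<close> is the staircase\<close>
  define low where "low d z z' \<longleftrightarrow> (\<forall>q. \<forall>a\<in>part (2 * (q + int d + 1)). \<forall>b\<in>part (2 * q + 1).
    (a, b) \<in> parcs \<Delta> \<longrightarrow> fst z' q a \<otimes> snd z' q b = snd z q b \<otimes> fst z (q + 1) a)"
    for d and z z' :: "(int \<Rightarrow> 'b \<Rightarrow> 'f) \<times> (int \<Rightarrow> 'b \<Rightarrow> 'f)"
  \<comment> \<open>on level \<open>d\<close> above the staircase: \<open>fst z p\<close> on \<open>(p, p + d)\<close> to \<open>(p + 1, p + d)\<close> and \<open>snd z p\<close>
    on \<open>(p + 1, p + d)\<close> to \<open>(p + 1, p + d + 1)\<close>\<close>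
  define upp where "upp d z z' \<longleftrightarrow> (\<forall>p. \<forall>a\<in>part (2 * p). \<forall>b\<in>part (2 * (p + int d) + 1).
    (a, b) \<in> parcs \<Delta> \<longrightarrow> fst z p a \<otimes> snd z p b = snd z' (p - 1) b \<otimes> fst z' p a)"
    for d and z z' :: "(int \<Rightarrow> 'b \<Rightarrow> 'f) \<times> (int \<Rightarrow> 'b \<Rightarrow> 'f)"
  have low_ex: "\<exists>z'. closed z' \<and> low d z z'" if z: "closed z" for d z
  proof -
    have "\<exists>uv. (\<forall>a. fst uv a \<in> carrier F) \<and> (\<forall>b. snd uv b \<in> carrier F) \<and>
      (\<forall>a\<in>part (2 * (q + int d + 1)). \<forall>b\<in>part (2 * q + 1). (a, b) \<in> parcs \<Delta> \<longrightarrow>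
        fst uv a \<otimes> snd uv b = snd z q b \<otimes> fst z (q + 1) a)" for q
      by (rule fill_square_part[OF F]) (use z in \<open>auto simp: closed_def\<close>)
    then obtain uv where uv: "\<And>q a. fst (uv q) a \<in> carrier F" "\<And>q b. snd (uv q) b \<in> carrier F"
      "\<And>q a b. a \<in> part (2 * (q + int d + 1)) \<Longrightarrow> b \<in> part (2 * q + 1) \<Longrightarrow> (a, b) \<in> parcs \<Delta> \<Longrightarrow>
        fst (uv q) a \<otimes> snd (uv q) b = snd z q b \<otimes> fst z (q + 1) a" by metis
    then have "closed (\<lambda>q. fst (uv q), \<lambda>q. snd (uv q)) \<and> low d z (\<lambda>q. fst (uv q), \<lambda>q. snd (uv q))"
      unfolding closed_def low_def by simp
    then show ?thesis by (rule exI)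
  qed
  have upp_ex: "\<exists>z'. closed z' \<and> upp d z z'" if z: "closed z" for d z
  proof -
    have "\<exists>uv. (\<forall>a. fst uv a \<in> carrier F) \<and> (\<forall>b. snd uv b \<in> carrier F) \<and>
      (\<forall>b\<in>part (2 * (p + int d) + 1). \<forall>a\<in>part (2 * p). (b, a) \<in> parcs \<Delta> \<longrightarrow>
        fst uv b \<otimes> snd uv a = fst z p a \<otimes> snd z p b)" for p
      by (rule fill_square_part[OF F]) (use z in \<open>auto simp: closed_def\<close>)
    then obtain uv where uv: "\<And>p a. fst (uv p) a \<in> carrier F" "\<And>p b. snd (uv p) b \<in> carrier F"
      "\<And>p a b. b \<in> part (2 * (p + int d) + 1) \<Longrightarrow> a \<in> part (2 * p) \<Longrightarrow> (b, a) \<in> parcs \<Delta> \<Longrightarrow>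
        fst (uv p) b \<otimes> snd (uv p) a = fst z p a \<otimes> snd z p b" by metis
    then have "closed (\<lambda>p. snd (uv p), \<lambda>p. fst (uv (p + 1))) \<and>
        upp d z (\<lambda>p. snd (uv p), \<lambda>p. fst (uv (p + 1)))"
      unfolding closed_def upp_def by (simp add: edge_sym)
    then show ?thesis by (rule exI)
  qed
  have chain: "\<exists>f. f 0 = z0 \<and> (\<forall>d. closed (f d) \<and> R d (f d) (f (Suc d)))"
    if "\<And>d z. closed z \<Longrightarrow> \<exists>z'. closed z' \<and> R d z z'" for R :: "nat \<Rightarrow> _ \<Rightarrow> _ \<Rightarrow> bool"
  proof -
    have "\<exists>f. \<forall>d. (closed (f d) \<and> (d = 0 \<longrightarrow> f d = z0)) \<and> R d (f d) (f (Suc d))"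
    proof (rule dependent_nat_choice)
      show "\<exists>x. closed x \<and> (0 = (0::nat) \<longrightarrow> x = z0)" using z0 by blast
      show "\<exists>y. (closed y \<and> (Suc n = 0 \<longrightarrow> y = z0)) \<and> R n x y"
        if "closed x \<and> (n = 0 \<longrightarrow> x = z0)" for x n
        using \<open>\<And>d z. closed z \<Longrightarrow> \<exists>z'. closed z' \<and> R d z z'\<close>[of x n] that by simp
    qed
    then show ?thesis by metis
  qed
  obtain l where l: "l 0 = z0" "\<And>d. closed (l d)" "\<And>d. low d (l d) (l (Suc d))"
    using chain[of low, OF low_ex] by blast
  obtain u where u: "u 0 = z0" "\<And>d. closed (u d)" "\<And>d. upp d (u d) (u (Suc d))"
    using chain[of upp, OF upp_ex] by blast
  define hor where "hor p q = (if q \<le> p then fst (l (nat (p - q))) q else fst (u (nat (q - p))) p)" for p q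
  define ver where "ver p q = (if q < p then snd (l (nat (p - q - 1))) q
    else snd (u (nat (q - p + 1))) (p - 1))" for p q
  have "hor p q a \<otimes> ver (p + 1) q b = ver p q b \<otimes> hor p (q + 1) a"
    if ab: "a \<in> part (2 * p)" "b \<in> part (2 * q + 1)" "(a, b) \<in> parcs \<Delta>" for p q a b
  proof (cases "q < p")
    case True
    define d where "d = nat (p - q - 1)"
    have p: "p = q + int d + 1" using True by (simp add: d_def)
    have "hor p q = fst (l (Suc d)) q" "ver (p + 1) q = snd (l (Suc d)) q"
      "ver p q = snd (l d) q" "hor p (q + 1) = fst (l d) (q + 1)"
      by (auto simp: hor_def ver_def p nat_add_distrib)
    then show ?thesis using l(3)[of d] ab by (simp add: low_def p)
  next
    case False
    define d where "d = nat (q - p)"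
    have q: "q = p + int d" using False by (simp add: d_def)
    have "hor p q = fst (u d) p" "ver (p + 1) q = snd (u d) p"
      "ver p q = snd (u (Suc d)) (p - 1)" "hor p (q + 1) = fst (u (Suc d)) p"
      by (auto simp: hor_def ver_def q nat_add_distrib l(1) u(1))
    then show ?thesis using u(3)[of d] ab by (simp add: upp_def q)
  qed
  moreover have "hor p q a \<in> carrier F" "ver p q a \<in> carrier F" for p q a
    using l(2) u(2) by (auto simp: hor_def ver_def closed_def)
  moreover have "hor p p a = \<xi> a" "ver (p + 1) p a = \<xi> a" for p a
    by (simp_all add: hor_def ver_def l(1) z0_def)
  ultimately show ?thesis by blast
qed


section \<open>Free generators\<close>

text \<open>
  The path in the maximal tree from the base vertex to the vertex \<open>t mod N\<close> of the cycle.
\<close>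

definition stem :: "int \<Rightarrow> 'b list" where
  "stem t = map (\<lambda>i. letter (int i)) [0..<nat (t mod N)]"

lemma part_mod: "part (t mod N) = part t"
  by (simp add: part_def)

lemma letter_mod: "letter (t mod N) = letter t"
  by (simp add: letter_def part_mod)

lemma stem_0: "t mod N = 0 \<Longrightarrow> stem t = []"
  by (simp add: stem_def)

lemma stem_mod: "t mod N = t' mod N \<Longrightarrow> stem t = stem t'"
  by (simp add: stem_def)

lemma mod_Suc_N: "(t + 1) mod N \<noteq> 0 \<Longrightarrow> (t + 1) mod N = t mod N + 1"
proof -
  assume ne: "(t + 1) mod N \<noteq> 0"
  have eq: "(t + 1) mod N = (t mod N + 1) mod N" by (simp add: mod_add_left_eq)
  have "0 \<le> t mod N" "t mod N < N" using N_pos pos_mod_bound pos_mod_sign by blast+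
  moreover have "t mod N + 1 \<noteq> N" using ne eq by auto
  ultimately show ?thesis using eq by simp
qed

lemma stem_Suc:
  assumes "(t + 1) mod N \<noteq> 0"
  shows "stem (t + 1) = stem t @ [letter t]"
proof -
  have "nat ((t + 1) mod N) = Suc (nat (t mod N))"
    using mod_Suc_N[OF assms] N_pos by (simp add: nat_add_distrib)
  moreover have "int (nat (t mod N)) = t mod N" using N_pos by simp
  ultimately show ?thesis by (simp add: stem_def letter_mod)
qed

lemma walk_stem: "walk (t - t mod N) (stem t) t"
proof -
  have "walk 0 (map (\<lambda>i. letter (int i)) [0..<j]) (int j)" for j
    by (induction j) (auto simp: walk_append letter_part add.commute)
  from walk_shift[OF this[of "nat (t mod N)"], of "t div N"] show ?thesis
    using N_pos by (simp add: stem_def minus_mod_eq_mult_div)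
qed

lemma stem_lists [simp]: "stem t \<in> lists V" "rev (stem t) \<in> lists V"
  using walk_lists[OF walk_stem] walk_lists[OF walk_rev[OF walk_stem]] by blast+

definition loop_word :: "'b \<Rightarrow> 'b list" where
  "loop_word a = stem (int (index a)) @ [a] @ rev (stem (int (index a) + 1))"

definition gen where "gen a = E (loop_word a)"

text \<open>
  The chosen letters, except for the one that closes the cycle, form a maximal tree of the cycle with
  multiplied edges. The remaining letters index a basis.
\<close>

definition basis :: "'b set" where
  "basis = {a \<in> V. \<not> (\<exists>t. a = letter t \<and> (t + 1) mod N \<noteq> 0)}"

lemma loop_word_walk:
  assumes "a \<in> V"
  shows "\<exists>m. walk 0 (loop_word a) (N * m)"
proof -
  let ?j = "int (index a)"
  have j: "a \<in> part ?j" "?j mod N = ?j" using vertex_part[OF assms] by auto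
  have "walk 0 (stem ?j) ?j" using walk_stem[of ?j] j by simp
  moreover have "walk (?j + 1) (rev (stem (?j + 1))) (N * ((?j + 1) div N))"
    using walk_rev[OF walk_stem[of "?j + 1"]] by (simp add: minus_mod_eq_mult_div)
  ultimately have "walk 0 (loop_word a) (N * ((?j + 1) div N))"
    using j unfolding loop_word_def by (auto simp: walk_append simp del: mult_eq_0_iff)
  then show ?thesis ..
qed

lemma gen_H: "a \<in> V \<Longrightarrow> gen a \<in> H"
  using loop_word_walk H_I by (auto simp: gen_def)

lemma gen_stem:
  assumes "a \<in> part t"
  shows "E (stem t @ [a] @ rev (stem (t + 1))) = gen a"
proof -
  have "int (index a) = t mod N" using assms by (rule index_part)
  then have "stem (int (index a)) = stem t" "stem (int (index a) + 1) = stem (t + 1)"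
    by (auto intro!: stem_mod simp: mod_add_left_eq)
  then show ?thesis by (simp add: gen_def loop_word_def)
qed

lemma E_rev_cancel: "w \<in> lists V \<Longrightarrow> E (w @ rev w) = \<bbbone>"
  using racg_elem_rev[of w \<Delta>] E_append[of w "rev w"] by (simp add: rev_in_lists del: in_lists_conv_set)

lemma gen_trivial:
  assumes "a \<in> V" "a \<notin> basis"
  shows "gen a = \<bbbone>"
proof -
  obtain t where t: "a = letter t" "(t + 1) mod N \<noteq> 0" using assms by (auto simp: basis_def)
  then have "a \<in> part t" using letter_part by simp
  then have "gen a = E (stem (t + 1) @ rev (stem (t + 1)))"
    using gen_stem stem_Suc t by fastforce
  then show ?thesis using E_rev_cancel by simp
qed

text \<open>
  Inserting the stem to each vertex of a walk and back decomposes it into loops through single edges.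
\<close>

lemma walk_generate:
  "walk t w t' \<Longrightarrow> E (stem t @ w @ rev (stem t')) \<in> generate (racg \<Delta>) (gen ` basis)"
proof (induction w arbitrary: t)
  case Nil
  then show ?case using E_rev_cancel[OF stem_lists(1)] by (simp add: generate.one)
next
  case (Cons a w)
  have gens: "gen a \<in> generate (racg \<Delta>) (gen ` basis) \<and> (gen a)\<^sup>- \<in> generate (racg \<Delta>) (gen ` basis)"
    if "a \<in> V"
    using that gen_trivial[OF that] by (cases "a \<in> basis") (auto intro: generate.incl generate.inv generate.one)
  have step: "E (stem t @ (a # w) @ rev (stem t')) \<in> generate (racg \<Delta>) (gen ` basis)"
    if r: "walk r w t'" and a: "a \<in> V" and
      eq: "E (stem t @ [a] @ rev (stem r)) \<in> generate (racg \<Delta>) (gen ` basis)" for r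
  proof -
    have w: "w \<in> lists V" using r by (rule walk_lists)
    have lists: "[a] @ rev (stem r) \<in> lists V" "w @ rev (stem t') \<in> lists V"
      "[a] @ w @ rev (stem t') \<in> lists V" "[a] \<in> lists V"
      using a w stem_lists by (simp_all only: append_in_lists_conv lists.intros)
    have C: "E (stem t) \<in> C" "E [a] \<in> C" "E (rev (stem r)) \<in> C" "E (stem r) \<in> C"
      "E (w @ rev (stem t')) \<in> C"
      using a lists by (simp_all only: E_carrier stem_lists gen_carrier)
    have "E (stem t @ [a] @ rev (stem r)) \<cdot> E (stem r @ w @ rev (stem t')) =
        E (stem t) \<cdot> (E [a] \<cdot> E (rev (stem r))) \<cdot> (E (stem r) \<cdot> E (w @ rev (stem t')))"
      using E_append[OF stem_lists(1) lists(1)] E_append[OF lists(4) stem_lists(2)]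
        E_append[OF stem_lists(1) lists(2)] by (simp only:)
    also have "\<dots> = E (stem t) \<cdot> (E [a] \<cdot> (E (rev (stem r)) \<cdot> E (stem r) \<cdot> E (w @ rev (stem t'))))"
      using C by (simp only: W.m_assoc W.m_closed)
    also have "E (rev (stem r)) \<cdot> E (stem r) = \<bbbone>"
      using racg_elem_rev[OF stem_lists(1)] W.l_inv[OF C(4)] by (simp only:)
    also have "E (stem t) \<cdot> (E [a] \<cdot> (\<bbbone> \<cdot> E (w @ rev (stem t')))) = E (stem t @ [a] @ w @ rev (stem t'))"
      using E_append[OF stem_lists(1) lists(3)] E_append[OF lists(4) lists(2)] C
      by (simp only: W.l_one)
    finally show ?thesis using generate.eng[OF eq Cons.IH[OF r]] by simp
  qed
  from Cons.prems consider "a \<in> part t" "walk (t + 1) w t'" | "a \<in> part (t - 1)" "walk (t - 1) w t'"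
    by auto
  then show ?case
  proof cases
    case 1
    then show ?thesis using step[OF 1(2)] gens gen_stem part_vertex by metis
  next
    case 2
    then have a: "a \<in> V" by (simp add: part_vertex)
    have "E (stem (t - 1) @ [a] @ rev (stem t)) = gen a" using gen_stem[OF 2(1)] by simp
    then have "E (rev (stem (t - 1) @ [a] @ rev (stem t))) = (gen a)\<^sup>-"
      using racg_elem_rev[of "stem (t - 1) @ [a] @ rev (stem t)" \<Delta>] a
      by (simp del: in_lists_conv_set rev_append)
    then have "E (stem t @ [a] @ rev (stem (t - 1))) = (gen a)\<^sup>-" by simp
    then show ?thesis using step[OF 2(2) a] gens[OF a] by simp
  qed
qed

lemma generate_basis: "generate (racg \<Delta>) (gen ` basis) = H"
proof
  show "generate (racg \<Delta>) (gen ` basis) \<subseteq> H"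
    by (rule W.generate_subgroup_incl[OF _ subgroup_H]) (auto simp: basis_def gen_H)
  show "H \<subseteq> generate (racg \<Delta>) (gen ` basis)"
  proof
    fix g assume "g \<in> H"
    then obtain w m where "walk 0 w (N * m)" "g = E w" by (auto simp: H_def)
    then show "g \<in> generate (racg \<Delta>) (gen ` basis)"
      using walk_generate[of 0 w "N * m"] by (simp add: stem_0)
  qed
qed

section \<open>The action given by a cocycle\<close>

lemma mem_part_iff: "a \<in> V \<Longrightarrow> a \<in> part t \<longleftrightarrow> int (index a) = t mod N"
  using index_part vertex_part by (metis part_mod)

lemma part_unique: "a \<in> part t \<Longrightarrow> a \<in> part t' \<Longrightarrow> N dvd t - t'"
  using index_part mod_eq_dvd_iff by metis

lemma part_two: "a \<in> part t \<Longrightarrow> a \<notin> part (t + 2)" "a \<in> part (t + 2) \<Longrightarrow> a \<notin> part t"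
proof -
  have "\<not> N dvd 2" using k2 by (auto dest: zdvd_imp_le)
  moreover have "N dvd 2" if "a \<in> part t" "a \<in> part (t + 2)" using part_unique[OF that(2,1)] by simp
  ultimately show "a \<in> part t \<Longrightarrow> a \<notin> part (t + 2)" "a \<in> part (t + 2) \<Longrightarrow> a \<notin> part t" by blast+
qed

lemma part_index_parity: "a \<in> part t \<Longrightarrow> even (index a) \<longleftrightarrow> even t"
  using index_part[of a t] by (metis dvd_mod_iff dvd_triv_left even_of_nat)

lemma move_hor_back: "a \<in> part (2 * p) \<Longrightarrow> move a (p + 1, q) = (p, q)"
  using move_hor move_move by metis

lemma move_ver_back: "b \<in> part (2 * q + 1) \<Longrightarrow> move b (p, q + 1) = (p, q)"
  using move_ver move_move by metis

lemma move_hor_fix: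
  assumes "a \<in> V" "even (index a)" "a \<notin> part (2 * p)" "a \<notin> part (2 * (p - 1))"
  shows "move a (p, q) = (p, q)"
proof -
  have "2 * p mod N = 2 * (p mod int k)" for p by simp
  from this[of p] this[of "p - 1"] show ?thesis using assms
    by (auto simp: move_def shift_def mem_part_iff elim!: evenE)
qed

lemma move_ver_fix:
  assumes "b \<in> V" "odd (index b)" "b \<notin> part (2 * q + 1)" "b \<notin> part (2 * (q - 1) + 1)"
  shows "move b (p, q) = (p, q)"
proof -
  have "(2 * q + 1) mod N = 2 * (q mod int k) + 1" for q
  proof (cases "(2 * q + 1) mod N = 0")
    case True
    then have "even ((2 * q + 1) mod N)" by simp
    then show ?thesis by (simp add: dvd_mod_iff)
  next
    case False
    then show ?thesis using mod_Suc_N[of "2 * q"] by simp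
  qed
  from this[of q] this[of "q - 1"] show ?thesis using assms
    by (auto simp: move_def shift_def mem_part_iff elim!: oddE)
qed

context
  fixes F :: "'f monoid" and hor ver :: "int \<Rightarrow> int \<Rightarrow> 'b \<Rightarrow> 'f"
  assumes grpF: "group F"
    and horC: "\<And>p q a. hor p q a \<in> carrier F"
    and verC: "\<And>p q a. ver p q a \<in> carrier F"
    and square: "\<And>p q a b. a \<in> part (2 * p) \<Longrightarrow> b \<in> part (2 * q + 1) \<Longrightarrow> (a, b) \<in> parcs \<Delta> \<Longrightarrow>
      hor p q a \<otimes>\<^bsub>F\<^esub> ver (p + 1) q b = ver p q b \<otimes>\<^bsub>F\<^esub> hor p (q + 1) a"
begin

interpretation F: group F by (rule grpF)

text \<open>
  The value of the cocycle on the edge along which the letter moves, inverted if the edge is used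
  backwards.
\<close>

definition increment :: "'b \<Rightarrow> int \<times> int \<Rightarrow> 'f" where
  "increment a = (\<lambda>(p, q).
     if a \<in> part (2 * p) then hor p q a
     else if a \<in> part (2 * (p - 1)) then inv\<^bsub>F\<^esub> hor (p - 1) q a
     else if a \<in> part (2 * q + 1) then ver p q a
     else if a \<in> part (2 * (q - 1) + 1) then inv\<^bsub>F\<^esub> ver p (q - 1) a
     else \<one>\<^bsub>F\<^esub>)"

definition lift_move :: "'b \<Rightarrow> (int \<times> int) \<times> 'f \<Rightarrow> (int \<times> int) \<times> 'f" where
  "lift_move a = (\<lambda>(v, f). (move a v, f \<otimes>\<^bsub>F\<^esub> increment a v))"

lemma lift_hor:
  assumes "a \<in> part (2 * p)"
  shows "lift_move a ((p, q), f) = ((p + 1, q), f \<otimes>\<^bsub>F\<^esub> hor p q a)"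
    and "lift_move a ((p + 1, q), f) = ((p, q), f \<otimes>\<^bsub>F\<^esub> inv\<^bsub>F\<^esub> hor p q a)"
  using assms part_two(1)[OF assms]
  by (simp_all add: lift_move_def increment_def move_hor move_hor_back)

lemma lift_ver:
  assumes "b \<in> part (2 * q + 1)"
  shows "lift_move b ((p, q), f) = ((p, q + 1), f \<otimes>\<^bsub>F\<^esub> ver p q b)"
    and "lift_move b ((p, q + 1), f) = ((p, q), f \<otimes>\<^bsub>F\<^esub> inv\<^bsub>F\<^esub> ver p q b)"
proof -
  have "even t \<Longrightarrow> b \<notin> part t" for t
    using part_index_parity[OF assms] part_index_parity[of b t] by auto
  then show "lift_move b ((p, q), f) = ((p, q + 1), f \<otimes>\<^bsub>F\<^esub> ver p q b)"
    and "lift_move b ((p, q + 1), f) = ((p, q), f \<otimes>\<^bsub>F\<^esub> inv\<^bsub>F\<^esub> ver p q b)"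
    using assms part_two(1)[OF assms]
    by (simp_all add: lift_move_def increment_def move_ver move_ver_back)
qed

lemma lift_hor_cases:
  assumes "a \<in> V" "even (index a)"
  obtains "a \<in> part (2 * p)" | p' where "p = p' + 1" "a \<in> part (2 * p')"
    | "\<And>q f. f \<in> carrier F \<Longrightarrow> lift_move a ((p, q), f) = ((p, q), f)"
proof (cases "a \<in> part (2 * p) \<or> a \<in> part (2 * (p - 1))")
  case True
  then show ?thesis using that(1) that(2)[of "p - 1"] by auto
next
  case False
  have "odd t \<Longrightarrow> a \<notin> part t" for t using assms(2) part_index_parity[of a t] by auto
  then have "increment a (p, q) = \<one>\<^bsub>F\<^esub>" for q using False by (simp add: increment_def)
  then show ?thesis using that(3) move_hor_fix[OF assms] False by (simp add: lift_move_def)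
qed

lemma lift_ver_cases:
  assumes "b \<in> V" "odd (index b)"
  obtains "b \<in> part (2 * q + 1)" | q' where "q = q' + 1" "b \<in> part (2 * q' + 1)"
    | "\<And>p f. f \<in> carrier F \<Longrightarrow> lift_move b ((p, q), f) = ((p, q), f)"
proof (cases "b \<in> part (2 * q + 1) \<or> b \<in> part (2 * (q - 1) + 1)")
  case True
  then show ?thesis using that(1) that(2)[of "q - 1"] by auto
next
  case False
  have "even t \<Longrightarrow> b \<notin> part t" for t using assms(2) part_index_parity[of b t] by auto
  then have "increment b (p, q) = \<one>\<^bsub>F\<^esub>" for p using False by (simp add: increment_def)
  then show ?thesis using that(3) move_ver_fix[OF assms] False by (simp add: lift_move_def)
qed

lemma increment_carrier: "increment a v \<in> carrier F"
  using horC verC by (cases v) (auto simp: increment_def)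

lemma lift_carrier: "snd x \<in> carrier F \<Longrightarrow> snd (lift_move a x) \<in> carrier F"
  using increment_carrier by (cases x) (auto simp: lift_move_def)

lemma lift_lift:
  assumes a: "a \<in> V" and f: "f \<in> carrier F"
  shows "lift_move a (lift_move a ((p, q), f)) = ((p, q), f)"
proof (cases "even (index a)")
  case True
  show ?thesis
  proof (rule lift_hor_cases[OF a True, of p])
    fix p' assume "p = p' + 1" "a \<in> part (2 * p')"
    then show ?thesis using f horC by (simp add: lift_hor F.m_assoc)
  qed (use f horC in \<open>simp_all add: lift_hor F.m_assoc\<close>)
next
  case False
  show ?thesis
  proof (rule lift_ver_cases[OF a, of q])
    fix q' assume "q = q' + 1" "a \<in> part (2 * q' + 1)"
    then show ?thesis using f verC by (simp add: lift_ver F.m_assoc)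
  qed (use f verC False in \<open>simp_all add: lift_ver F.m_assoc\<close>)
qed

text \<open>
  Involutions that commute at a point commute on its whole orbit, so it is enough to look at the
  lower left corners of the squares.
\<close>

lemma lift_commute_even_odd:
  assumes ab: "(a, b) \<in> parcs \<Delta>" "even (index a)" and f: "f \<in> carrier F"
  shows "lift_move a (lift_move b ((p, q), f)) = lift_move b (lift_move a ((p, q), f))"
proof -
  have V: "a \<in> V" "b \<in> V" and odd: "odd (index b)"
    using edge_vertices[OF ab(1)] edge_index[OF ab(1)] ab(2) by auto
  let ?a = "lift_move a" and ?b = "lift_move b"
  have inv: "?a (?a x) = x" "?b (?b x) = x" if "snd x \<in> carrier F" for x
    using that V lift_lift by (cases x; cases "fst x"; simp)+
  have corner: "?a (?b ((p, q), f)) = ?b (?a ((p, q), f))"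
    if "a \<in> part (2 * p)" "b \<in> part (2 * q + 1)" "f \<in> carrier F" for p q f
    using that square[OF that(1,2) ab(1)] horC verC by (simp add: lift_hor lift_ver F.m_assoc)
  have half: "?a (?b ((p, q), f)) = ?b (?a ((p, q), f))"
    if a: "a \<in> part (2 * p)" and f: "f \<in> carrier F" for p f
  proof (rule lift_ver_cases[OF V(2) odd, of q])
    show "?a (?b ((p, q), f)) = ?b (?a ((p, q), f))" if "b \<in> part (2 * q + 1)"
      using corner[OF a that f] .
  next
    fix q' assume q: "q = q' + 1" "b \<in> part (2 * q' + 1)"
    let ?x = "?b ((p, q), f)"
    have x: "?x = ((p, q'), f \<otimes>\<^bsub>F\<^esub> inv\<^bsub>F\<^esub> ver p q' b)" using q by (simp add: lift_ver)
    have xC: "snd ?x \<in> carrier F" "snd (?a ?x) \<in> carrier F" using f lift_carrier by simp_all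
    have "?a (?b ?x) = ?b (?a ?x)" unfolding x using corner[OF a q(2)] f verC by simp
    then have "?b (?a (?b ?x)) = ?a ?x" using inv(2)[OF xC(2)] by simp
    then show "?a (?b ((p, q), f)) = ?b (?a ((p, q), f))" using inv(2)[of "((p, q), f)"] f by simp
  next
    assume fix_b: "\<And>p f. f \<in> carrier F \<Longrightarrow> ?b ((p, q), f) = ((p, q), f)"
    then show "?a (?b ((p, q), f)) = ?b (?a ((p, q), f))" using a f horC by (simp add: lift_hor)
  qed
  show ?thesis
  proof (rule lift_hor_cases[OF V(1) ab(2), of p])
    show ?thesis if "a \<in> part (2 * p)" using half[OF that f] .
  next
    fix p' assume p: "p = p' + 1" "a \<in> part (2 * p')"
    let ?x = "?a ((p, q), f)"
    have x: "?x = ((p', q), f \<otimes>\<^bsub>F\<^esub> inv\<^bsub>F\<^esub> hor p' q a)" using p by (simp add: lift_hor)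
    have xC: "snd ?x \<in> carrier F" "snd (?b ?x) \<in> carrier F" using f lift_carrier by simp_all
    have "?a (?b ?x) = ?b (?a ?x)" unfolding x using half[OF p(2)] f horC by simp
    then have "?a (?b (?a ?x)) = ?b ?x" using inv(1)[OF xC(2)] by simp
    then show ?thesis using inv(1)[of "((p, q), f)"] f by simp
  next
    assume fix_a: "\<And>q f. f \<in> carrier F \<Longrightarrow> ?a ((p, q), f) = ((p, q), f)"
    have "\<exists>q' f'. ?b ((p, q), f) = ((p, q'), f') \<and> f' \<in> carrier F"
      using odd f increment_carrier by (auto simp: lift_move_def move_def)
    then show ?thesis using fix_a f by auto
  qed
qed

lemma lift_action: "racg_action \<Delta> (UNIV \<times> carrier F) lift_move"
  unfolding racg_action_def
proof (intro conjI ballI allI impI)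
  fix a and x :: "(int \<times> int) \<times> 'f" assume a: "a \<in> V" and "x \<in> UNIV \<times> carrier F"
  then obtain p q f where x: "x = ((p, q), f)" "f \<in> carrier F" by auto
  show "lift_move a x \<in> UNIV \<times> carrier F" using lift_carrier[of x a] x by (simp add: mem_Times_iff)
  show "lift_move a (lift_move a x) = x" using lift_lift a x by simp
next
  fix a b and x :: "(int \<times> int) \<times> 'f" assume e: "(a, b) \<in> parcs \<Delta>" and "x \<in> UNIV \<times> carrier F"
  then obtain p q f where x: "x = ((p, q), f)" "f \<in> carrier F" by auto
  show "lift_move a (lift_move b x) = lift_move b (lift_move a x)"
  proof (cases "even (index a)")
    case True
    then show ?thesis using lift_commute_even_odd[OF e] x by simp
  next
    case False
    then have "even (index b)" using edge_index[OF e] by simp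
    then show ?thesis using lift_commute_even_odd[OF edge_sym[OF e]] x by simp
  qed
qed

context
  fixes \<xi> :: "'b \<Rightarrow> 'f"
  assumes stairs: "\<And>p a. hor p p a = \<xi> a" "\<And>p a. ver (p + 1) p a = \<xi> a"
begin

lemma xi_carrier: "\<xi> a \<in> carrier F"
  using horC[of 0 0 a] stairs(1) by simp

lemma lift_stairs:
  assumes "a \<in> part t"
  shows "lift_move a (grid t, f) = (grid (t + 1), f \<otimes>\<^bsub>F\<^esub> \<xi> a)"
    and "lift_move a (grid (t + 1), f) = (grid t, f \<otimes>\<^bsub>F\<^esub> inv\<^bsub>F\<^esub> \<xi> a)"
proof -
  have "lift_move a (grid t, f) = (grid (t + 1), f \<otimes>\<^bsub>F\<^esub> \<xi> a) \<and>
    lift_move a (grid (t + 1), f) = (grid t, f \<otimes>\<^bsub>F\<^esub> inv\<^bsub>F\<^esub> \<xi> a)"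
  proof (cases "even t")
    case True
    then obtain p where t: "t = 2 * p" by (elim evenE)
    then show ?thesis using assms lift_hor[of a p p] by (simp add: grid_def stairs add.commute)
  next
    case False
    then obtain p where t: "t = 2 * p + 1" by (elim oddE)
    then show ?thesis using assms lift_ver[of a p "p + 1"] stairs(2)[of p a]
      by (simp add: grid_def add.commute)
  qed
  then show "lift_move a (grid t, f) = (grid (t + 1), f \<otimes>\<^bsub>F\<^esub> \<xi> a)"
    and "lift_move a (grid (t + 1), f) = (grid t, f \<otimes>\<^bsub>F\<^esub> inv\<^bsub>F\<^esub> \<xi> a)" by auto
qed

lemma lift_walk_trivial:
  "walk t w t' \<Longrightarrow> \<forall>a\<in>set w. \<xi> a = \<one>\<^bsub>F\<^esub> \<Longrightarrow> f \<in> carrier F \<Longrightarrow>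
    fold lift_move w (grid t, f) = (grid t', f)"
proof (induction w arbitrary: t)
  case (Cons a w)
  from Cons.prems(1) consider "a \<in> part t" "walk (t + 1) w t'" | "a \<in> part (t - 1)" "walk (t - 1) w t'"
    by auto
  then show ?case
  proof cases
    case 1
    then show ?thesis using Cons lift_stairs(1)[OF 1(1), of f] by simp
  next
    case 2
    then show ?thesis using Cons lift_stairs(2)[OF 2(1), of f] by simp
  qed
qed simp

lemma lift_gen:
  assumes a: "a \<in> V" and f: "f \<in> carrier F" and triv: "\<And>a. a \<in> V - basis \<Longrightarrow> \<xi> a = \<one>\<^bsub>F\<^esub>"
  shows "\<exists>m'. act lift_move (gen a) (grid (N * m), f) = (grid (N * m'), f \<otimes>\<^bsub>F\<^esub> \<xi> a)"
proof -
  let ?j = "int (index a)" let ?t = "?j + N * m"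
  have j: "a \<in> part ?t" "?t mod N = ?j" using vertex_part[OF a] part_shift by auto
  have "\<xi> x = \<one>\<^bsub>F\<^esub>" if "x \<in> set (stem t)" for x t
  proof (rule triv)
    from that obtain i where i: "i < nat (t mod N)" "x = letter (int i)" by (auto simp: stem_def)
    have "t mod N < N" using N_pos by simp
    then have "(int i + 1) mod N = int i + 1" using i(1) by (intro mod_pos_pos_trivial) auto
    then have "(int i + 1) mod N \<noteq> 0" by simp
    then show "x \<in> V - basis" using i(2) part_vertex[OF letter_part] by (auto simp: basis_def)
  qed
  then have triv': "\<forall>x\<in>set (stem t). \<xi> x = \<one>\<^bsub>F\<^esub>" for t by blast
  have stems: "stem ?j = stem ?t" "stem (?j + 1) = stem (?t + 1)"
    using mod_mult_self2[of ?j N m] mod_mult_self2[of "?j + 1" N m]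
    by (auto intro!: stem_mod simp: ac_simps)
  have "?t - ?t mod N = N * m" using j by simp
  then have 1: "fold lift_move (stem ?t) (grid (N * m), f) = (grid ?t, f)"
    using lift_walk_trivial[OF walk_stem[of ?t] triv' f] by simp
  have "walk (?t + 1) (rev (stem (?t + 1))) (N * ((?t + 1) div N))"
    using walk_rev[OF walk_stem[of "?t + 1"]] by (simp add: minus_mod_eq_mult_div)
  then have 2: "fold lift_move (rev (stem (?t + 1))) (grid (?t + 1), f \<otimes>\<^bsub>F\<^esub> \<xi> a) =
      (grid (N * ((?t + 1) div N)), f \<otimes>\<^bsub>F\<^esub> \<xi> a)"
    using triv'[of "?t + 1"] f xi_carrier by (intro lift_walk_trivial) auto
  have "loop_word a \<in> lists V" using loop_word_walk[OF a] walk_lists by blast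
  then have "act lift_move (gen a) (grid (N * m), f) = fold lift_move (loop_word a) (grid (N * m), f)"
    unfolding gen_def using f by (intro act_E[OF lift_action]) auto
  also have "\<dots> = (grid (N * ((?t + 1) div N)), f \<otimes>\<^bsub>F\<^esub> \<xi> a)"
    unfolding loop_word_def stems using 1 2 lift_stairs(1)[OF j(1)] by simp
  finally show ?thesis by blast
qed

lemma lift_H:
  assumes "g \<in> H"
  shows "\<exists>m. \<exists>f\<in>carrier F. act lift_move g (grid 0, \<one>\<^bsub>F\<^esub>) = (grid (N * m), f)"
proof -
  obtain w m where w: "walk 0 w (N * m)" "g = E w" using assms by (auto simp: H_def)
  have "fst (fold lift_move w (v, f)) = fold move w v" for v f
    by (induction w arbitrary: v f) (auto simp: lift_move_def)
  then have "fst (fold lift_move w (grid 0, \<one>\<^bsub>F\<^esub>)) = grid (N * m)"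
    using move_walk[OF w(1)] by simp
  moreover have "fold lift_move w (grid 0, \<one>\<^bsub>F\<^esub>) \<in> UNIV \<times> carrier F"
    using walk_lists[OF w(1)] by (intro fold_action_closed[OF lift_action]) auto
  moreover have "act lift_move g (grid 0, \<one>\<^bsub>F\<^esub>) = fold lift_move w (grid 0, \<one>\<^bsub>F\<^esub>)"
    unfolding w(2) using walk_lists[OF w(1)] by (intro act_E[OF lift_action]) auto
  ultimately show ?thesis by (auto simp: mem_Times_iff intro!: exI[of _ m] bexI prod_eqI)
qed

end

end

text \<open>
  The value \<open>\<xi>\<close> on the staircase is trivial on the maximal tree and a free generator on each other
  letter. In the lifted action the generator \<open>gen a\<close> of \<open>H\<close> then multiplies the second component by
  \<open>\<xi> a\<close>, starting from any point of the staircase over the base vertex.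
\<close>

lemma is_free_H: "is_free (racg \<Delta>\<lparr>carrier := H\<rparr>)"
proof -
  define X where "X = gen ` basis"
  define F where "F = free_group X"
  have X: "X \<subseteq> H" using gen_H by (auto simp: X_def basis_def)
  have F: "group F" by (simp add: F_def free_group_def group_presented_group)
  then interpret F: group F .
  define \<xi> where "\<xi> a = (if a \<in> basis then presentation_rel X {} `` {[(gen a, True)]} else \<one>\<^bsub>F\<^esub>)" for a
  have "presentation_rel X {} `` {[(x, True)]} \<in> carrier F" if "x \<in> X" for x
    using that by (auto simp: F_def free_group_def carrier_presented_group)
  then have "\<xi> a \<in> carrier F" for a by (simp add: \<xi>_def X_def)
  note \<xi>_carrier = this
  obtain hor ver where
    c: "\<And>p q a. hor p q a \<in> carrier F" "\<And>p q a. ver p q a \<in> carrier F"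
      "\<And>p q a b. a \<in> part (2 * p) \<Longrightarrow> b \<in> part (2 * q + 1) \<Longrightarrow> (a, b) \<in> parcs \<Delta> \<Longrightarrow>
        hor p q a \<otimes>\<^bsub>F\<^esub> ver (p + 1) q b = ver p q b \<otimes>\<^bsub>F\<^esub> hor p (q + 1) a"
    and s: "\<And>p a. hor p p a = \<xi> a" "\<And>p a. ver (p + 1) p a = \<xi> a"
    using cocycle_exists[where \<xi> = \<xi>, OF F \<xi>_carrier] by metis
  let ?l = "lift_move F hor ver"
  note action = lift_action[where F = F and hor = hor and ver = ver, OF F c]
  define f where "f g = snd (act ?l g (grid 0, \<one>\<^bsub>F\<^esub>))" for g
  have state: "\<exists>m. act ?l g (grid 0, \<one>\<^bsub>F\<^esub>) = (grid (N * m), f g) \<and> f g \<in> carrier F" if "g \<in> H" for g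
    using lift_H[where F = F and hor = hor and ver = ver and \<xi> = \<xi>, OF F c s that] by (auto simp: f_def)
  show ?thesis
  proof (rule is_freeI[where f = f and X = X])
    show "group (racg \<Delta>\<lparr>carrier := H\<rparr>)" using subgroup_H by (rule W.subgroup_imp_group)
    show "X \<subseteq> carrier (racg \<Delta>\<lparr>carrier := H\<rparr>)" using X by simp
    show "generate (racg \<Delta>\<lparr>carrier := H\<rparr>) X = carrier (racg \<Delta>\<lparr>carrier := H\<rparr>)"
      using W.generate_consistent[OF X subgroup_H] generate_basis by (simp add: X_def)
    show "f g \<in> carrier (free_group X)" if "g \<in> carrier (racg \<Delta>\<lparr>carrier := H\<rparr>)" for g
      using state that by (auto simp: F_def)
    show "f \<one>\<^bsub>racg \<Delta>\<lparr>carrier := H\<rparr>\<^esub> = \<one>\<^bsub>free_group X\<^esub>"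
      using act_one[OF action, of "(grid 0, \<one>\<^bsub>F\<^esub>)"] F.one_closed by (simp add: f_def flip: F_def)
    show "f (g \<otimes>\<^bsub>racg \<Delta>\<lparr>carrier := H\<rparr>\<^esub> x) =
        f g \<otimes>\<^bsub>free_group X\<^esub> presentation_rel X {} `` {[(x, True)]}"
      if g: "g \<in> carrier (racg \<Delta>\<lparr>carrier := H\<rparr>)" and x: "x \<in> X" for g x
    proof -
      obtain a where a: "a \<in> basis" "x = gen a" using x by (auto simp: X_def)
      then have aV: "a \<in> V" by (simp add: basis_def)
      have gx: "g \<in> C" "x \<in> C" "g \<in> H" using g x X subgroup.subset[OF subgroup_H] by auto
      obtain m where m: "act ?l g (grid 0, \<one>\<^bsub>F\<^esub>) = (grid (N * m), f g)" "f g \<in> carrier F"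
        using state[OF gx(3)] by blast
      obtain m' where m': "act ?l (gen a) (grid (N * m), f g) = (grid (N * m'), f g \<otimes>\<^bsub>F\<^esub> \<xi> a)"
        using lift_gen[where F = F and hor = hor and ver = ver and \<xi> = \<xi> and m = m, OF F c s aV m(2)]
        by (auto simp: \<xi>_def)
      have "(grid 0, \<one>\<^bsub>F\<^esub>) \<in> UNIV \<times> carrier F" using F.one_closed by simp
      from act_mult[OF action gx(1,2) this] have "f (g \<cdot> x) = f g \<otimes>\<^bsub>F\<^esub> \<xi> a"
        unfolding m(1) unfolding a(2) m' by (simp only: f_def snd_conv)
      then show ?thesis using a by (simp add: \<xi>_def F_def)
    qed
  qed
qed


section \<open>Loops in the rose and walks on the staircase\<close>

text \<open>
  A backtrack has a label \<open>[a, a]\<close>, which is trivial since generators are involutions. So labels give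
  a homomorphism from the fundamental group.
\<close>

lemma racg_elem_loop_homotopy:
  assumes "wf_digraph (oriented X)"
    and lab: "\<And>e. e \<in> arcs X \<Longrightarrow> label X e \<in> V"
    and "(p, q) \<in> loop_homotopy X b"
  shows "E (path_label X p) = E (path_label X q)"
proof -
  interpret O: wf_digraph "oriented X" by fact
  have lists: "path_label X p \<in> lists V" if "set p \<subseteq> arcs (oriented X)" for p
    using that lab by (fastforce simp: path_label_def oriented_def)
  have arcs: "set p \<subseteq> arcs (oriented X)" if "p \<in> loops_at X b" for p
    using that by (auto simp: loops_at_def dest: O.awalkE')
  show ?thesis using assms(3)
  proof (induction rule: loop_homotopy.induct)
    case (backtrack p x q)
    have s: "set p \<subseteq> arcs (oriented X)" "set q \<subseteq> arcs (oriented X)" "set [x, flip x] \<subseteq> arcs (oriented X)"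
      using arcs[OF backtrack.hyps(1)] by auto
    have xV: "label X (fst x) \<in> V" using s(3) lab by (auto simp: oriented_def)
    have "path_label X [x, flip x] = [label X (fst x), label X (fst x)]"
      by (simp add: path_label_def flip_def)
    then have "E (path_label X [x, flip x]) = \<bbbone>" using racg_elem_square xV by simp
    moreover have "path_label X (p @ [x, flip x] @ q) = path_label X p @ path_label X [x, flip x] @ path_label X q"
      "path_label X (p @ q) = path_label X p @ path_label X q"
      by (simp_all add: path_label_def)
    moreover have "path_label X [x, flip x] @ path_label X q \<in> lists V"
      using lists s by (simp only: append_in_lists_conv)
    ultimately show ?case
      using lists s E_append[of "path_label X p" "path_label X [x, flip x] @ path_label X q"]
        E_append[of "path_label X [x, flip x]" "path_label X q"] E_append[of "path_label X p" "path_label X q"]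
      by (simp only: W.l_one E_carrier)
  qed simp_all
qed

text \<open>
  By this homomorphism, labels of loops that generate the fundamental group generate a subgroup that
  contains the labels of all loops.
\<close>

lemma generate_loop_labels:
  assumes wf: "wf_digraph (oriented X)" and b: "b \<in> verts X"
    and lab: "\<And>e. e \<in> arcs X \<Longrightarrow> label X e \<in> V"
    and L: "generates_fundamental_group X b L"
  shows "generate (racg \<Delta>) (E ` path_label X ` L) = E ` path_label X ` loops_at X b"
proof -
  interpret O: wf_digraph "oriented X" by (rule wf)
  let ?c = "\<lambda>p. loop_homotopy X b `` {p}" and ?l = "path_label X"
  interpret P: group "fundamental_group X b" by (rule group_fundamental_group[OF wf b])
  note mult = fundamental_group_mult[OF wf b]
  note hom = racg_elem_loop_homotopy[OF wf lab]
  have lists: "?l p \<in> lists V" if "p \<in> loops_at X b" for p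
  proof -
    have "set p \<subseteq> arcs (oriented X)" using that by (auto simp: loops_at_def dest: O.awalkE')
    then show ?thesis using lab by (fastforce simp: path_label_def oriented_def)
  qed
  have L_loops: "L \<subseteq> loops_at X b" using L by (simp add: generates_fundamental_group_def)
  have nil: "[] \<in> loops_at X b" using b by (simp add: loops_at_def O.awalk_Nil_iff)
  have app: "p @ q \<in> loops_at X b" if "p \<in> loops_at X b" "q \<in> loops_at X b" for p q
    using that by (auto simp: loops_at_def)
  have l_app: "E (?l (p @ q)) = E (?l p) \<cdot> E (?l q)" if "p \<in> loops_at X b" "q \<in> loops_at X b" for p q
    using E_append lists that by (simp add: path_label_def)
  have inv_loop: "inv_word p \<in> loops_at X b" if "p \<in> loops_at X b" for p
    using edge_path_inv_word[OF wf] that by (auto simp: loops_at_def)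
  have l_inv: "E (?l (inv_word p)) = (E (?l p))\<^sup>-" if "p \<in> loops_at X b" for p
  proof -
    have "?l (inv_word p) = rev (?l p)"
      by (simp add: path_label_def inv_word_def rev_map flip_def comp_def)
    then show ?thesis using racg_elem_rev[OF lists[OF that]] by simp
  qed
  have cls_eq: "E (?l p) = E (?l q)" if "?c p = ?c q" "q \<in> loops_at X b" for p q
    using hom eq_equiv_class[OF that(1) equiv_loop_homotopy that(2)] by blast
  have c_one: "\<one>\<^bsub>fundamental_group X b\<^esub> = ?c []"
    by (simp add: fundamental_group_def word_quotient_def)
  have c_carrier: "carrier (fundamental_group X b) = ?c ` loops_at X b"
    by (auto simp: fundamental_group_def word_quotient_def quotient_def)
  have c_inv: "inv\<^bsub>fundamental_group X b\<^esub> (?c p) = ?c (inv_word p)" if p: "p \<in> loops_at X b" for p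
  proof (rule P.inv_equality)
    have "(inv_word p @ p, []) \<in> loop_homotopy X b"
      using loop_homotopy_cancel[OF wf, of b "[]" b b p "[]"] p nil by (auto simp: loops_at_def)
    then show "?c (inv_word p) \<otimes>\<^bsub>fundamental_group X b\<^esub> ?c p = \<one>\<^bsub>fundamental_group X b\<^esub>"
      using mult[OF inv_loop[OF p] p] equiv_class_eq[OF equiv_loop_homotopy] c_one by metis
  qed (use p inv_loop c_carrier in auto)
  have 1: "\<exists>p\<in>loops_at X b. z = ?c p \<and> E (?l p) \<in> generate (racg \<Delta>) (E ` ?l ` L)"
    if "z \<in> generate (fundamental_group X b) (?c ` L)" for z
    using that
  proof (induction rule: generate.induct)
    case one
    then show ?case using nil c_one by (intro bexI[of _ "[]"]) (auto simp: path_label_def E_Nil generate.one)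
  next
    case (incl h)
    then show ?case using L_loops by (auto intro!: generate.incl)
  next
    case (inv h)
    then obtain p where p: "p \<in> L" "h = ?c p" by blast
    then have "(E (?l p))\<^sup>- \<in> generate (racg \<Delta>) (E ` ?l ` L)" by (intro generate.inv) auto
    then show ?case using p L_loops c_inv l_inv inv_loop by (intro bexI[of _ "inv_word p"]) auto
  next
    case (eng h1 h2)
    then obtain p q where "p \<in> loops_at X b" "h1 = ?c p" "E (?l p) \<in> generate (racg \<Delta>) (E ` ?l ` L)"
      "q \<in> loops_at X b" "h2 = ?c q" "E (?l q) \<in> generate (racg \<Delta>) (E ` ?l ` L)" by blast
    then show ?case using mult l_app app
      by (intro bexI[of _ "p @ q"]) (auto intro: generate.eng)
  qed
  show ?thesis
  proof
    have "subgroup (E ` ?l ` loops_at X b) (racg \<Delta>)"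
    proof (rule W.subgroupI)
      show "E ` ?l ` loops_at X b \<subseteq> C" using lists by auto
      show "E ` ?l ` loops_at X b \<noteq> {}" using nil by auto
      show "g\<^sup>- \<in> E ` ?l ` loops_at X b" if "g \<in> E ` ?l ` loops_at X b" for g
      proof -
        from that obtain p where "p \<in> loops_at X b" "g = E (?l p)" by blast
        then show ?thesis using l_inv inv_loop by (intro image_eqI[of _ _ "?l (inv_word p)"]) auto
      qed
      show "g \<cdot> h \<in> E ` ?l ` loops_at X b"
        if "g \<in> E ` ?l ` loops_at X b" "h \<in> E ` ?l ` loops_at X b" for g h
      proof -
        from that obtain p q where "p \<in> loops_at X b" "g = E (?l p)" "q \<in> loops_at X b" "h = E (?l q)"
          by blast
        then show ?thesis using l_app app by (intro image_eqI[of _ _ "?l (p @ q)"]) auto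
      qed
    qed
    then show "generate (racg \<Delta>) (E ` ?l ` L) \<subseteq> E ` ?l ` loops_at X b"
      using L_loops by (intro W.generate_subgroup_incl) auto
    show "E ` ?l ` loops_at X b \<subseteq> generate (racg \<Delta>) (E ` ?l ` L)"
    proof
      fix g assume "g \<in> E ` ?l ` loops_at X b"
      then obtain p where p: "p \<in> loops_at X b" "g = E (?l p)" by blast
      then have "?c p \<in> generate (fundamental_group X b) (?c ` L)"
        using L c_carrier by (auto simp: generates_fundamental_group_def)
      then obtain q where "q \<in> loops_at X b" "?c p = ?c q" "E (?l q) \<in> generate (racg \<Delta>) (E ` ?l ` L)"
        using 1 by blast
      then show "g \<in> generate (racg \<Delta>) (E ` ?l ` L)" using cls_eq p by metis
    qed
  qed
qed

text \<open>
  The rose has a single petal, whose vertices are the residues modulo \<open>N\<close>. An edge path lifts to the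
  integers from any point over its start, and it is a loop if its lift ends at a multiple of \<open>N\<close>.
\<close>

lemma rose_loops_walks:
  fixes w :: "'a list" and A :: "'a \<Rightarrow> 'b set"
  assumes len: "length w = 2 * k" and A: "\<And>j. j < 2 * k \<Longrightarrow> A (w ! j) = B j"
  defines "X \<equiv> expand_labels A (rose_graph {w})"
  shows "path_label X ` loops_at X Base = {u. \<exists>m. walk 0 u (N * m)}"
proof -
  note defs = oriented_def expand_labels_def rose_graph_def
  have wf: "wf_digraph (oriented X)"
    by unfold_locales (force simp: X_def defs split: if_splits)+
  interpret O: wf_digraph "oriented X" by (rule wf)
  define vert where "vert t = petal_vertex w (nat (t mod N))" for t
  have vert_Suc: "petal_vertex w (Suc (nat (t mod N))) = vert (t + 1)" for t
  proof (cases "(t + 1) mod N = 0")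
    case True
    have "0 \<le> t mod N" "t mod N < N" using N_pos by simp_all
    moreover have "(t mod N + 1) mod N = 0" using True by (simp add: mod_add_left_eq)
    ultimately have "t mod N + 1 = N"
      by (cases "t mod N + 1 < N") (auto simp: mod_pos_pos_trivial)
    moreover have "int (nat (t mod N)) = t mod N" using N_pos by simp
    ultimately have "int (Suc (nat (t mod N))) = int (length w)" using len by simp
    then have "Suc (nat (t mod N)) = length w" by (simp only: of_nat_eq_iff)
    then show ?thesis using True by (simp add: vert_def petal_vertex_def)
  next
    case False
    then show ?thesis using mod_Suc_N[OF False] N_pos by (simp add: vert_def nat_add_distrib)
  qed
  have vert_inj: "t mod N = t' mod N" if "vert t = vert t'" for t t'
  proof -
    have "nat (t mod N) < length w" "nat (t' mod N) < length w" using nat_mod_N len by simp_all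
    then have "nat (t mod N) = nat (t' mod N)"
      using that by (auto simp: vert_def petal_vertex_def split: if_splits)
    then show ?thesis using N_pos by (simp add: eq_nat_nat_iff)
  qed
  have vert_X: "vert t \<in> verts X" for t
    using nat_mod_N[of t] len by (auto simp: vert_def X_def defs intro!: less_imp_le)
  have arcs_X: "((w', j), a) \<in> arcs X \<longleftrightarrow> w' = w \<and> j < 2 * k \<and> a \<in> B j" for w' j a
    using len A by (auto simp: X_def defs)
  have ends: "tail (oriented X) (((w, j), a), d) = (if d then petal_vertex w j else petal_vertex w (Suc j))"
    "head (oriented X) (((w, j), a), d) = (if d then petal_vertex w (Suc j) else petal_vertex w j)" for j a d
    by (simp_all add: X_def defs)
  have vert_nat: "petal_vertex w j = vert (int j)" "petal_vertex w (Suc j) = vert (int j + 1)" "part (int j) = B j"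
    if "j < 2 * k" for j
  proof -
    have "int j mod N = int j" using that by (intro mod_pos_pos_trivial) auto
    then show "petal_vertex w j = vert (int j)" "petal_vertex w (Suc j) = vert (int j + 1)" "part (int j) = B j"
      using vert_Suc[of "int j"] by (simp_all add: vert_def part_def)
  qed
  have loop_walk: "\<exists>t'. vert t' = v \<and> walk t (path_label X p) t'"
    if "edge_path X (vert t) p v" for p t v
    using that
  proof (induction p arbitrary: t)
    case Nil
    then show ?case by (auto simp: O.awalk_Nil_iff path_label_def)
  next
    case (Cons x p)
    obtain w' j a d where x: "x = (((w', j), a), d)" by (metis surj_pair)
    from Cons.prems have "x \<in> arcs (oriented X)" "tail (oriented X) x = vert t"
      and p: "edge_path X (head (oriented X) x) p v" by (auto simp: O.awalk_Cons_iff)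
    then have j: "w' = w" "j < 2 * k" "a \<in> B j"
      using arcs_X x by (auto simp: oriented_def)
    have l: "path_label X (x # p) = a # path_label X p"
      by (simp add: path_label_def x X_def defs)
    show ?case
    proof (cases d)
      case True
      then have "vert (int j) = vert t" using \<open>tail (oriented X) x = vert t\<close> ends(1) vert_nat j x by simp
      then have jt: "int j mod N = t mod N" by (rule vert_inj)
      then have "a \<in> part t" using j vert_nat(3) by (metis part_mod)
      moreover have "head (oriented X) x = vert (t + 1)"
        using True ends(2) vert_nat(2) j x jt by (simp add: vert_def) (metis mod_add_left_eq)
      ultimately show ?thesis using Cons.IH[of "t + 1"] p l by auto
    next
      case False
      then have "vert (int j + 1) = vert t" using \<open>tail (oriented X) x = vert t\<close> ends(1) vert_nat j x by simp
      then have "(int j + 1) mod N = t mod N" by (rule vert_inj)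
      then have jt: "int j mod N = (t - 1) mod N" by (metis add_diff_cancel_right' mod_diff_left_eq)
      then have "a \<in> part (t - 1)" using j vert_nat(3) by (metis part_mod)
      moreover have "head (oriented X) x = vert (t - 1)"
      proof -
        have "head (oriented X) x = vert (int j)" using False ends(2) vert_nat(1) j x by simp
        also have "\<dots> = vert (t - 1)" unfolding vert_def jt ..
        finally show ?thesis .
      qed
      ultimately show ?thesis using Cons.IH[of "t - 1"] p l by auto
    qed
  qed
  have walk_loop: "\<exists>p. edge_path X (vert t) p (vert t') \<and> path_label X p = u"
    if "walk t u t'" for u t t'
    using that
  proof (induction u arbitrary: t)
    case Nil
    then show ?case using vert_X by (intro exI[of _ "[]"]) (auto simp: O.awalk_Nil_iff path_label_def)
  next
    case (Cons a u)
    have edge: "\<exists>x\<in>arcs (oriented X). tail (oriented X) x = vert r \<and> head (oriented X) x = vert (r + 1) \<and> label X (fst x) = a"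
      if "a \<in> part r" for r
    proof -
      let ?x = "(((w, nat (r mod N)), a), True)"
      have "?x \<in> arcs (oriented X)" using that nat_mod_N arcs_X by (simp add: oriented_def part_def)
      moreover have "tail (oriented X) ?x = vert r" "head (oriented X) ?x = vert (r + 1)"
        using ends vert_Suc by (simp_all add: vert_def)
      moreover have "label X (fst ?x) = a" by (simp add: X_def defs)
      ultimately show ?thesis by blast
    qed
    have ext: ?case if x: "x \<in> arcs (oriented X)" "tail (oriented X) x = vert t"
      "head (oriented X) x = vert r" "label X (fst x) = a" and r: "walk r u t'" for x r
    proof -
      obtain p where "edge_path X (vert r) p (vert t')" "path_label X p = u" using Cons.IH r by blast
      then show ?thesis using x by (intro exI[of _ "x # p"]) (auto simp: O.awalk_Cons_iff path_label_def)
    qed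
    from Cons.prems consider "a \<in> part t" "walk (t + 1) u t'" | "a \<in> part (t - 1)" "walk (t - 1) u t'"
      by auto
    then show ?case
    proof cases
      case 1
      then show ?thesis using edge[OF 1(1)] ext by blast
    next
      case 2
      have label_flip: "label X (fst (flip x)) = label X (fst x)" for x
        by (simp add: flip_def)
      obtain x where "x \<in> arcs (oriented X)" "tail (oriented X) x = vert (t - 1)"
        "head (oriented X) x = vert t" "label X (fst x) = a" using edge[OF 2(1)] by auto
      then show ?thesis using ext[of "flip x" "t - 1"] 2(2) by (simp add: label_flip)
    qed
  qed
  have base: "Base = vert 0" by (simp add: vert_def petal_vertex_def)
  show ?thesis
  proof (intro equalityI subsetI)
    fix u assume "u \<in> path_label X ` loops_at X Base"
    then obtain p where "edge_path X (vert 0) p (vert 0)" "u = path_label X p"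
      by (auto simp: loops_at_def base)
    then obtain t where t: "vert t = vert 0" "walk 0 u t" using loop_walk by blast
    then have "t mod N = 0" using vert_inj by fastforce
    then obtain m where "t = N * m" by auto
    then show "u \<in> {u. \<exists>m. walk 0 u (N * m)}" using t by blast
  next
    fix u assume "u \<in> {u. \<exists>m. walk 0 u (N * m)}"
    then obtain m where "walk 0 u (N * m)" by blast
    moreover have "vert (N * m) = vert 0" by (simp add: vert_def)
    ultimately obtain p where "edge_path X (vert 0) p (vert 0)" "path_label X p = u"
      using walk_loop by metis
    then show "u \<in> path_label X ` loops_at X Base" by (auto simp: loops_at_def base)
  qed
qed

end

theorem theorem5p1:
  fixes k :: nat and s :: "nat \<Rightarrow> 'a" and \<Gamma> :: "'a pair_pre_digraph"
    and w :: "'a list" and H :: "('a \<times> bool) list set set"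
    and \<Delta> :: "'b pair_pre_digraph" and A :: "'a \<Rightarrow> 'b set"
    and H' :: "('b \<times> bool) list set set"
  assumes "k \<ge> 2"
    and "inj_on s {1..2 * k}"
    and "\<Gamma> = complete_bipartite (s ` {i \<in> {1..2 * k}. odd i}) (s ` {i \<in> {1..2 * k}. even i})"
    and "w = map s [1..<2 * k + 1]"
    and "H = generate (racg \<Gamma>) {racg_elem \<Gamma> w}"
    and "pair_graph \<Delta>"
    and "partite \<Gamma> \<Delta> A"
    and "path_connectors \<Gamma> \<Delta> A"
    and "\<forall>v \<in> pverts \<Gamma>. card (A v) \<ge> 2"
    and "is_generalization \<Gamma> H {w} \<Delta> A H'"
  shows "subgroup H' (racg \<Delta>) \<and>
    finitely_generated (racg \<Delta>\<lparr>carrier := H'\<rparr>) \<and>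
    \<not> quasiconvex (racg \<Delta>) (racg_gens \<Delta>) H' \<and>
    \<not> H' \<lhd> racg \<Delta> \<and>
    is_free (racg \<Delta>\<lparr>carrier := H'\<rparr>) \<and>
    one_ended (racg \<Delta>) \<and>
    (k > 2 \<longrightarrow>
      (\<forall>K. subgroup K (racg \<Delta>) \<and> finite_index K (racg \<Delta>) \<longrightarrow>
        \<not> (H' \<inter> K) \<lhd> (racg \<Delta>\<lparr>carrier := K\<rparr>)))"
proof -
  interpret pair_graph \<Delta> by fact
  define B where "B j = A (s (Suc j))" for j
  have vG: "pverts \<Gamma> = s ` {1..2 * k}"
    unfolding assms(3) complete_bipartite_def by auto
  have sG: "s (Suc j) \<in> pverts \<Gamma>" if "j < 2 * k" for j
    using that by (auto simp: vG)
  have s_eq: "s (Suc i) = s (Suc j) \<longleftrightarrow> i = j" if "i < 2 * k" "j < 2 * k" for i j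
    using that inj_on_eq_iff[OF assms(2), of "Suc i" "Suc j"] by auto
  have eG: "(s (Suc i), s (Suc j)) \<in> parcs \<Gamma> \<longleftrightarrow> even i \<noteq> even j" if ij: "i < 2 * k" "j < 2 * k" for i j
  proof -
    have mem: "s (Suc i) \<in> s ` {i \<in> {1..2 * k}. P i} \<longleftrightarrow> P (Suc i)" if "i < 2 * k" for i P
      using that inj_on_eq_iff[OF assms(2), of "Suc i"] by (auto simp: image_iff)
    show ?thesis unfolding assms(3) complete_bipartite_def
      using mem[OF ij(1), of odd] mem[OF ij(1), of even] mem[OF ij(2), of odd] mem[OF ij(2), of even] by auto
  qed
  note partite = assms(7)[unfolded partite_def, THEN conjunct1]
    assms(7)[unfolded partite_def, THEN conjunct2, THEN conjunct2, THEN conjunct1, rule_format]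
    assms(7)[unfolded partite_def, THEN conjunct2, THEN conjunct2, THEN conjunct2, THEN conjunct1, rule_format]
  have linked: "if (s (Suc i), s (Suc j)) \<in> parcs \<Gamma> then connected (with_proj \<Delta> \<restriction> (B i \<union> B j))
      else arcs (with_proj \<Delta> \<restriction> (B i \<union> B j)) = {}"
    if ij: "i < 2 * k" "j < 2 * k" "i \<noteq> j" for i j
  proof -
    have "s (Suc i) \<noteq> s (Suc j)" using s_eq[OF ij(1,2)] ij(3) by simp
    with assms(7)[unfolded partite_def, THEN conjunct2, THEN conjunct2, THEN conjunct2, THEN conjunct2,
        THEN bspec, OF sG[OF ij(1)], THEN bspec, OF sG[OF ij(2)]]
    show ?thesis unfolding B_def by (rule mp)
  qed
  have sub: "B j \<subseteq> pverts \<Delta>" if "j < 2 * k" for j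
    using partite(1) sG[OF that] by (auto simp: B_def)
  have arcs_sub: "(x, y) \<in> arcs_ends (with_proj \<Delta> \<restriction> S) \<longleftrightarrow> (x, y) \<in> parcs \<Delta> \<and> x \<in> S \<and> y \<in> S" for x y S
    by (auto simp: arcs_ends_def arc_to_ends_def induce_subgraph_def image_iff)
  interpret cycle_partite \<Delta> k B
  proof unfold_locales
    show "2 \<le> k" by fact
    show "pverts \<Delta> = (\<Union>j<2 * k. B j)"
    proof -
      have "{1..2 * k} = Suc ` {..<2 * k}" by (simp add: image_Suc_lessThan)
      then have "pverts \<Gamma> = (\<lambda>j. s (Suc j)) ` {..<2 * k}" by (simp add: vG image_image)
      then show ?thesis using partite(1) by (simp add: B_def)
    qed
    show "B i \<inter> B j = {}" if "i < 2 * k" "j < 2 * k" "i \<noteq> j" for i j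
      using partite(2) sG that s_eq unfolding B_def by metis
    show "even i \<noteq> even j"
      if e: "(a, b) \<in> parcs \<Delta>" and ij: "i < 2 * k" "j < 2 * k" and ab: "a \<in> B i" "b \<in> B j" for a b i j
    proof (rule ccontr)
      assume par: "\<not> even i \<noteq> even j"
      show False
      proof (cases "i = j")
        case True
        then show False using partite(3)[OF sG[OF ij(1)]] e ab by (simp add: B_def)
      next
        case False
        then have "arcs (with_proj \<Delta> \<restriction> (B i \<union> B j)) = {}"
          using linked[OF ij False] eG[OF ij] par by simp
        then show False using e ab by (auto simp: induce_subgraph_def)
      qed
    qed
    show card: "2 \<le> card (B j)" if "j < 2 * k" for j
      using assms(9) sG[OF that] by (simp add: B_def)
    show "\<exists>vs. distinct vs \<and> set vs = B i \<union> B j \<and>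
        (\<forall>x\<in>B i \<union> B j. \<forall>y\<in>B i \<union> B j. (x, y) \<in> parcs \<Delta> \<longleftrightarrow>
          (\<exists>m. Suc m < length vs \<and> (x = vs ! m \<and> y = vs ! Suc m \<or> y = vs ! m \<and> x = vs ! Suc m)))"
      if ij: "i < 2 * k" "j < 2 * k" and "even i" "odd j" for i j
    proof -
      let ?X = "with_proj \<Delta> \<restriction> (B i \<union> B j)"
      have ne: "s (Suc i) \<noteq> s (Suc j)" using s_eq[OF ij] that by auto
      have "connected ?X"
        using linked[OF ij] ne eG[OF ij] that by auto
      have "arcs ?X \<noteq> {}"
      proof
        assume empty: "arcs ?X = {}"
        obtain x y where xy: "x \<in> B i" "y \<in> B j" using card ij
          by (metis card.empty all_not_in_conv not_numeral_le_zero)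
        have "x \<noteq> y" using xy partite(2)[OF sG[OF ij(1)] sG[OF ij(2)] ne] by (auto simp: B_def)
        have "x \<rightarrow>\<^sup>*\<^bsub>with_proj (mk_symmetric ?X)\<^esub> y"
          using \<open>connected ?X\<close> xy by (simp add: connected_def strongly_connected_def mk_symmetric_def)
        moreover have "arcs_ends (with_proj (mk_symmetric ?X)) = {}"
          using empty by (simp add: mk_symmetric_def arcs_ends_def)
        ultimately show False using \<open>x \<noteq> y\<close> unfolding reachable_def
          by (metis empty_iff rtrancl_on.cases)
      qed
      then have "simple_path_graph ?X"
        using assms(8) sG ij ne unfolding path_connectors_def B_def by blast
      then obtain vs where vs: "distinct vs" "set vs = B i \<union> B j" and
        e: "arcs_ends ?X = (\<Union>i\<in>{i. Suc i < length vs}. {(vs ! i, vs ! Suc i), (vs ! Suc i, vs ! i)})"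
        unfolding simple_path_graph_def by auto
      have "(x, y) \<in> parcs \<Delta> \<longleftrightarrow>
          (\<exists>m. Suc m < length vs \<and> (x = vs ! m \<and> y = vs ! Suc m \<or> y = vs ! m \<and> x = vs ! Suc m))"
        if "x \<in> B i \<union> B j" "y \<in> B i \<union> B j" for x y
        using arcs_sub[of x y "B i \<union> B j"] that unfolding e by auto
      then show ?thesis using vs by blast
    qed
  qed
  have nth: "A (w ! j) = B j" if "j < 2 * k" for j
    using that by (simp add: assms(4) B_def del: upt_Suc)
  let ?X = "expand_labels A (rose_graph {w})"
  have lenw: "length w = 2 * k" by (simp add: assms(4))
  obtain L where L: "finite L" "generates_fundamental_group ?X Base L"
    and H': "H' = generate (racg \<Delta>) (racg_elem \<Delta> ` path_label ?X ` L)"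
    using assms(10) unfolding is_generalization_def Let_def by blast
  have wf: "wf_digraph (oriented ?X)"
    by unfold_locales (force simp: oriented_def expand_labels_def rose_graph_def split: if_splits)+
  have base: "Base \<in> verts ?X" by (simp add: expand_labels_def rose_graph_def)
  have lab: "label ?X e \<in> pverts \<Delta>" if "e \<in> arcs ?X" for e
    using that nth lenw by (auto simp: expand_labels_def rose_graph_def intro: sub[THEN subsetD])
  have H'_eq: "H' = cycle_partite.H \<Delta> k B"
    using generate_loop_labels[OF wf base lab L(2)] rose_loops_walks[OF lenw nth]
    by (simp add: H' H_def)
  have "racg_elem \<Delta> ` path_label ?X ` L \<subseteq> H'" unfolding H' by (auto intro: generate.incl)
  then have "finitely_generated (racg \<Delta>\<lparr>carrier := H'\<rparr>)"
    unfolding finitely_generated_def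
    using L(1) W.generate_consistent[OF _ subgroup_H, folded H'_eq] H'
    by (intro exI[of _ "racg_elem \<Delta> ` path_label ?X ` L"]) auto
  moreover have "one_ended (racg \<Delta>)"
    using one_endedI[OF no_separating_clique infinite_elements] .
  ultimately show ?thesis
    using subgroup_H not_quasiconvex_H not_normal_H is_free_H not_normal_in_finite_index
    unfolding H'_eq by blast
qed

end
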